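(* Assume that $$0<\varrho_0\in W^{1,\infty}(\mathbb R),\quad \underline J\le J_0\in L^\infty(\mathbb R),\quad \vartheta_0\ge 0,$$ $$\sqrt{\varrho_0}v_0,\ \sqrt{\varrho_0}v_0^2,\ \sqrt{\varrho_0}\vartheta_0,\ \sqrt{\varrho_0}J_0',\ v_0',\ \varrho_0^{3/2}\vartheta_0'\in L^2(\mathbb R),$$ where $\underline J$ is a positive constant, that $$\Big(\frac1{\sqrt{\varrho_0}}\Big)'\in L^\infty(\mathbb R),\quad \varrho_0\in L^1(\mathbb R),\quad \sqrt{\varrho_0}\vartheta_0'\in L^2(\mathbb R),\quad \frac{J_0'}{\sqrt{\varrho_0}}\in L^2(\mathbb R),$$ and that $$\Big(\frac1{\varrho_0}\Big)''\in L^\infty(\mathbb R).$$ Let $(J,v,\vartheta)$ be the unique global solution with initial data $(J_0,v_0,\vartheta_0)$ and let $s$ be its entropy. If $s$ is bounded from below at $t=0$, i.e. $\inf_{\mathbb R}s|_{t=0}>-\infty$, then for every $T\in(0,\infty)$ $$\inf_{(y,t)\in\mathbb R\times(0,T)}s(y,t)>-\infty .$$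
   Context: $\mu,\kappa,c_v,R,A$ are positive constants and $\gamma:=1+R/c_v>1$. The one-dimensional heat conductive compressible Navier--Stokes system in Lagrangian coordinates, for unknowns $(J,v,\vartheta)(y,t)$, $y\in\mathbb R$, with a given function $\varrho_0=\varrho_0(y)$ (the initial density), is $$J_t=v_y,\qquad \varrho_0v_t-\mu\Big(\frac{v_y}{J}\Big)_y+R\Big(\frac{\varrho_0}{J}\vartheta\Big)_y=0,\qquad c_v\varrho_0\vartheta_t-\kappa\Big(\frac{\vartheta_y}{J}\Big)_y+R\frac{\varrho_0}{J}\vartheta v_y=\mu\frac{|v_y|^2}{J},$$ with initial condition $(J,v,\vartheta)|_{t=0}=(J_0,v_0,\vartheta_0)$. A prime denotes $d/dy$. A triple $(J,v,\vartheta)$ is called a solution in $\mathbb R\times(0,\mathcal T)$ if $0<J,J^{-1}\in L^\infty(\mathbb R\times(0,\mathcal T))$, $\vartheta\ge0$, $$J_t,\ \sqrt{\varrho_0}J_y,\ \sqrt{\varrho_0}v,\ \sqrt{\varrho_0}v^2,\ v_y,\ \sqrt{\varrho_0}\vartheta,\ \varrho_0^{3/2}\vartheta_y\in L^\infty(0,\mathcal T;L^2(\mathbb R)),$$ $$\sqrt{\varrho_0}J_{yt},\ vv_y,\ \sqrt{\varrho_0}v_t,\ \sqrt{\varrho_0}v_{yy},\ \vartheta_y,\ \varrho_0\Big(\frac{\vartheta_y}{J}\Big)_y,\ \varrho_0^2\vartheta_t\in L^2(0,\mathcal T;L^2(\mathbb R)),$$ the equations hold a.e. in $\mathbb R\times(0,\mathcal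 T)$ and the initial condition is satisfied; it is global if it is a solution in $\mathbb R\times(0,\mathcal T)$ for every $\mathcal T<\infty$. Under the first two groups of hypotheses of the claim, a global solution exists and is unique. The entropy is $$s=c_v\Big(\log\frac RA+(\gamma-1)\log J+\log\vartheta-(\gamma-1)\log\varrho_0\Big)$$ (with $s=-\infty$ where $\vartheta=0$). *)

theory Defs
  imports "HOL-Analysis.Analysis" "HOL-Probability.Essential_Supremum"
begin

section \<open>Test functions and weak derivatives\<close>

primrec C_k :: "nat \<Rightarrow> ('a::euclidean_space \<Rightarrow> real) \<Rightarrow> bool" where
  "C_k 0 f \<longleftrightarrow> continuous_on UNIV f"
| "C_k (Suc k) f \<longleftrightarrow> f differentiable_on UNIV \<and>
     (\<forall>b\<in>Basis. C_k k (\<lambda>x. frechet_derivative f (at x) b))"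

definition test_function :: "'a::euclidean_space set \<Rightarrow> ('a \<Rightarrow> real) \<Rightarrow> bool" where
  "test_function \<Omega> \<phi> \<longleftrightarrow> (\<forall>k. C_k k \<phi>) \<and>
     (\<exists>K. compact K \<and> K \<subseteq> \<Omega> \<and> (\<forall>x. x \<notin> K \<longrightarrow> \<phi> x = 0))"

definition locally_integrable :: "'a::euclidean_space set \<Rightarrow> ('a \<Rightarrow> real) \<Rightarrow> bool" where
  "locally_integrable \<Omega> f \<longleftrightarrow> (\<forall>K. compact K \<longrightarrow> K \<subseteq> \<Omega> \<longrightarrow> set_integrable lborel K f)"

text \<open>\<open>weak_deriv \<Omega> b f g\<close>: on the open set \<open>\<Omega>\<close>, the function \<open>g\<close> is the distributional
  derivative of \<open>f\<close> in the coordinate direction \<open>b\<close>.\<close>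

definition weak_deriv ::
    "'a::euclidean_space set \<Rightarrow> 'a \<Rightarrow> ('a \<Rightarrow> real) \<Rightarrow> ('a \<Rightarrow> real) \<Rightarrow> bool" where
  "weak_deriv \<Omega> b f g \<longleftrightarrow> locally_integrable \<Omega> f \<and> locally_integrable \<Omega> g \<and>
     (\<forall>\<phi>. test_function \<Omega> \<phi> \<longrightarrow>
        (LINT x:\<Omega>|lborel. f x * frechet_derivative \<phi> (at x) b)
          = - (LINT x:\<Omega>|lborel. g x * \<phi> x))"

abbreviation weak_deriv1 :: "(real \<Rightarrow> real) \<Rightarrow> (real \<Rightarrow> real) \<Rightarrow> bool" where
  "weak_deriv1 \<equiv> weak_deriv UNIV 1"


section \<open>Lebesgue and Bochner spaces\<close>

text \<open>Membership is expressed through Borel measurable representatives.\<close>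

definition L_infty :: "'a::euclidean_space set \<Rightarrow> ('a \<Rightarrow> real) \<Rightarrow> bool" where
  "L_infty \<Omega> f \<longleftrightarrow> set_borel_measurable lborel \<Omega> f \<and>
     (\<exists>C. AE x in lborel. x \<in> \<Omega> \<longrightarrow> \<bar>f x\<bar> \<le> C)"

definition L2 :: "(real \<Rightarrow> real) \<Rightarrow> bool" where
  "L2 f \<longleftrightarrow> f \<in> borel_measurable lborel \<and> integrable lborel (\<lambda>y. (f y)\<^sup>2)"

text \<open>Points of space-time are pairs \<open>(y, t)\<close>.\<close>

definition strip :: "real \<Rightarrow> (real \<times> real) set" where
  "strip T = UNIV \<times> {0<..<T}"

definition L_infty_L2 :: "real \<Rightarrow> (real \<times> real \<Rightarrow> real) \<Rightarrow> bool" where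
  "L_infty_L2 T f \<longleftrightarrow> set_borel_measurable lborel (strip T) f \<and>
     (\<exists>C::real. AE t in lborel. t \<in> {0<..<T} \<longrightarrow>
        (\<integral>\<^sup>+ y. ennreal ((f (y, t))\<^sup>2) \<partial>lborel) \<le> ennreal C)"

definition L2_L2 :: "real \<Rightarrow> (real \<times> real \<Rightarrow> real) \<Rightarrow> bool" where
  "L2_L2 T f \<longleftrightarrow> set_borel_measurable lborel (strip T) f \<and>
     (\<integral>\<^sup>+ t\<in>{0<..<T}. (\<integral>\<^sup>+ y. ennreal ((f (y, t))\<^sup>2) \<partial>lborel) \<partial>lborel) < \<infinity>"

definition ess_inf :: "'a measure \<Rightarrow> ('a \<Rightarrow> ereal) \<Rightarrow> ereal" where
  "ess_inf M f = - esssup M (\<lambda>x. - f x)"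

lemma ess_inf_eq_INF:
  fixes f :: "'a::euclidean_space \<Rightarrow> ereal"
  assumes "open \<Omega>" and f: "continuous_on \<Omega> f"
  shows "ess_inf (restrict_space lborel \<Omega>) f = (INF x\<in>\<Omega>. f x)"
proof (rule antisym)
  have \<Omega>: "\<Omega> \<in> sets borel" using \<open>open \<Omega>\<close> by simp
  let ?M = "restrict_space lborel \<Omega>"
  have meas: "(\<lambda>x. - f x) \<in> borel_measurable ?M"
  proof -
    have "f \<in> borel_measurable (restrict_space borel \<Omega>)"
      by (rule borel_measurable_continuous_on_restrict[OF f])
    then have "f \<in> borel_measurable ?M"
      by (simp add: measurable_def sets_restrict_space space_restrict_space)
    then show ?thesis by simp
  qed
  have "esssup ?M (\<lambda>x. - f x) \<le> - (INF x\<in>\<Omega>. f x)"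
    by (rule esssup_I[OF meas]) (auto intro!: AE_I2 INF_lower simp: space_restrict_space)
  then show "(INF x\<in>\<Omega>. f x) \<le> ess_inf ?M f"
    unfolding ess_inf_def by (metis ereal_minus_le_minus ereal_uminus_uminus)
  define e where "e = ess_inf ?M f"
  have "AE x in ?M. - f x \<le> - e"
    using esssup_AE[of "\<lambda>x. - f x" ?M] by (simp add: e_def ess_inf_def)
  then have AE: "AE x in lborel. x \<in> \<Omega> \<longrightarrow> e \<le> f x"
    using \<Omega> by (simp add: AE_restrict_space_iff)
  have op: "open (f -` {..<e} \<inter> \<Omega>)"
    using f \<open>open \<Omega>\<close> by (simp add: continuous_on_open_vimage)
  have "f -` {..<e} \<inter> \<Omega> \<in> null_sets lborel"
    using AE op by (subst AE_iff_null_sets) (auto elim!: eventually_mono)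
  then have "f -` {..<e} \<inter> \<Omega> = {}"
    using op open_not_negligible[of "f -` {..<e} \<inter> \<Omega>"]
    by (auto simp: negligible_iff_null_sets null_sets_completionI)
  then show "ess_inf ?M f \<le> (INF x\<in>\<Omega>. f x)"
    unfolding e_def[symmetric] by (intro INF_greatest) (force simp: not_less[symmetric])
qed


section \<open>The Navier--Stokes system in Lagrangian coordinates\<close>

text \<open>Attainment of the initial value \<open>f0\<close>: essential limit in \<open>L\<^sup>2\<close> of bounded intervals
  as \<open>t\<close> tends to \<open>0\<close> from the right. Independent of the representative of \<open>f\<close>; for \<open>f\<close> with
  \<open>f\<^sub>t\<close> in \<open>L\<^sup>2((a,b) \<times> (0,T))\<close> for all \<open>a < b\<close>, it says that
  the representative in \<open>C([0,T]; L\<^sup>2(a,b))\<close> equals \<open>f0\<close> at \<open>t = 0\<close>.\<close>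

definition attains_initial :: "(real \<times> real \<Rightarrow> real) \<Rightarrow> (real \<Rightarrow> real) \<Rightarrow> bool" where
  "attains_initial f f0 \<longleftrightarrow> (\<forall>a b \<epsilon>::real. \<epsilon> > 0 \<longrightarrow>
     (\<exists>\<delta>>0. AE t in lborel. 0 < t \<and> t < \<delta> \<longrightarrow>
        (\<integral>\<^sup>+ y\<in>{a..b}. ennreal ((f (y, t) - f0 y)\<^sup>2) \<partial>lborel) < ennreal \<epsilon>))"

text \<open>The bound functions are the weak derivatives of the solution:
  \<open>Fy\<close> is \<open>(v\<^sub>y/J)\<^sub>y\<close>, \<open>Py\<close> is \<open>(\<rho>\<^sub>0\<theta>/J)\<^sub>y\<close>, \<open>Qy\<close> is \<open>(\<theta>\<^sub>y/J)\<^sub>y\<close>.\<close>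

definition NS_solution ::
    "real \<Rightarrow> real \<Rightarrow> real \<Rightarrow> real \<Rightarrow> (real \<Rightarrow> real) \<Rightarrow>
     (real \<Rightarrow> real) \<Rightarrow> (real \<Rightarrow> real) \<Rightarrow> (real \<Rightarrow> real) \<Rightarrow> real \<Rightarrow>
     (real \<times> real \<Rightarrow> real) \<Rightarrow> (real \<times> real \<Rightarrow> real) \<Rightarrow> (real \<times> real \<Rightarrow> real) \<Rightarrow> bool" where
  "NS_solution \<mu> \<kappa> cv R \<rho>0 J0 v0 \<theta>0 T J v \<theta> \<longleftrightarrow>
    (AE z in lborel. z \<in> strip T \<longrightarrow> 0 < J z) \<and>
    L_infty (strip T) J \<and> L_infty (strip T) (\<lambda>z. inverse (J z)) \<and>
    (AE z in lborel. z \<in> strip T \<longrightarrow> 0 \<le> \<theta> z) \<and>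
    (\<exists>Jt Jy Jyt vt vy vyy \<theta>t \<theta>y Fy Py Qy.
      weak_deriv (strip T) (0, 1) J Jt \<and>
      weak_deriv (strip T) (1, 0) J Jy \<and>
      weak_deriv (strip T) (0, 1) Jy Jyt \<and>
      weak_deriv (strip T) (0, 1) v vt \<and>
      weak_deriv (strip T) (1, 0) v vy \<and>
      weak_deriv (strip T) (1, 0) vy vyy \<and>
      weak_deriv (strip T) (0, 1) \<theta> \<theta>t \<and>
      weak_deriv (strip T) (1, 0) \<theta> \<theta>y \<and>
      weak_deriv (strip T) (1, 0) (\<lambda>z. vy z / J z) Fy \<and>
      weak_deriv (strip T) (1, 0) (\<lambda>(y, t). \<rho>0 y / J (y, t) * \<theta> (y, t)) Py \<and>
      weak_deriv (strip T) (1, 0) (\<lambda>z. \<theta>y z / J z) Qy \<and>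
      L_infty_L2 T Jt \<and>
      L_infty_L2 T (\<lambda>(y, t). sqrt (\<rho>0 y) * Jy (y, t)) \<and>
      L_infty_L2 T (\<lambda>(y, t). sqrt (\<rho>0 y) * v (y, t)) \<and>
      L_infty_L2 T (\<lambda>(y, t). sqrt (\<rho>0 y) * (v (y, t))\<^sup>2) \<and>
      L_infty_L2 T vy \<and>
      L_infty_L2 T (\<lambda>(y, t). sqrt (\<rho>0 y) * \<theta> (y, t)) \<and>
      L_infty_L2 T (\<lambda>(y, t). \<rho>0 y powr (3/2) * \<theta>y (y, t)) \<and>
      L2_L2 T (\<lambda>(y, t). sqrt (\<rho>0 y) * Jyt (y, t)) \<and>
      L2_L2 T (\<lambda>z. v z * vy z) \<and>
      L2_L2 T (\<lambda>(y, t). sqrt (\<rho>0 y) * vt (y, t)) \<and>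
      L2_L2 T (\<lambda>(y, t). sqrt (\<rho>0 y) * vyy (y, t)) \<and>
      L2_L2 T \<theta>y \<and>
      L2_L2 T (\<lambda>(y, t). \<rho>0 y * Qy (y, t)) \<and>
      L2_L2 T (\<lambda>(y, t). (\<rho>0 y)\<^sup>2 * \<theta>t (y, t)) \<and>
      (AE (y, t) in lborel. (y, t) \<in> strip T \<longrightarrow>
         Jt (y, t) = vy (y, t) \<and>
         \<rho>0 y * vt (y, t) - \<mu> * Fy (y, t) + R * Py (y, t) = 0 \<and>
         cv * \<rho>0 y * \<theta>t (y, t) - \<kappa> * Qy (y, t)
           + R * (\<rho>0 y / J (y, t)) * \<theta> (y, t) * vy (y, t)
           = \<mu> * (\<bar>vy (y, t)\<bar>\<^sup>2 / J (y, t)))) \<and>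
    attains_initial J J0 \<and> attains_initial v v0 \<and> attains_initial \<theta> \<theta>0"

definition NS_global_solution ::
    "real \<Rightarrow> real \<Rightarrow> real \<Rightarrow> real \<Rightarrow> (real \<Rightarrow> real) \<Rightarrow>
     (real \<Rightarrow> real) \<Rightarrow> (real \<Rightarrow> real) \<Rightarrow> (real \<Rightarrow> real) \<Rightarrow>
     (real \<times> real \<Rightarrow> real) \<Rightarrow> (real \<times> real \<Rightarrow> real) \<Rightarrow> (real \<times> real \<Rightarrow> real) \<Rightarrow> bool" where
  "NS_global_solution \<mu> \<kappa> cv R \<rho>0 J0 v0 \<theta>0 J v \<theta> \<longleftrightarrow>
     (\<forall>T>0. NS_solution \<mu> \<kappa> cv R \<rho>0 J0 v0 \<theta>0 T J v \<theta>)"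

definition adiabatic :: "real \<Rightarrow> real \<Rightarrow> real" where
  "adiabatic cv R = 1 + R / cv"

text \<open>Entropy as a function of the values \<open>r\<close>, \<open>j\<close>, \<open>th\<close> of \<open>\<rho>\<^sub>0\<close>, \<open>J\<close>, \<open>\<theta>\<close> at a point.\<close>

definition entropy :: "real \<Rightarrow> real \<Rightarrow> real \<Rightarrow> real \<Rightarrow> real \<Rightarrow> real \<Rightarrow> ereal" where
  "entropy cv R A r j th =
     (if th = 0 then - \<infinity>
      else ereal (cv * (ln (R / A) + (adiabatic cv R - 1) * ln j + ln th
                        - (adiabatic cv R - 1) * ln r)))"

end

theory Submission
  imports Defs
begin

text \<open>
  Put \<open>\<alpha> = R / c\<^sub>v\<close>. Since \<open>J\<close> is bounded above and below on the strip, the claim is a lower bound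
  \<open>\<theta> \<ge> c \<rho>\<^sub>0\<^sup>\<alpha>\<close>. Completing the square in the viscous heating shows
  \<open>c\<^sub>v \<rho>\<^sub>0 \<theta>\<^sub>t \<ge> \<kappa> (\<theta>\<^sub>y / J)\<^sub>y - R\<^sup>2 \<rho>\<^sub>0\<^sup>2 \<theta>\<^sup>2 / (4 \<mu> J)\<close>, and \<open>\<theta>\<close> is compared with
  \<open>w = \<delta> exp (- K t - E)\<close>, where \<open>E(y, t) = \<integral>\<^sub>0\<^sup>y J e\<close> for a fixed weight \<open>e = e(y)\<close>. Then
  \<open>(w\<^sub>y / J)\<^sub>y = w (J e\<^sup>2 - e')\<close> contains no derivative of \<open>J\<close>, and
  \<open>E\<^sub>t = \<integral>\<^sub>0\<^sup>y v\<^sub>y e\<close> is bounded by the Cauchy--Schwarz inequality as soon as \<open>\<bar>e\<bar> \<le> C \<surd>\<rho>\<^sub>0\<close>; if also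
  \<open>\<bar>e'\<bar> \<le> C \<rho>\<^sub>0\<close>, then \<open>w\<close> is a subsolution for large \<open>K\<close>. It remains to choose \<open>e\<close> such that
  \<open>\<integral>\<^sub>0\<^sup>y J\<^sub>0 e = - \<alpha> ln \<rho>\<^sub>0 + O(1)\<close>, which makes \<open>w\<close> comparable to \<open>\<rho>\<^sub>0\<^sup>\<alpha>\<close>. The comparison
  \<open>w \<le> \<theta>\<close> follows by testing with the square of the positive part of \<open>w - \<theta>\<close> times a spatial cutoff
  of width \<open>N\<close>, whose contribution is \<open>O(1 / N)\<close>.
\<close>

section \<open>Primitives of locally integrable functions\<close>

text \<open>For the obvious candidate \<open>\<delta> exp (- K t) \<rho>0 powr \<alpha>\<close> the
  derivative of the flux contains the space derivative of \<open>J\<close>, which is controlled only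
  in weighted L2 spaces; this is why the exponent carries the factor \<open>J\<close>. The price is
  an exponent that moves in time, and the rate \<open>K\<close> has to absorb this motion as well.
  The quadratic sink is harmless because \<open>w\<close> stays below a constant \<open>W\<close>,
  which makes it linear in \<open>w\<close>. As \<theta> is nonnegative, the positive part of
  \<open>w - \<theta>\<close> lies between 0 and \<open>W\<close>, and this bound replaces any decay
  of \<theta> at infinity in the cutoff argument. The square of the positive part is a C^1 function,
  unlike its first power, so a chain rule for C^1 functions applies; the energy is then cubic. Weak
  derivatives enter only through \<open>primitive_on\<close>: on almost every line parallel to an
  axis the solution agrees with an everywhere defined function that is the integral of its
  derivative, and all integrations by parts take place on such lines. The integral identity, not
  pointwise differentiability, is the defining property, so the derivative may be any measurable
  representative.\<close>

definition primitive_on :: "real set \<Rightarrow> (real \<Rightarrow> real) \<Rightarrow> (real \<Rightarrow> real) \<Rightarrow> bool" where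
  "primitive_on I u g \<longleftrightarrow> (\<forall>a\<in>I. \<forall>b\<in>I. a \<le> b \<longrightarrow>
     set_integrable lborel {a..b} g \<and> u b - u a = (LINT x:{a..b}|lborel. g x))"

lemma primitive_onD:
  assumes "primitive_on I u g" "a \<in> I" "b \<in> I" "a \<le> b"
  shows "set_integrable lborel {a..b} g" "u b - u a = (LINT x:{a..b}|lborel. g x)"
  using assms unfolding primitive_on_def by auto

lemma primitive_on_subset: "primitive_on I u g \<Longrightarrow> K \<subseteq> I \<Longrightarrow> primitive_on K u g"
  unfolding primitive_on_def by blast

lemma set_integral_combine_ivl:
  fixes g :: "real \<Rightarrow> real"
  assumes "set_integrable lborel {a..c} g" "a \<le> b" "b \<le> c"
  shows "(LINT x:{a..c}|lborel. g x) = (LINT x:{a..b}|lborel. g x) + (LINT x:{b..c}|lborel. g x)"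
proof -
  have "set_integrable lborel {a..b} g" "set_integrable lborel {b..c} g"
    using assms by (auto intro: set_integrable_subset[OF assms(1)])
  then show ?thesis
    using assms Henstock_Kurzweil_Integration.integral_combine[of a b c g]
    by (simp add: set_borel_integral_eq_integral)
qed

lemma set_integrable_combine_ivl:
  fixes g :: "real \<Rightarrow> real"
  assumes "set_integrable lborel {a..b} g" "set_integrable lborel {b..c} g" "a \<le> b" "b \<le> c"
  shows "set_integrable lborel {a..c} g"
  using set_integrable_Un[OF assms(1,2)] assms(3,4) by (simp add: ivl_disj_un_two_touch)

lemma primitive_on_continuous_ivl:
  assumes "primitive_on I u g" "a \<in> I" "{a..b} \<subseteq> I"
  shows "continuous_on {a..b} u"
proof (cases "a \<le> b")
  case True
  then have b: "b \<in> I" using assms by auto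
  have "set_integrable lborel {a..b} g"
    using primitive_onD[OF assms(1,2) b True] by simp
  then have "continuous_on {a..b} (\<lambda>x. integral {a..x} g)"
    by (intro indefinite_integral_continuous_1) (simp add: set_borel_integral_eq_integral)
  moreover have "u x = u a + integral {a..x} g" if "x \<in> {a..b}" for x
  proof -
    have "x \<in> I" using that assms by auto
    then show ?thesis
      using primitive_onD[OF assms(1,2), of x] that by (simp add: set_borel_integral_eq_integral)
  qed
  ultimately show ?thesis
    using continuous_on_eq[OF continuous_on_add[OF continuous_on_const]] by metis
qed simp

lemma primitive_on_UNIV_continuous:
  assumes "primitive_on UNIV u g"
  shows "continuous_on UNIV u"
proof -
  have "isCont u x" for x
  proof -
    have "continuous_on {x-1..x+1} u"
      by (rule primitive_on_continuous_ivl[OF assms]) auto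
    then have "continuous_on {x-1<..<x+1} u"
      by (rule continuous_on_subset) auto
    then show ?thesis
      by (rule continuous_on_interior) simp
  qed
  then show ?thesis by (simp add: continuous_on_eq_continuous_at)
qed

lemma set_integrable_continuous_mult:
  fixes h g :: "real \<Rightarrow> real"
  assumes h: "continuous_on {a..b} h" and g: "set_integrable lborel {a..b} g"
  shows "set_integrable lborel {a..b} (\<lambda>x. h x * g x)"
proof -
  obtain C where C: "\<And>x. x \<in> {a..b} \<Longrightarrow> \<bar>h x\<bar> \<le> C"
  proof -
    have "compact (h ` {a..b})" by (rule compact_continuous_image[OF h]) simp
    then have "bounded (h ` {a..b})" by (rule compact_imp_bounded)
    then obtain C where "\<forall>x\<in>{a..b}. \<bar>h x\<bar> \<le> C" unfolding bounded_iff by auto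
    then show ?thesis by (intro that) auto
  qed
  have hm: "set_borel_measurable lborel {a..b} h"
    using borel_measurable_continuous_on_indicator[OF _ h] unfolding set_borel_measurable_def by simp
  have gm: "set_borel_measurable lborel {a..b} g"
    using g unfolding set_integrable_def set_borel_measurable_def by auto
  have "(\<lambda>x. (indicator {a..b} x *\<^sub>R h x) * (indicator {a..b} x *\<^sub>R g x)) \<in> borel_measurable lborel"
    using hm gm unfolding set_borel_measurable_def by (rule borel_measurable_times)
  also have "(\<lambda>x. (indicator {a..b} x *\<^sub>R h x) * (indicator {a..b} x *\<^sub>R g x)) =
      (\<lambda>x. indicator {a..b} x *\<^sub>R (h x * g x))" by (auto simp: indicator_def)
  finally have m: "set_borel_measurable lborel {a..b} (\<lambda>x. h x * g x)"
    unfolding set_borel_measurable_def .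
  show ?thesis
  proof (rule set_integrable_bound[OF _ m])
    show "set_integrable lborel {a..b} (\<lambda>x. C * g x)" using g by simp
    show "AE x in lborel. x \<in> {a..b} \<longrightarrow> norm (h x * g x) \<le> norm (C * g x)"
      using C by (intro AE_I2) (auto simp: abs_mult intro!: mult_right_mono order_trans[OF C])
  qed
qed

lemma set_integral_abs_bound:
  fixes g :: "'a \<Rightarrow> real"
  assumes "set_integrable M A g"
  shows "\<bar>LINT x:A|M. g x\<bar> \<le> (LINT x:A|M. \<bar>g x\<bar>)"
  using set_integral_norm_bound[OF assms] by simp

text \<open>The additive interval function \<open>\<epsilon> \<integral> \<bar>g\<bar>\<close> dominates the defect of the chain rule on all
  short intervals, so Bolzano's bisection principle propagates the estimate to \<open>{a..b}\<close>.\<close>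

lemma primitive_on_chain:
  assumes I: "is_interval I" and u: "primitive_on I u g"
    and S: "open S" "\<And>x. x \<in> I \<Longrightarrow> u x \<in> S"
    and \<Phi>: "\<And>r. r \<in> S \<Longrightarrow> (\<Phi> has_real_derivative \<phi> r) (at r)" and \<phi>: "continuous_on S \<phi>"
  shows "primitive_on I (\<lambda>x. \<Phi> (u x)) (\<lambda>x. \<phi> (u x) * g x)"
  unfolding primitive_on_def
proof (intro ballI impI)
  fix a b assume a: "a \<in> I" and b: "b \<in> I" and ab: "a \<le> b"
  have sub: "{a..b} \<subseteq> I"
    using a b I by (meson atLeastAtMost_iff is_interval_1 subsetI)
  have gi: "set_integrable lborel {a..b} g" using primitive_onD[OF u a b ab] by simp
  have uc: "continuous_on {a..b} u" by (rule primitive_on_continuous_ivl[OF u a sub])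
  have \<phi>u: "continuous_on {a..b} (\<lambda>x. \<phi> (u x))"
    by (rule continuous_on_compose2[OF \<phi> uc]) (use sub S in auto)
  have int: "set_integrable lborel {a..b} (\<lambda>x. \<phi> (u x) * g x)"
    by (rule set_integrable_continuous_mult[OF \<phi>u gi])
  have gabs: "set_integrable lborel {a..b} (\<lambda>x. \<bar>g x\<bar>)" by (rule set_integrable_abs[OF gi])
  define F where "F c d = \<Phi> (u d) - \<Phi> (u c) - (LINT x:{c..d}|lborel. \<phi> (u x) * g x)" for c d
  have small: "\<bar>F a b\<bar> \<le> 2 * \<epsilon> * (LINT x:{a..b}|lborel. \<bar>g x\<bar>)" if \<epsilon>: "\<epsilon> > 0" for \<epsilon>
  proof -
    define P where "P c d \<longleftrightarrow> (a \<le> c \<and> c \<le> d \<and> d \<le> b \<longrightarrow>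
        \<bar>F c d\<bar> \<le> 2 * \<epsilon> * (LINT x:{c..d}|lborel. \<bar>g x\<bar>))" for c d
    have "P a b"
      using ab
    proof (induction rule: Bolzano)
      case (trans c d e)
      show ?case
        unfolding P_def
      proof
        assume ce: "a \<le> c \<and> c \<le> e \<and> e \<le> b"
        have i1: "set_integrable lborel {c..e} (\<lambda>x. \<phi> (u x) * g x)"
             "set_integrable lborel {c..e} (\<lambda>x. \<bar>g x\<bar>)"
          using ce by (auto intro: set_integrable_subset[OF int] set_integrable_subset[OF gabs])
        have "F c e = F c d + F d e"
          unfolding F_def using set_integral_combine_ivl[OF i1(1)] trans by simp
        moreover have "\<bar>F c d\<bar> \<le> 2 * \<epsilon> * (LINT x:{c..d}|lborel. \<bar>g x\<bar>)"
             "\<bar>F d e\<bar> \<le> 2 * \<epsilon> * (LINT x:{d..e}|lborel. \<bar>g x\<bar>)"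
          using trans ce unfolding P_def by auto
        ultimately show "\<bar>F c e\<bar> \<le> 2 * \<epsilon> * (LINT x:{c..e}|lborel. \<bar>g x\<bar>)"
          using set_integral_combine_ivl[OF i1(2)] trans by (simp add: algebra_simps)
      qed
    next
      case (local x)
      have xS: "u x \<in> S" using local sub S by auto
      have "isCont \<phi> (u x)" using \<phi> S(1) xS by (simp add: continuous_on_eq_continuous_at)
      then obtain \<eta>1 where \<eta>1: "\<eta>1 > 0" "\<And>r. \<bar>r - u x\<bar> < \<eta>1 \<Longrightarrow> \<bar>\<phi> r - \<phi> (u x)\<bar> < \<epsilon>"
        using \<epsilon> unfolding continuous_at_eps_delta dist_real_def by (metis dist_real_def)
      obtain \<eta>2 where \<eta>2: "\<eta>2 > 0" "ball (u x) \<eta>2 \<subseteq> S" using S(1) xS by (meson open_contains_ball)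
      define \<eta> where "\<eta> = min \<eta>1 \<eta>2"
      have \<eta>: "\<eta> > 0" using \<eta>1 \<eta>2 by (simp add: \<eta>_def)
      obtain d where d: "d > 0" "\<And>y. y \<in> {a..b} \<Longrightarrow> \<bar>y - x\<bar> < d \<Longrightarrow> \<bar>u y - u x\<bar> < \<eta>"
        using uc local \<eta> unfolding continuous_on_iff dist_real_def
        by (metis atLeastAtMost_iff)
      show ?case
      proof (intro exI[of _ d] conjI d(1) allI impI)
        fix c e assume ce: "c \<le> x \<and> x \<le> e \<and> e - c < d"
        show "P c e"
          unfolding P_def
        proof
          assume ce': "a \<le> c \<and> c \<le> e \<and> e \<le> b"
          have cI: "c \<in> I" "e \<in> I" using ce' sub by auto
          have near: "\<bar>u y - u x\<bar> < \<eta>" if "y \<in> {c..e}" for y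
            using that ce ce' by (intro d(2)) auto
          have i1: "set_integrable lborel {c..e} (\<lambda>x. \<phi> (u x) * g x)"
             "set_integrable lborel {c..e} (\<lambda>x. \<bar>g x\<bar>)" "set_integrable lborel {c..e} g"
            using ce' by (auto intro: set_integrable_subset[OF int] set_integrable_subset[OF gabs]
                set_integrable_subset[OF gi])
          have du: "u e - u c = (LINT x:{c..e}|lborel. g x)"
            using primitive_onD(2)[OF u cI] ce' by simp
          \<comment> \<open>The mean value inequality for the function
            \<open>\<Phi> r - \<phi> (u x) r\<close>, whose derivative is at most
            \<open>\<epsilon>\<close> in modulus on the ball, replaces \<open>\<Phi>\<close> by its
            tangent at \<open>u x\<close>.\<close>
          have "\<bar>(\<Phi> (u e) - \<phi> (u x) * u e) - (\<Phi> (u c) - \<phi> (u x) * u c)\<bar> \<le> \<epsilon> * \<bar>u e - u c\<bar>"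
          proof -
            have "norm ((\<lambda>r. \<Phi> r - \<phi> (u x) * r) (u e) - (\<lambda>r. \<Phi> r - \<phi> (u x) * r) (u c))
                \<le> \<epsilon> * norm (u e - u c)"
            proof (rule field_differentiable_bound[where S = "ball (u x) \<eta>" and f' = "\<lambda>r. \<phi> r - \<phi> (u x)"])
              fix r assume "r \<in> ball (u x) \<eta>"
              then have r: "\<bar>r - u x\<bar> < \<eta>" by (simp add: dist_real_def abs_minus_commute)
              then have "r \<in> S" using \<eta>2 by (auto simp: \<eta>_def dist_real_def abs_minus_commute)
              then show "((\<lambda>r. \<Phi> r - \<phi> (u x) * r) has_field_derivative \<phi> r - \<phi> (u x)) (at r within ball (u x) \<eta>)"
                by (auto intro!: derivative_eq_intros has_field_derivative_at_within[OF \<Phi>])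
              show "norm (\<phi> r - \<phi> (u x)) \<le> \<epsilon>"
                using \<eta>1(2)[of r] r by (simp add: \<eta>_def)
            qed (use near[of c] near[of e] ce' in \<open>auto simp: dist_real_def abs_minus_commute\<close>)
            then show ?thesis by simp
          qed
          also have "\<epsilon> * \<bar>u e - u c\<bar> \<le> \<epsilon> * (LINT x:{c..e}|lborel. \<bar>g x\<bar>)"
            using set_integral_abs_bound[OF i1(3)] \<epsilon> du by (intro mult_left_mono) auto
          finally have 1: "\<bar>\<Phi> (u e) - \<Phi> (u c) - \<phi> (u x) * (u e - u c)\<bar>
              \<le> \<epsilon> * (LINT x:{c..e}|lborel. \<bar>g x\<bar>)" by (simp add: algebra_simps)
          \<comment> \<open>The second half of the defect is the oscillation of
            \<open>\<phi>\<close> along \<open>u\<close> integrated against \<open>g\<close>; it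
            costs another \<open>\<epsilon>\<close> times the integral of
            \<open>\<bar>g\<bar>\<close>, hence the factor 2.\<close>
          have "\<phi> (u x) * (u e - u c) - (LINT y:{c..e}|lborel. \<phi> (u y) * g y)
              = (LINT y:{c..e}|lborel. \<phi> (u x) * g y - \<phi> (u y) * g y)"
            using i1 by (simp add: du)
          also have "\<bar>\<dots>\<bar> \<le> (LINT y:{c..e}|lborel. \<bar>\<phi> (u x) * g y - \<phi> (u y) * g y\<bar>)"
            by (rule set_integral_abs_bound) (use i1 in auto)
          also have "\<dots> \<le> (LINT y:{c..e}|lborel. \<epsilon> * \<bar>g y\<bar>)"
          proof (rule set_integral_mono)
            show "set_integrable lborel {c..e} (\<lambda>y. \<bar>\<phi> (u x) * g y - \<phi> (u y) * g y\<bar>)"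
              by (rule set_integrable_abs) (use i1 in auto)
            show "set_integrable lborel {c..e} (\<lambda>y. \<epsilon> * \<bar>g y\<bar>)" using i1 by auto
            fix y assume "y \<in> {c..e}"
            then have "\<bar>\<phi> (u y) - \<phi> (u x)\<bar> < \<epsilon>" using near[of y] \<eta>1(2) by (simp add: \<eta>_def)
            then have "\<bar>\<phi> (u x) - \<phi> (u y)\<bar> * \<bar>g y\<bar> \<le> \<epsilon> * \<bar>g y\<bar>"
              by (intro mult_right_mono) auto
            then show "\<bar>\<phi> (u x) * g y - \<phi> (u y) * g y\<bar> \<le> \<epsilon> * \<bar>g y\<bar>"
              by (simp add: abs_mult[symmetric] algebra_simps)
          qed
          also have "\<dots> = \<epsilon> * (LINT x:{c..e}|lborel. \<bar>g x\<bar>)" by simp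
          finally show "\<bar>F c e\<bar> \<le> 2 * \<epsilon> * (LINT x:{c..e}|lborel. \<bar>g x\<bar>)"
            unfolding F_def using 1 by linarith
        qed
      qed
    qed
    then show ?thesis unfolding P_def using ab by simp
  qed
  have "F a b = 0"
  proof (rule ccontr)
    assume "F a b \<noteq> 0"
    define G where "G = (LINT x:{a..b}|lborel. \<bar>g x\<bar>)"
    have G: "G \<ge> 0" unfolding G_def set_lebesgue_integral_def by (rule integral_nonneg_AE) auto
    \<comment> \<open>This choice of \<open>\<epsilon>\<close> makes the right-hand side less than
      half of \<open>\<bar>F a b\<bar>\<close>; the summand 1 covers the case
      \<open>G = 0\<close>.\<close>
    have "\<bar>F a b\<bar> \<le> 2 * (\<bar>F a b\<bar> / (4 * (G + 1))) * G"
      using small[of "\<bar>F a b\<bar> / (4 * (G + 1))"] \<open>F a b \<noteq> 0\<close> G unfolding G_def[symmetric] by simp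
    also have "\<dots> = \<bar>F a b\<bar> * (G / (2 * (G + 1)))" using G by (simp add: field_simps)
    also have "\<dots> < \<bar>F a b\<bar> * 1"
      using \<open>F a b \<noteq> 0\<close> G by (intro mult_strict_left_mono) (auto simp: field_simps)
    finally show False by simp
  qed
  then show "set_integrable lborel {a..b} (\<lambda>x. \<phi> (u x) * g x) \<and>
      \<Phi> (u b) - \<Phi> (u a) = (LINT x:{a..b}|lborel. \<phi> (u x) * g x)"
    using int by (simp add: F_def)
qed

section \<open>Linear combinations, products and changes of representative of primitives\<close>

lemma primitive_on_add:
  assumes "primitive_on I u g" "primitive_on I v h"
  shows "primitive_on I (\<lambda>x. u x + v x) (\<lambda>x. g x + h x)"
  unfolding primitive_on_def
proof (intro ballI impI)
  fix a b assume ab: "a \<in> I" "b \<in> I" "a \<le> b"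
  show "set_integrable lborel {a..b} (\<lambda>x. g x + h x) \<and>
      u b + v b - (u a + v a) = (LINT x:{a..b}|lborel. g x + h x)"
    using primitive_onD[OF assms(1) ab] primitive_onD[OF assms(2) ab] by simp
qed

lemma primitive_on_cmult:
  assumes "primitive_on I u g"
  shows "primitive_on I (\<lambda>x. c * u x) (\<lambda>x. c * g x)"
  unfolding primitive_on_def
proof (intro ballI impI)
  fix a b assume ab: "a \<in> I" "b \<in> I" "a \<le> b"
  show "set_integrable lborel {a..b} (\<lambda>x. c * g x) \<and>
      c * u b - c * u a = (LINT x:{a..b}|lborel. c * g x)"
    using primitive_onD[OF assms ab] by (simp flip: right_diff_distrib)
qed

lemma primitive_on_diff:
  assumes "primitive_on I u g" "primitive_on I v h"
  shows "primitive_on I (\<lambda>x. u x - v x) (\<lambda>x. g x - h x)"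
  using primitive_on_add[OF assms(1) primitive_on_cmult[OF assms(2), of "-1"]] by simp

lemma primitive_on_minus:
  assumes "primitive_on I u g"
  shows "primitive_on I (\<lambda>x. - u x) (\<lambda>x. - g x)"
  using primitive_on_cmult[OF assms, of "-1"] by simp

lemma primitive_on_const: "primitive_on I (\<lambda>x. c) (\<lambda>x. 0)"
  unfolding primitive_on_def by (simp add: set_integrable_def)

text \<open>Polarisation, \<open>4 u v = (u + v)^2 - (u - v)^2\<close>, reduces the product rule to
  the chain rule for squares.\<close>

lemma primitive_on_mult:
  assumes I: "is_interval I" and u: "primitive_on I u g" and v: "primitive_on I v h"
  shows "primitive_on I (\<lambda>x. u x * v x) (\<lambda>x. u x * h x + g x * v x)"
proof -
  have sq: "primitive_on I (\<lambda>x. (w x)\<^sup>2) (\<lambda>x. (2 * w x) * k x)" if "primitive_on I w k" for w k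
    by (rule primitive_on_chain[OF I that open_UNIV, where \<phi> = "\<lambda>r. 2 * r"])
       (auto intro!: derivative_eq_intros continuous_intros)
  have "primitive_on I (\<lambda>x. (1/4) * ((u x + v x)\<^sup>2 - (u x - v x)\<^sup>2))
     (\<lambda>x. (1/4) * ((2 * (u x + v x)) * (g x + h x) - (2 * (u x - v x)) * (g x - h x)))"
    by (intro primitive_on_cmult primitive_on_diff sq primitive_on_add u v)
  moreover have "(1/4) * ((u x + v x)\<^sup>2 - (u x - v x)\<^sup>2) = u x * v x" for x
    by (simp add: power2_eq_square field_simps)
  moreover have "(1/4) * ((2 * (u x + v x)) * (g x + h x) - (2 * (u x - v x)) * (g x - h x))
      = u x * h x + g x * v x" for x
    by (simp add: field_simps)
  ultimately show ?thesis
    by (simp only:)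
qed

text \<open>Measurability of \<open>h\<close> is a separate hypothesis because equality almost
  everywhere does not transfer Borel measurability.\<close>

lemma primitive_on_cong_deriv:
  assumes u: "primitive_on I u g" and I: "is_interval I"
    and h: "\<And>a b. a \<in> I \<Longrightarrow> b \<in> I \<Longrightarrow> set_borel_measurable lborel {a..b} h"
    and eq: "AE x in lborel. x \<in> I \<longrightarrow> g x = h x"
  shows "primitive_on I u h"
  unfolding primitive_on_def
proof (intro ballI impI)
  fix a b assume ab: "a \<in> I" "b \<in> I" "a \<le> b"
  have sub: "{a..b} \<subseteq> I"
    using ab I by (meson atLeastAtMost_iff is_interval_1 subsetI)
  note P = primitive_onD[OF u ab]
  have m: "(\<lambda>x. indicator {a..b} x *\<^sub>R g x) \<in> borel_measurable lborel"
    using P(1) unfolding set_integrable_def by auto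
  have m': "(\<lambda>x. indicator {a..b} x *\<^sub>R h x) \<in> borel_measurable lborel"
    using h ab unfolding set_borel_measurable_def by auto
  have eq': "AE x in lborel. indicator {a..b} x *\<^sub>R g x = indicator {a..b} x *\<^sub>R h x"
    using eq by eventually_elim (use sub in \<open>auto simp: indicator_def\<close>)
  show "set_integrable lborel {a..b} h \<and> u b - u a = (LINT x:{a..b}|lborel. h x)"
    using P integrable_cong_AE[OF m m' eq'] integral_cong_AE[OF m m' eq']
    unfolding set_integrable_def set_lebesgue_integral_def by auto
qed

lemma primitive_on_cong:
  assumes "primitive_on I u g" "\<And>x. x \<in> I \<Longrightarrow> u x = v x"
  shows "primitive_on I v g"
  using assms unfolding primitive_on_def by simp

lemma primitive_on_DERIV:
  assumes I: "is_interval I" and d: "\<And>x. x \<in> I \<Longrightarrow> (u has_real_derivative g x) (at x within I)"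
    and g: "continuous_on I g"
  shows "primitive_on I u g"
  unfolding primitive_on_def
proof (intro ballI impI)
  fix a b assume ab: "a \<in> I" "b \<in> I" "a \<le> b"
  have sub: "{a..b} \<subseteq> I"
    using ab I by (meson atLeastAtMost_iff is_interval_1 subsetI)
  have i: "set_integrable lborel {a..b} g"
    unfolding set_integrable_def
    by (rule borel_integrable_compact) (use continuous_on_subset[OF g sub] in auto)
  have "(g has_integral (u b - u a)) {a..b}"
    by (rule fundamental_theorem_of_calculus[OF ab(3)])
       (use DERIV_subset[OF d sub] sub in \<open>auto simp: has_real_derivative_iff_has_vector_derivative[symmetric]\<close>)
  then show "set_integrable lborel {a..b} g \<and> u b - u a = (LINT x:{a..b}|lborel. g x)"
    using i by (simp add: set_borel_integral_eq_integral integral_unique)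
qed

text \<open>The oriented integral from \<open>c\<close> to \<open>x\<close>; the case distinction is
  there because \<open>{c..x}\<close> is empty for \<open>x < c\<close>. It provides a primitive
  that is defined at every point and vanishes at \<open>c\<close>.\<close>

definition signed_integral :: "real \<Rightarrow> (real \<Rightarrow> real) \<Rightarrow> real \<Rightarrow> real" where
  "signed_integral c g x =
     (if c \<le> x then (LINT y:{c..x}|lborel. g y) else - (LINT y:{x..c}|lborel. g y))"

lemma set_integral_singleton_lborel:
  fixes g :: "real \<Rightarrow> real"
  shows "(LINT y:{a..a}|lborel. g y) = 0"
  unfolding set_lebesgue_integral_def
proof (rule integral_eq_zero_AE)
  show "AE x in lborel. indicator {a..a} x *\<^sub>R g x = 0"
    using AE_lborel_singleton[of a] by eventually_elim (auto simp: indicator_def)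
qed

lemma signed_integral_self [simp]: "signed_integral c g c = 0"
  by (simp only: signed_integral_def set_integral_singleton_lborel) simp

lemma signed_integral_ge: "c \<le> x \<Longrightarrow> signed_integral c g x = (LINT y:{c..x}|lborel. g y)"
  by (simp add: signed_integral_def)

lemma signed_integral_le: "x \<le> c \<Longrightarrow> signed_integral c g x = - (LINT y:{x..c}|lborel. g y)"
  using set_integral_singleton_lborel[of c g] by (cases "c = x") (auto simp: signed_integral_def)

lemma primitive_on_signed_integral:
  assumes g: "\<And>a b. a \<in> I \<Longrightarrow> b \<in> I \<Longrightarrow> a \<le> b \<Longrightarrow> set_integrable lborel {a..b} g" and c: "c \<in> I"
  shows "primitive_on I (signed_integral c g) g"
  unfolding primitive_on_def
proof (intro ballI impI)
  fix a b assume ab: "a \<in> I" "b \<in> I" "a \<le> b"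
  consider "c \<le> a" | "a \<le> c" "c \<le> b" | "b \<le> c" by linarith
  then have "signed_integral c g b - signed_integral c g a = (LINT x:{a..b}|lborel. g x)"
  proof cases
    case 1
    then show ?thesis
      using set_integral_combine_ivl[of c b g a] g[of c b] ab c by (simp add: signed_integral_ge)
  next
    case 2
    then show ?thesis
      using set_integral_combine_ivl[of a b g c] g[of a b] ab c
      by (simp add: signed_integral_ge signed_integral_le)
  next
    case 3
    then show ?thesis
      using set_integral_combine_ivl[of a c g b] g[of a c] ab c by (simp add: signed_integral_le)
  qed
  then show "set_integrable lborel {a..b} g \<and>
      signed_integral c g b - signed_integral c g a = (LINT x:{a..b}|lborel. g x)"
    using g ab by simp
qed

lemma primitive_on_eq_signed_integral:
  assumes u: "primitive_on I u g" and "c \<in> I" "x \<in> I"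
  shows "u x = u c + signed_integral c g x"
proof (cases "c \<le> x")
  case True
  then show ?thesis using primitive_onD(2)[OF u assms(2,3)] by (simp add: signed_integral_ge)
next
  case False
  then show ?thesis using primitive_onD(2)[OF u assms(3,2)] by (simp add: signed_integral_le)
qed

section \<open>Smooth test functions\<close>

lemma C_k_SucI:
  assumes "\<And>x. (f has_derivative f' x) (at x)" "\<And>b. b \<in> Basis \<Longrightarrow> C_k k (\<lambda>x. f' x b)"
  shows "C_k (Suc k) f"
proof -
  have "frechet_derivative f (at x) = f' x" for x
    using frechet_derivative_at[OF assms(1)] by simp
  moreover have "f differentiable_on UNIV"
    using assms(1) by (auto simp: differentiable_on_def differentiable_def)
  ultimately show ?thesis using assms(2) by simp
qed

lemma C_k_SucD:
  assumes "C_k (Suc k) f"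
  shows "(f has_derivative frechet_derivative f (at x)) (at x)"
    and "b \<in> Basis \<Longrightarrow> C_k k (\<lambda>x. frechet_derivative f (at x) b)"
  using assms by (auto simp: differentiable_on_def frechet_derivative_works)

lemma C_k_Suc_imp: "C_k (Suc k) f \<Longrightarrow> C_k k f"
proof (induction k arbitrary: f)
  case 0
  then show ?case by (auto intro: differentiable_imp_continuous_on)
next
  case (Suc k)
  then show ?case by simp
qed

lemma C_k_const: "C_k k (\<lambda>x. c)"
proof (induction k arbitrary: c)
  case (Suc k)
  show ?case by (rule C_k_SucI[where f' = "\<lambda>x b. 0"]) (auto simp: Suc)
qed simp

lemma C_k_add: "C_k k f \<Longrightarrow> C_k k g \<Longrightarrow> C_k k (\<lambda>x. f x + g x)"
proof (induction k arbitrary: f g)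
  case 0
  then show ?case by (auto intro: continuous_on_add)
next
  case (Suc k)
  show ?case
    by (rule C_k_SucI[OF has_derivative_add[OF C_k_SucD(1)[OF Suc.prems(1)] C_k_SucD(1)[OF Suc.prems(2)]]])
       (intro Suc.IH C_k_SucD(2)[OF Suc.prems(1)] C_k_SucD(2)[OF Suc.prems(2)])
qed

lemma C_k_mult: "C_k k f \<Longrightarrow> C_k k g \<Longrightarrow> C_k k (\<lambda>x. f x * g x)"
proof (induction k arbitrary: f g)
  case 0
  then show ?case by (auto intro: continuous_on_mult)
next
  case (Suc k)
  show ?case
    by (rule C_k_SucI[OF has_derivative_mult[OF C_k_SucD(1)[OF Suc.prems(1)] C_k_SucD(1)[OF Suc.prems(2)]]])
       (intro C_k_add Suc.IH C_k_SucD(2)[OF Suc.prems(1)] C_k_SucD(2)[OF Suc.prems(2)]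
         C_k_Suc_imp[OF Suc.prems(1)] C_k_Suc_imp[OF Suc.prems(2)])
qed

lemma C_k_cmult: "C_k k f \<Longrightarrow> C_k k (\<lambda>x. c * f x)"
  by (rule C_k_mult[OF C_k_const])

lemma C_k_diff: "C_k k f \<Longrightarrow> C_k k g \<Longrightarrow> C_k k (\<lambda>x. f x - g x)"
  using C_k_add[of k f "\<lambda>x. (-1) * g x"] C_k_cmult[of k g "-1"] by simp

text \<open>\<open>m\<close> has the same derivative \<open>l\<close> at every point, so
  differentiating the composite in direction \<open>b\<close> gives the constant \<open>l b\<close>
  times a composite of the same kind. The induction thus closes without a general chain rule of
  higher order. The inner maps that occur are projections and affine rescalings.\<close>

lemma C_k_compose_affine:
  fixes f :: "real \<Rightarrow> real" and m :: "'a::euclidean_space \<Rightarrow> real"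
  assumes "C_k k f" and m: "\<And>z. (m has_derivative l) (at z)"
  shows "C_k k (\<lambda>z. f (m z))"
  using assms(1)
proof (induction k arbitrary: f)
  case 0
  have "continuous_on UNIV m"
    using m by (auto intro!: continuous_at_imp_continuous_on has_derivative_continuous)
  then show ?case using 0 by (auto intro: continuous_on_compose2)
next
  case (Suc k)
  show ?case
  proof (rule C_k_SucI)
    fix z
    show "((\<lambda>z. f (m z)) has_derivative (\<lambda>b. frechet_derivative f (at (m z)) (l b))) (at z)"
      by (rule has_derivative_compose[OF m C_k_SucD(1)[OF Suc.prems]])
  next
    fix b :: 'a assume "b \<in> Basis"
    have lin: "frechet_derivative f (at (m z)) (l b) = l b * frechet_derivative f (at (m z)) 1" for z
    proof -
      have "linear (frechet_derivative f (at (m z)))"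
        using C_k_SucD(1)[OF Suc.prems] by (rule has_derivative_linear)
      from linear_cmul[OF this, of "l b" 1] show ?thesis by simp
    qed
    have "C_k k (\<lambda>z. l b * frechet_derivative f (at (m z)) 1)"
      by (intro C_k_cmult Suc.IH C_k_SucD(2)[OF Suc.prems]) simp
    then show "C_k k (\<lambda>z. frechet_derivative f (at (m z)) (l b))"
      by (simp add: lin)
  qed
qed

lemma C_k_real_SucI:
  assumes "\<And>x. (f has_real_derivative f' x) (at x)" "C_k k f'"
  shows "C_k (Suc k) f"
  by (rule C_k_SucI[where f' = "\<lambda>x b. f' x * b"])
     (use assms in \<open>auto simp: has_field_derivative_def Basis_real_def\<close>)

lemma C_k_real_DERIV:
  assumes "C_k (Suc k) f"
  shows "(f has_real_derivative deriv f x) (at x)" "C_k k (deriv f)"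
proof -
  have d: "(f has_real_derivative deriv f x) (at x)" for x
  proof -
    have "f differentiable (at x)" using C_k_SucD(1)[OF assms] by (auto simp: differentiable_def)
    then show ?thesis
      using DERIV_deriv_iff_real_differentiable by blast
  qed
  then show "(f has_real_derivative deriv f x) (at x)" .
  have "frechet_derivative f (at x) 1 = deriv f x" for x
    using frechet_derivative_at[OF d[of x, unfolded has_field_derivative_def]]
    by (metis mult.right_neutral)
  then show "C_k k (deriv f)" using C_k_SucD(2)[OF assms, of 1] by simp
qed

text \<open>The functions \<open>exp (-1/x) / x^m\<close> on the positive half-line form a family
  whose derivatives are linear combinations of its members. Smoothness of the standard flat function
  \<open>flat 0\<close> therefore follows by induction on the order, for all \<open>m\<close> at
  once.\<close>

definition flat :: "nat \<Rightarrow> real \<Rightarrow> real" where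
  "flat m x = (if x \<le> 0 then 0 else exp (- (1 / x)) / x ^ m)"

lemma flat_tendsto_0: "(flat m \<longlongrightarrow> 0) (at 0)"
proof -
  have l: "(flat m \<longlongrightarrow> 0) (at_left 0)"
  proof (rule tendsto_eventually)
    show "\<forall>\<^sub>F x in at_left 0. flat m x = 0"
      using eventually_at_left_real[of "-1" 0] by (auto elim!: eventually_mono simp: flat_def)
  qed
  have "((\<lambda>x::real. (inverse x) ^ m / exp (inverse x)) \<longlongrightarrow> 0) (at_right 0)"
    by (rule filterlim_compose[OF tendsto_power_div_exp_0 filterlim_inverse_at_top_right])
  moreover have "\<forall>\<^sub>F x in at_right 0. (inverse x) ^ m / exp (inverse x) = flat m x"
    using eventually_at_right_real[of 0 1]
    by (auto elim!: eventually_mono simp: flat_def exp_minus field_simps power_inverse inverse_eq_divide)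
  ultimately have r: "(flat m \<longlongrightarrow> 0) (at_right 0)"
    by (rule Lim_transform_eventually)
  show ?thesis using l r by (simp add: filterlim_at_split)
qed

lemma flat_DERIV: "(flat m has_real_derivative (flat (m + 2) x - real m * flat (m + 1) x)) (at x)"
proof -
  consider "x < 0" | "x = 0" | "x > 0" by linarith
  then show ?thesis
  proof cases
    case 1
    have "((\<lambda>x. 0) has_real_derivative 0) (at x)" by simp
    then have "(flat m has_real_derivative 0) (at x)"
      by (rule has_field_derivative_transform_within_open[of _ _ _ "{..<0}"])
         (use 1 in \<open>auto simp: flat_def\<close>)
    then show ?thesis using 1 by (simp add: flat_def)
  next
    case 2
    \<comment> \<open>The difference quotient of \<open>flat m\<close> at 0 is
      \<open>flat (m + 1)\<close>, which tends to 0.\<close>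
    have "((\<lambda>h. (flat m (0 + h) - flat m 0) / h) \<longlongrightarrow> 0) (at 0)"
      by (rule Lim_transform_eventually[OF flat_tendsto_0[of "m + 1"]])
         (auto simp: eventually_at_filter flat_def field_simps)
    then have "(flat m has_real_derivative 0) (at 0)" by (simp add: DERIV_def)
    then show ?thesis using 2 by (simp add: flat_def)
  next
    case 3
    have "((\<lambda>x. exp (- (1 / x)) / x ^ m) has_real_derivative
        (flat (m + 2) x - real m * flat (m + 1) x)) (at x)"
    proof (cases m)
      case 0
      show ?thesis using 3 unfolding 0
        by (auto intro!: derivative_eq_intros simp: flat_def field_simps power2_eq_square)
    next
      case (Suc n)
      show ?thesis using 3 unfolding Suc
        by (auto intro!: derivative_eq_intros simp: flat_def)
           (cases n; auto simp: field_simps power2_eq_square)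
    qed
    then show ?thesis
      by (rule has_field_derivative_transform_within_open[of _ _ _ "{0<..}"])
         (use 3 in \<open>auto simp: flat_def\<close>)
  qed
qed

lemma C_k_flat: "C_k k (flat m)"
proof (induction k arbitrary: m)
  case 0
  show ?case
    using flat_DERIV by (auto intro!: continuous_at_imp_continuous_on DERIV_isCont)
next
  case (Suc k)
  show ?case
    by (rule C_k_real_SucI[OF flat_DERIV]) (intro C_k_diff C_k_cmult Suc)
qed

text \<open>A product of two copies of \<open>flat 0\<close>, applied to multiples by
  \<open>Suc n\<close> of the distances \<open>x - a\<close> and \<open>b - x\<close>: inside the
  interval both factors tend to \<open>exp 0 = 1\<close>, outside one of them is 0. Each approximant
  is positive exactly on the open interval, which gives a support in \<open>{a..b}\<close> and, for
  \<open>a < b\<close>, a bump of nonzero mean.\<close>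

lemma smooth_approx_indicator:
  fixes a b :: real
  obtains \<beta> :: "nat \<Rightarrow> real \<Rightarrow> real" where
    "\<And>n k. C_k k (\<beta> n)" "\<And>n x. 0 \<le> \<beta> n x" "\<And>n x. \<beta> n x \<le> 1"
    "\<And>n x. 0 < \<beta> n x \<longleftrightarrow> x \<in> {a<..<b}"
    "\<And>x. (\<lambda>n. \<beta> n x) \<longlonglongrightarrow> indicator {a<..<b} x"
proof
  define \<beta> where "\<beta> n x = flat 0 (real (Suc n) * (x - a)) * flat 0 (real (Suc n) * (b - x))" for n x
  show "C_k k (\<beta> n)" for n k
    unfolding \<beta>_def
    by (intro C_k_mult C_k_compose_affine[OF C_k_flat, of "\<lambda>x. real (Suc n) * (x - a)" "\<lambda>h. real (Suc n) * h"]
        C_k_compose_affine[OF C_k_flat, of "\<lambda>x. real (Suc n) * (b - x)" "\<lambda>h. real (Suc n) * (- h)"])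
       (auto intro!: derivative_eq_intros)
  have f: "0 \<le> flat 0 x" "flat 0 x \<le> 1" "0 < flat 0 x \<longleftrightarrow> x > 0" for x
    by (auto simp: flat_def)
  show "0 \<le> \<beta> n x" for n x unfolding \<beta>_def using f by simp
  show "\<beta> n x \<le> 1" for n x unfolding \<beta>_def using f by (simp add: mult_le_one)
  have z: "\<beta> n x = 0" if "x \<notin> {a<..<b}" for n x
    using that unfolding \<beta>_def flat_def by (auto simp: mult_le_0_iff not_less)
  have pos: "0 < \<beta> n x" if "x \<in> {a<..<b}" for n x
    using that unfolding \<beta>_def by (intro mult_pos_pos) (simp_all add: f)
  show "0 < \<beta> n x \<longleftrightarrow> x \<in> {a<..<b}" for n x using z[of x n] pos[of x n] by force
  show "(\<lambda>n. \<beta> n x) \<longlonglongrightarrow> indicator {a<..<b} x" for x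
  proof (cases "x \<in> {a<..<b}")
    case True
    have lim: "(\<lambda>n. flat 0 (real (Suc n) * c)) \<longlonglongrightarrow> 1" if c: "c > 0" for c
    proof -
      have "(\<lambda>n. exp (- (inverse c * inverse (real (Suc n))))) \<longlonglongrightarrow> exp (- (inverse c * 0))"
        by (intro tendsto_intros LIMSEQ_inverse_real_of_nat)
      moreover have "exp (- (inverse c * inverse (real (Suc n)))) = flat 0 (real (Suc n) * c)" for n
      proof -
        have "\<not> real (Suc n) * c \<le> 0" using c by (simp add: mult_le_0_iff)
        then show ?thesis by (simp add: flat_def field_simps inverse_eq_divide)
      qed
      ultimately show ?thesis by simp
    qed
    have "(\<lambda>n. \<beta> n x) \<longlonglongrightarrow> 1 * 1"
      unfolding \<beta>_def by (intro tendsto_mult lim) (use True in auto)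
    then show ?thesis using True by simp
  next
    case False
    then show ?thesis using z by simp
  qed
qed

lemma compact_subset_ivl:
  fixes K I :: "real set"
  assumes "compact K" "K \<subseteq> I" "open I" "is_interval I" "I \<noteq> {}"
  obtains a b where "a < b" "{a..b} \<subseteq> I" "K \<subseteq> {a..b}"
proof -
  obtain x where x: "x \<in> I" using assms by auto
  then obtain e where e: "e > 0" "cball x e \<subseteq> I" using assms(3) open_contains_cball by blast
  \<comment> \<open>Adding a closed ball makes the hull a nondegenerate interval even if
    \<open>K\<close> is empty.\<close>
  define K' where "K' = K \<union> cball x e"
  have K': "compact K'" "K' \<noteq> {}" "K' \<subseteq> I" unfolding K'_def using assms e by auto
  define a b where "a = Inf K'" and "b = Sup K'"
  have ab: "a \<in> K'" "b \<in> K'"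
    unfolding a_def b_def using K'
    by (auto intro!: closed_contains_Inf closed_contains_Sup bounded_imp_bdd_below bounded_imp_bdd_above
        compact_imp_closed compact_imp_bounded)
  have le: "a \<le> y" "y \<le> b" if "y \<in> K'" for y
    unfolding a_def b_def using K' that
    by (auto intro!: cInf_lower cSup_upper bounded_imp_bdd_below bounded_imp_bdd_above compact_imp_bounded)
  have "x - e \<in> K'" "x + e \<in> K'" unfolding K'_def using e by (auto simp: dist_real_def)
  then have "a < b" using le[of "x - e"] le[of "x + e"] e by linarith
  moreover have "{a..b} \<subseteq> I"
    using ab K' assms(4) by (meson atLeastAtMost_iff is_interval_1 subset_iff)
  moreover have "K \<subseteq> {a..b}" using le unfolding K'_def by auto
  ultimately show ?thesis by (rule that)
qed

lemma test_function_ivl: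
  assumes "test_function I \<psi>" "open I" "is_interval I" "I \<noteq> {}"
  obtains a b :: real where "a < b" "{a..b} \<subseteq> I" "\<And>x. x \<notin> {a..b} \<Longrightarrow> \<psi> x = 0"
proof -
  obtain K where K: "compact K" "K \<subseteq> I" "\<And>x. x \<notin> K \<Longrightarrow> \<psi> x = 0"
    using assms(1) unfolding test_function_def by blast
  obtain a b where ab: "a < b" "{a..b} \<subseteq> I" "K \<subseteq> {a..b}"
    by (rule compact_subset_ivl[OF K(1,2) assms(2-4)])
  show ?thesis
    using that[OF ab(1,2)] K(3) ab(3) by blast
qed

lemma test_function_ivlI:
  assumes "\<And>k. C_k k \<psi>" "{a..b::real} \<subseteq> I" "\<And>x. x \<notin> {a..b} \<Longrightarrow> \<psi> x = 0"
  shows "test_function I \<psi>"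
  unfolding test_function_def using assms by (intro conjI exI[of _ "{a..b}"]) auto

lemma test_function_DERIV:
  fixes \<psi> :: "real \<Rightarrow> real"
  assumes "test_function I \<psi>"
  shows "(\<psi> has_real_derivative deriv \<psi> x) (at x)" "continuous_on UNIV \<psi>" "continuous_on UNIV (deriv \<psi>)"
proof -
  have "C_k (Suc 0) \<psi>" "C_k 0 \<psi>" using assms unfolding test_function_def by blast+
  then show "(\<psi> has_real_derivative deriv \<psi> x) (at x)" "continuous_on UNIV \<psi>" "continuous_on UNIV (deriv \<psi>)"
    using C_k_real_DERIV[of 0 \<psi>] by auto
qed

lemma deriv_eq_0_outside:
  fixes \<psi> :: "real \<Rightarrow> real"
  assumes "\<And>x. x \<notin> {a..b} \<Longrightarrow> \<psi> x = 0" "x \<notin> {a..b}"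
  shows "deriv \<psi> x = 0"
proof -
  have "((\<lambda>x. 0) has_real_derivative 0) (at x)" by simp
  then have "(\<psi> has_real_derivative 0) (at x)"
    by (rule has_field_derivative_transform_within_open[of _ _ _ "- {a..b}"])
       (use assms in auto)
  then show ?thesis by (rule DERIV_imp_deriv)
qed

lemma test_function_prod:
  fixes \<psi> \<phi> :: "real \<Rightarrow> real"
  assumes "test_function I1 \<psi>" "test_function I2 \<phi>"
  shows "test_function (I1 \<times> I2) (\<lambda>z. \<psi> (fst z) * \<phi> (snd z))"
    and "frechet_derivative (\<lambda>z. \<psi> (fst z) * \<phi> (snd z)) (at z) (1, 0) = deriv \<psi> (fst z) * \<phi> (snd z)"
    and "frechet_derivative (\<lambda>z. \<psi> (fst z) * \<phi> (snd z)) (at z) (0, 1) = \<psi> (fst z) * deriv \<phi> (snd z)"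
proof -
  obtain K1 K2 where K: "compact K1" "K1 \<subseteq> I1" "\<And>x. x \<notin> K1 \<Longrightarrow> \<psi> x = 0"
      "compact K2" "K2 \<subseteq> I2" "\<And>x. x \<notin> K2 \<Longrightarrow> \<phi> x = 0"
    using assms unfolding test_function_def by blast
  have "C_k k (\<lambda>z. \<psi> (fst z) * \<phi> (snd z))" for k
    using assms unfolding test_function_def
    by (intro C_k_mult C_k_compose_affine[of k \<psi> fst fst] C_k_compose_affine[of k \<phi> snd snd])
       (auto intro!: derivative_eq_intros)
  then show "test_function (I1 \<times> I2) (\<lambda>z. \<psi> (fst z) * \<phi> (snd z))"
    unfolding test_function_def using K
    by (intro conjI exI[of _ "K1 \<times> K2"]) (auto intro: compact_Times)
  have d: "((\<lambda>z. \<psi> (fst z) * \<phi> (snd z)) has_derivative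
      (\<lambda>h. \<psi> (fst z) * (deriv \<phi> (snd z) * snd h) + (deriv \<psi> (fst z) * fst h) * \<phi> (snd z))) (at z)"
    using test_function_DERIV(1)[OF assms(1)] test_function_DERIV(1)[OF assms(2)]
    unfolding has_field_derivative_def
    by (intro has_derivative_mult has_derivative_compose[of fst fst z UNIV \<psi>]
        has_derivative_compose[of snd snd z UNIV \<phi>] derivative_eq_intros) auto
  note fr = frechet_derivative_at[OF this, symmetric]
  show "frechet_derivative (\<lambda>z. \<psi> (fst z) * \<phi> (snd z)) (at z) (1, 0) = deriv \<psi> (fst z) * \<phi> (snd z)"
    "frechet_derivative (\<lambda>z. \<psi> (fst z) * \<phi> (snd z)) (at z) (0, 1) = \<psi> (fst z) * deriv \<phi> (snd z)"
    by (simp_all add: fr)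
qed

section \<open>Fubini and the du Bois-Reymond lemma\<close>

lemma borel_measurable_fst_snd [measurable]:
  "fst \<in> borel_measurable (borel :: (real \<times> real) measure)"
  "snd \<in> borel_measurable (borel :: (real \<times> real) measure)"
  by (auto intro!: borel_measurable_continuous_onI continuous_intros)

lemma borel_measurable_Pair_real [measurable (raw)]:
  fixes f g :: "'a \<Rightarrow> real"
  assumes "f \<in> borel_measurable M" "g \<in> borel_measurable M"
  shows "(\<lambda>x. (f x, g x)) \<in> borel_measurable M"
  using assms by (rule borel_measurable_Pair)

lemma AE_lborel_pairD1:
  fixes P :: "real \<times> real \<Rightarrow> bool"
  assumes "AE z in lborel. P z"
  shows "AE x in lborel. AE y in lborel. P (x, y)"
  using assms unfolding lborel_prod[symmetric] by (rule lborel_pair.AE_pair)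

lemma space_sets_lborel_pair:
  "space (lborel \<Otimes>\<^sub>M (lborel :: real measure)) = (UNIV :: (real \<times> real) set)"
  "sets (lborel \<Otimes>\<^sub>M (lborel :: real measure)) = sets (borel :: (real \<times> real) measure)"
  by (simp_all only: lborel_prod sets_lborel space_lborel space_borel)

lemma AE_lborel_pairI1:
  fixes P :: "real \<times> real \<Rightarrow> bool"
  assumes "{z. P z} \<in> sets borel" "AE x in lborel. AE y in lborel. P (x, y)"
  shows "AE z in lborel. P z"
  unfolding lborel_prod[symmetric]
  by (rule lborel_pair.AE_pair_measure)
     (use assms in \<open>simp_all only: space_sets_lborel_pair UNIV_I simp_thms\<close>)

lemma AE_lborel_pair_commute:
  fixes P :: "real \<times> real \<Rightarrow> bool"
  assumes "{z. P z} \<in> sets borel"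
  shows "(AE x in lborel. AE y in lborel. P (x, y)) \<longleftrightarrow> (AE y in lborel. AE x in lborel. P (x, y))"
  by (rule lborel_pair.AE_commute[of "\<lambda>x y. P (x, y)"])
     (use assms in \<open>simp only: space_sets_lborel_pair UNIV_I simp_thms prod.collapse\<close>)

text \<open>The order of the two quantifiers can be exchanged for measurable predicates only, and
  \<open>P\<close> is arbitrary; a Borel null set that covers the failures of \<open>P\<close> takes
  its place.\<close>

lemma AE_lborel_pairD2:
  fixes P :: "real \<times> real \<Rightarrow> bool"
  assumes "AE z in lborel. P z"
  shows "AE y in lborel. AE x in lborel. P (x, y)"
proof -
  obtain N where N: "{z \<in> space lborel. \<not> P z} \<subseteq> N" "emeasure lborel N = 0" "N \<in> sets lborel"
    using assms by (rule AE_E)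
  have "AE z in lborel. z \<notin> N" using N by (intro AE_not_in null_setsI)
  then have "AE y in lborel. AE x in lborel. (x, y) \<notin> N"
    using AE_lborel_pair_commute[of "\<lambda>z. z \<notin> N"] AE_lborel_pairD1[of "\<lambda>z. z \<notin> N"] N
    by (auto simp: Collect_neg_eq)
  then show ?thesis
    using N(1) by (auto elim!: eventually_mono)
qed

lemma lborel_Fubini:
  fixes f :: "real \<times> real \<Rightarrow> real"
  assumes "integrable lborel f"
  shows "AE x in lborel. integrable lborel (\<lambda>y. f (x, y))"
    "AE y in lborel. integrable lborel (\<lambda>x. f (x, y))"
    "integrable lborel (\<lambda>x. LINT y|lborel. f (x, y))"
    "integrable lborel (\<lambda>y. LINT x|lborel. f (x, y))"
    "(LINT z|lborel. f z) = (LINT x|lborel. LINT y|lborel. f (x, y))"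
    "(LINT z|lborel. f z) = (LINT y|lborel. LINT x|lborel. f (x, y))"
proof -
  have f: "integrable (lborel \<Otimes>\<^sub>M lborel) (case_prod (\<lambda>x y. f (x, y)))"
    using assms by (simp add: lborel_prod)
  show "AE x in lborel. integrable lborel (\<lambda>y. f (x, y))"
    "AE y in lborel. integrable lborel (\<lambda>x. f (x, y))"
    "integrable lborel (\<lambda>x. LINT y|lborel. f (x, y))"
    "integrable lborel (\<lambda>y. LINT x|lborel. f (x, y))"
    "(LINT z|lborel. f z) = (LINT x|lborel. LINT y|lborel. f (x, y))"
    "(LINT z|lborel. f z) = (LINT y|lborel. LINT x|lborel. f (x, y))"
    using lborel_pair.AE_integrable_fst[OF f] lborel_pair.AE_integrable_snd[OF f]
      lborel_pair.integrable_fst[OF f] lborel_pair.integrable_snd[OF f]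
      lborel_pair.integral_fst[OF f] lborel_pair.integral_snd[OF f]
    by (simp_all add: lborel_prod)
qed

lemma integrable_lborel_swap:
  fixes f :: "real \<times> real \<Rightarrow> real"
  assumes "integrable lborel f"
  shows "integrable lborel (\<lambda>z. f (snd z, fst z))"
    and "(LINT z|lborel. f (snd z, fst z)) = (LINT z|lborel. f z)"
proof -
  have "(\<lambda>(x, y). f (y, x)) = (\<lambda>z. f (snd z, fst z))" by auto
  then show "integrable lborel (\<lambda>z. f (snd z, fst z))"
    "(LINT z|lborel. f (snd z, fst z)) = (LINT z|lborel. f z)"
    using lborel_pair.integrable_product_swap[of f] lborel_pair.integral_product_swap[of f] assms
    by (auto simp: lborel_prod)
qed

lemma integrable_tensor:
  fixes u v :: "real \<Rightarrow> real"
  assumes u: "integrable lborel u" and v: "integrable lborel v"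
  shows "integrable lborel (\<lambda>z. u (fst z) * v (snd z))"
    and "(LINT z|lborel. u (fst z) * v (snd z)) = (LINT x|lborel. u x) * (LINT y|lborel. v y)"
proof -
  have [measurable]: "u \<in> borel_measurable borel" "v \<in> borel_measurable borel"
    using u v by auto
  have "integrable (lborel \<Otimes>\<^sub>M lborel) (\<lambda>z. u (fst z) * v (snd z))"
  proof (rule lborel_pair.Fubini_integrable)
    show "(\<lambda>z. u (fst z) * v (snd z)) \<in> borel_measurable (lborel \<Otimes>\<^sub>M lborel)" by measurable
    show "integrable lborel (\<lambda>x. LINT y|lborel. norm (u (fst (x, y)) * v (snd (x, y))))"
      using u by (simp add: abs_mult)
    show "AE x in lborel. integrable lborel (\<lambda>y. u (fst (x, y)) * v (snd (x, y)))"
      using v by simp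
  qed
  then show i: "integrable lborel (\<lambda>z. u (fst z) * v (snd z))" by (simp add: lborel_prod)
  show "(LINT z|lborel. u (fst z) * v (snd z)) = (LINT x|lborel. u x) * (LINT y|lborel. v y)"
    using lborel_Fubini(5)[OF i] by simp
qed

lemma locally_integrable_rect:
  assumes "locally_integrable (I1 \<times> I2) h" "{a..b} \<subseteq> I1" "{c..d::real} \<subseteq> I2"
  shows "set_integrable lborel ({a..b::real} \<times> {c..d}) h"
proof -
  have "compact ({a..b} \<times> {c..d})" "{a..b} \<times> {c..d} \<subseteq> I1 \<times> I2"
    using assms(2,3) by (auto intro: compact_Times)
  then show ?thesis using assms(1) unfolding locally_integrable_def by blast
qed

lemma locally_integrable_rectI:
  fixes h :: "real \<times> real \<Rightarrow> real"
  assumes I1: "open I1" "is_interval I1" "I1 \<noteq> {}" and I2: "open I2" "is_interval I2" "I2 \<noteq> {}"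
    and h: "\<And>a b c d. {a..b} \<subseteq> I1 \<Longrightarrow> {c..d} \<subseteq> I2 \<Longrightarrow> set_integrable lborel ({a..b} \<times> {c..d}) h"
  shows "locally_integrable (I1 \<times> I2) h"
  unfolding locally_integrable_def
proof (intro allI impI)
  fix K :: "(real \<times> real) set" assume K: "compact K" "K \<subseteq> I1 \<times> I2"
  have "compact (fst ` K)" "compact (snd ` K)" "fst ` K \<subseteq> I1" "snd ` K \<subseteq> I2"
    using K by (auto intro!: compact_continuous_image continuous_intros)
  then obtain a b a' b' where r: "{a..b} \<subseteq> I1" "fst ` K \<subseteq> {a..b}" "{a'..b'} \<subseteq> I2" "snd ` K \<subseteq> {a'..b'}"
    using compact_subset_ivl[of "fst ` K" I1] compact_subset_ivl[of "snd ` K" I2] I1 I2 by metis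
  show "set_integrable lborel K h"
    by (rule set_integrable_subset[OF h[OF r(1,3)]]) (use K r in \<open>auto simp: borel_compact\<close>)
qed

lemma integrable_mult_tensor:
  fixes h :: "real \<times> real \<Rightarrow> real"
  assumes h: "set_integrable lborel ({a..b} \<times> {c..d}) h"
    and \<psi>: "continuous_on UNIV \<psi>" "\<And>x. x \<notin> {a..b} \<Longrightarrow> \<psi> x = 0"
    and \<phi>: "continuous_on UNIV \<phi>" "\<And>x. x \<notin> {c..d} \<Longrightarrow> \<phi> x = 0"
  shows "integrable lborel (\<lambda>z. h z * (\<psi> (fst z) * \<phi> (snd z)))"
proof -
  have bdd: "\<exists>C. \<forall>x. \<bar>\<psi> x\<bar> \<le> C" if "continuous_on UNIV \<psi>" "\<And>x. x \<notin> {a..b} \<Longrightarrow> \<psi> x = 0"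
    for \<psi> :: "real \<Rightarrow> real" and a b
  proof -
    have "bounded (\<psi> ` {a..b})"
      by (intro compact_imp_bounded compact_continuous_image continuous_on_subset[OF that(1)]) auto
    then obtain C where "\<forall>x\<in>{a..b}. \<bar>\<psi> x\<bar> \<le> C" by (auto simp: bounded_iff)
    then have "\<bar>\<psi> x\<bar> \<le> max C 0" for x using that(2)[of x] by (cases "x \<in> {a..b}") (auto simp: le_max_iff_disj)
    then show ?thesis by blast
  qed
  obtain C1 C2 where C: "\<And>x. \<bar>\<psi> x\<bar> \<le> C1" "\<And>x. \<bar>\<phi> x\<bar> \<le> C2"
    using bdd[OF \<psi>] bdd[OF \<phi>] by blast
  have C0: "C1 \<ge> 0" using C(1)[of 0] by linarith
  have [measurable]: "\<psi> \<in> borel_measurable borel" "\<phi> \<in> borel_measurable borel"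
    using \<psi>(1) \<phi>(1) by (auto intro: borel_measurable_continuous_onI)
  let ?R = "{a..b} \<times> {c..d}"
  have hi: "integrable lborel (\<lambda>z. indicator ?R z *\<^sub>R h z)" using h unfolding set_integrable_def .
  then have [measurable]: "(\<lambda>z. indicator ?R z *\<^sub>R h z) \<in> borel_measurable borel" by auto
  have eq: "(\<lambda>z. h z * (\<psi> (fst z) * \<phi> (snd z))) = (\<lambda>z. (indicator ?R z *\<^sub>R h z) * (\<psi> (fst z) * \<phi> (snd z)))"
    using \<psi>(2) \<phi>(2) by (fastforce simp: indicator_def fun_eq_iff)
  show ?thesis
    unfolding eq
  proof (rule Bochner_Integration.integrable_bound)
    show "integrable lborel (\<lambda>z. (indicator ?R z *\<^sub>R h z) * (C1 * C2))" using hi by simp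
    show "(\<lambda>z. (indicator ?R z *\<^sub>R h z) * (\<psi> (fst z) * \<phi> (snd z))) \<in> borel_measurable lborel" by measurable
    show "AE z in lborel. norm ((indicator ?R z *\<^sub>R h z) * (\<psi> (fst z) * \<phi> (snd z)))
        \<le> norm ((indicator ?R z *\<^sub>R h z) * (C1 * C2))"
    proof (rule AE_I2)
      fix z :: "real \<times> real"
      have "\<bar>\<psi> (fst z) * \<phi> (snd z)\<bar> \<le> C1 * C2"
        unfolding abs_mult using C C0 by (intro mult_mono) auto
      then show "norm ((indicator ?R z *\<^sub>R h z) * (\<psi> (fst z) * \<phi> (snd z)))
        \<le> norm ((indicator ?R z *\<^sub>R h z) * (C1 * C2))"
        by (subst (1 2) norm_mult, intro mult_left_mono) auto
    qed
  qed
qed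

text \<open>The fundamental lemma of the calculus of variations with products of one-variable test
  functions only. Products of smooth bumps converge to indicators of boxes, so \<open>h\<close> has
  integral 0 over every box whose closure lies in the domain; differentiation of integrals over
  shrinking cubes then yields \<open>h = 0\<close>.\<close>

lemma orthogonal_tensor_imp_AE_0:
  fixes h :: "real \<times> real \<Rightarrow> real"
  assumes I: "open I1" "open I2" and h: "locally_integrable (I1 \<times> I2) h"
    and orth: "\<And>\<psi> \<phi>. test_function I1 \<psi> \<Longrightarrow> test_function I2 \<phi> \<Longrightarrow>
      (LINT z|lborel. h z * (\<psi> (fst z) * \<phi> (snd z))) = 0"
  shows "AE z in lborel. z \<in> I1 \<times> I2 \<longrightarrow> h z = 0"
proof -
  have box0: "(LINT z:box p q|lborel. h z) = 0" if sub: "cbox p q \<subseteq> I1 \<times> I2" for p q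
  proof (cases "box p q = {}")
    case True
    then show ?thesis by (simp add: set_lebesgue_integral_def)
  next
    case False
    obtain a c b d where pq: "p = (a, c)" "q = (b, d)" by (cases p, cases q) auto
    have cb: "cbox p q = {a..b} \<times> {c..d}" "box p q = {a<..<b} \<times> {c<..<d}"
      by (auto simp: pq cbox_Pair_eq box_prod)
    have ne: "a < b" "c < d" using False unfolding cb by auto
    have sub1: "{a..b} \<subseteq> I1" "{c..d} \<subseteq> I2"
      using sub ne unfolding cb by (auto simp: times_subset_iff)
    have hi: "set_integrable lborel ({a..b} \<times> {c..d}) h"
      by (rule locally_integrable_rect[OF h sub1])
    obtain \<beta> :: "nat \<Rightarrow> real \<Rightarrow> real" where \<beta>: "\<And>n k. C_k k (\<beta> n)" "\<And>n x. 0 \<le> \<beta> n x" "\<And>n x. \<beta> n x \<le> 1"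
      "\<And>n x. 0 < \<beta> n x \<longleftrightarrow> x \<in> {a<..<b}" "\<And>x. (\<lambda>n. \<beta> n x) \<longlonglongrightarrow> indicator {a<..<b} x"
      using smooth_approx_indicator[of a b] by blast
    obtain \<gamma> :: "nat \<Rightarrow> real \<Rightarrow> real" where \<gamma>: "\<And>n k. C_k k (\<gamma> n)" "\<And>n x. 0 \<le> \<gamma> n x" "\<And>n x. \<gamma> n x \<le> 1"
      "\<And>n x. 0 < \<gamma> n x \<longleftrightarrow> x \<in> {c<..<d}" "\<And>x. (\<lambda>n. \<gamma> n x) \<longlonglongrightarrow> indicator {c<..<d} x"
      using smooth_approx_indicator[of c d] by blast
    have z\<beta>: "\<beta> n x = 0" if "x \<notin> {a<..<b}" for n x using \<beta>(2,4)[of n x] that by force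
    have z\<gamma>: "\<gamma> n x = 0" if "x \<notin> {c<..<d}" for n x using \<gamma>(2,4)[of n x] that by force
    have test: "test_function I1 (\<beta> n)" "test_function I2 (\<gamma> n)" for n
      by (rule test_function_ivlI[OF \<beta>(1) sub1(1)], use z\<beta> in auto)
         (rule test_function_ivlI[OF \<gamma>(1) sub1(2)], use z\<gamma> in auto)
    have int: "integrable lborel (\<lambda>z. h z * (\<beta> n (fst z) * \<gamma> n (snd z)))" for n
      by (rule integrable_mult_tensor[OF hi])
         (use \<beta>(1)[of 0 n] \<gamma>(1)[of 0 n] z\<beta> z\<gamma> in auto)
    have hi': "integrable lborel (\<lambda>z. indicator ({a..b} \<times> {c..d}) z *\<^sub>R h z)"
      using hi unfolding set_integrable_def .
    have hb: "set_integrable lborel (box p q) h"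
      by (rule set_integrable_subset[OF hi]) (auto simp: cb intro!: borel_open open_Times)
    have "(\<lambda>n. LINT z|lborel. h z * (\<beta> n (fst z) * \<gamma> n (snd z)))
        \<longlonglongrightarrow> (LINT z|lborel. indicator (box p q) z *\<^sub>R h z)"
    proof (rule integral_dominated_convergence[where w = "\<lambda>z. norm (indicator ({a..b} \<times> {c..d}) z *\<^sub>R h z)"])
      show "(\<lambda>z. indicator (box p q) z *\<^sub>R h z) \<in> borel_measurable lborel"
        using hb unfolding set_integrable_def by auto
      show "(\<lambda>z. h z * (\<beta> n (fst z) * \<gamma> n (snd z))) \<in> borel_measurable lborel" for n using int by auto
      show "integrable lborel (\<lambda>z. norm (indicator ({a..b} \<times> {c..d}) z *\<^sub>R h z))"
        using hi' by (rule integrable_norm)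
      show "AE z in lborel. (\<lambda>n. h z * (\<beta> n (fst z) * \<gamma> n (snd z))) \<longlonglongrightarrow> indicator (box p q) z *\<^sub>R h z"
      proof (rule AE_I2)
        fix z :: "real \<times> real"
        have "(\<lambda>n. h z * (\<beta> n (fst z) * \<gamma> n (snd z)))
           \<longlonglongrightarrow> h z * (indicator {a<..<b} (fst z) * indicator {c<..<d} (snd z))"
          by (intro tendsto_intros \<beta> \<gamma>)
        also have "h z * (indicator {a<..<b} (fst z) * indicator {c<..<d} (snd z)) = indicator (box p q) z *\<^sub>R h z"
          unfolding cb by (cases z) (auto simp: indicator_def)
        finally show "(\<lambda>n. h z * (\<beta> n (fst z) * \<gamma> n (snd z))) \<longlonglongrightarrow> indicator (box p q) z *\<^sub>R h z" .
      qed
      show "AE z in lborel. norm (h z * (\<beta> n (fst z) * \<gamma> n (snd z)))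
          \<le> norm (indicator ({a..b} \<times> {c..d}) z *\<^sub>R h z)" for n
      proof (rule AE_I2)
        fix z :: "real \<times> real"
        show "norm (h z * (\<beta> n (fst z) * \<gamma> n (snd z))) \<le> norm (indicator ({a..b} \<times> {c..d}) z *\<^sub>R h z)"
        proof (cases "z \<in> {a..b} \<times> {c..d}")
          case True
          have "\<beta> n (fst z) * \<gamma> n (snd z) \<le> 1" "0 \<le> \<beta> n (fst z) * \<gamma> n (snd z)"
            using \<beta>(2,3) \<gamma>(2,3) by (auto simp: mult_le_one)
          then have "\<bar>h z\<bar> * \<bar>\<beta> n (fst z) * \<gamma> n (snd z)\<bar> \<le> \<bar>h z\<bar> * 1"
            by (intro mult_left_mono) auto
          then show ?thesis using True by (simp add: abs_mult)
        next
          case False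
          then have "\<beta> n (fst z) = 0 \<or> \<gamma> n (snd z) = 0"
            using z\<beta>[of "fst z" n] z\<gamma>[of "snd z" n] by (cases z) auto
          then show ?thesis by auto
        qed
      qed
    qed
    moreover have "(LINT z|lborel. h z * (\<beta> n (fst z) * \<gamma> n (snd z))) = 0" for n
      by (rule orth[OF test])
    ultimately show ?thesis
      unfolding set_lebesgue_integral_def by (simp add: LIMSEQ_const_iff)
  qed
  have cbox0: "AE z in lborel. z \<in> cbox p q \<longrightarrow> h z = 0" if sub: "cbox p q \<subseteq> I1 \<times> I2" for p q
  proof -
    have hi: "set_integrable lborel (cbox p q) h"
      using h sub unfolding locally_integrable_def by auto
    \<comment> \<open>The truncation is integrable over every box of the plane, as the
      differentiation theorem demands. Its integral over a box is that of \<open>h\<close> over an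
      intersection of two boxes, which is again a box in the domain.\<close>
    define f where "f z = (if z \<in> cbox p q then h z else 0)" for z
    have fint: "f integrable_on cbox a b" for a b
    proof -
      have "integrable lborel f"
        using hi unfolding f_def set_integrable_def
        by (rule Bochner_Integration.integrable_cong[THEN iffD1, rotated -1]) auto
      then have "set_integrable lborel (cbox a b) f"
        unfolding set_integrable_def by (intro integrable_mult_indicator) auto
      then show ?thesis by (rule set_borel_integral_eq_integral(1))
    qed
    have f0: "integral (cbox a b) f = 0" for a b
    proof -
      obtain r s where rs: "cbox p q \<inter> cbox a b = cbox r s"
        using Int_interval[of p q a b] by blast
      have sub': "cbox r s \<subseteq> I1 \<times> I2" using rs sub by auto
      then have "set_integrable lborel (cbox r s) h"
        using h unfolding locally_integrable_def by auto
      then have bi: "set_integrable lborel (box r s) h"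
        by (rule set_integrable_subset) (auto simp: box_subset_cbox)
      have "integral (cbox a b) f = integral (cbox r s) h"
        unfolding f_def using rs Henstock_Kurzweil_Integration.integral_restrict_Int[of "cbox a b" "cbox p q" h] by simp
      also have "\<dots> = integral (box r s) h" by (rule integral_open_interval[symmetric])
      also have "\<dots> = (LINT z:box r s|lborel. h z)"
        using set_borel_integral_eq_integral(2)[OF bi] by simp
      also have "\<dots> = 0" by (rule box0[OF sub'])
      finally show ?thesis .
    qed
    obtain N where N: "negligible N"
      "\<And>x e. \<lbrakk>x \<notin> N; 0 < e\<rbrakk> \<Longrightarrow> \<exists>d>0. \<forall>h. 0 < h \<and> h < d \<longrightarrow>
          norm (integral (cbox x (x + h *\<^sub>R One)) f /\<^sub>R h ^ DIM(real \<times> real) - f x) < e"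
      using integrable_ccontinuous_explicit[of f, OF fint] by blast
    have fz: "f x = 0" if "x \<notin> N" for x
    proof (rule ccontr)
      assume "f x \<noteq> 0"
      then obtain d :: real where d: "d > 0" "\<forall>h. 0 < h \<and> h < d \<longrightarrow>
          norm (integral (cbox x (x + h *\<^sub>R One)) f /\<^sub>R h ^ DIM(real \<times> real) - f x) < norm (f x)"
        using N(2)[OF \<open>x \<notin> N\<close>, of "norm (f x)"] by auto
      have "0 < d / 2 \<and> d / 2 < d" using d(1) by simp
      from d(2)[unfolded f0, rule_format, OF this] show False by simp
    qed
    have "AE x in completion lborel. x \<notin> N"
      using N(1) by (intro AE_not_in) (simp add: negligible_iff_null_sets)
    then have "AE x in lborel. x \<notin> N" by (simp add: AE_completion_iff)
    then show ?thesis
      by eventually_elim (metis f_def fz)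
  qed
  have "open (I1 \<times> I2)" using I by (rule open_Times)
  then obtain \<D> where \<D>: "countable \<D>" "\<D> \<subseteq> Pow (I1 \<times> I2)" "\<And>X. X \<in> \<D> \<Longrightarrow> \<exists>a b. X = cbox a b" "\<Union>\<D> = I1 \<times> I2"
    using open_countable_Union_open_cbox by blast
  have "AE z in lborel. \<forall>X\<in>\<D>. z \<in> X \<longrightarrow> h z = 0"
    unfolding AE_ball_countable[OF \<D>(1)] using \<D>(2,3) cbox0 by blast
  then show ?thesis
    by eventually_elim (use \<D>(4) in auto)
qed


section \<open>The du Bois-Reymond lemma with a parameter\<close>

lemma signed_integral_DERIV:
  assumes g: "continuous_on UNIV g"
  shows "(signed_integral c g has_real_derivative g x) (at x)"
proof -
  have int: "set_integrable lborel {a..b} g" for a b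
    unfolding set_integrable_def
    by (rule borel_integrable_compact) (use continuous_on_subset[OF g] in auto)
  have P: "primitive_on UNIV (signed_integral c g) g"
    by (rule primitive_on_signed_integral) (auto intro: int)
  have "((\<lambda>y. signed_integral c g (x - 1) + integral {x - 1..y} g) has_real_derivative g x)
      (at x within {x - 1..x + 1})"
    by (auto intro!: derivative_eq_intros integral_has_real_derivative continuous_on_subset[OF g])
  then have "((\<lambda>y. signed_integral c g (x - 1) + integral {x - 1..y} g) has_real_derivative g x) (at x)"
    by (subst (asm) at_within_interior) auto
  then show ?thesis
  proof (rule has_field_derivative_transform_within_open[of _ _ _ "{x - 1<..<x + 1}"])
    fix y assume "y \<in> {x - 1<..<x + 1}"
    then show "signed_integral c g (x - 1) + integral {x - 1..y} g = signed_integral c g y"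
      using primitive_onD(2)[OF P, of "x - 1" y] set_borel_integral_eq_integral(2)[OF int, of "x - 1" y]
      by simp
  qed auto
qed

text \<open>Mean zero makes the primitive vanish to the right of the support of \<open>g\<close>, so
  that it is again a test function.\<close>

lemma test_function_primitive:
  fixes g :: "real \<Rightarrow> real"
  assumes g: "\<And>k. C_k k g" and ab: "{a..b} \<subseteq> I" "\<And>x. x \<notin> {a..b} \<Longrightarrow> g x = 0"
    and mean: "(LINT x|lborel. g x) = 0"
  shows "test_function I (signed_integral a g)" "deriv (signed_integral a g) = g"
proof -
  have cont: "continuous_on UNIV g" using g[of 0] by simp
  note D = signed_integral_DERIV[OF cont, of a]
  show "deriv (signed_integral a g) = g" using D by (auto intro: DERIV_imp_deriv)
  have C: "C_k k (signed_integral a g)" for k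
    using C_k_Suc_imp[OF C_k_real_SucI[OF D g]] .
  have zero: "signed_integral a g x = 0" if "x \<notin> {a..b}" for x
  proof (cases "x < a")
    case True
    have "(LINT y:{x..a}|lborel. g y) = 0"
      unfolding set_lebesgue_integral_def
    proof (rule integral_eq_zero_AE)
      show "AE y in lborel. indicator {x..a} y *\<^sub>R g y = 0"
        using AE_lborel_singleton[of a] by eventually_elim (use ab(2) in \<open>force simp: indicator_def\<close>)
    qed
    then show ?thesis using True by (simp add: signed_integral_le)
  next
    case False
    then have x: "x \<ge> a" "x > b" using that by auto
    have "(LINT y:{a..x}|lborel. g y) = (LINT y|lborel. g y)"
      unfolding set_lebesgue_integral_def
      by (rule Bochner_Integration.integral_cong) (use ab(2) x in \<open>force simp: indicator_def\<close>)+
    then show ?thesis using x mean by (simp add: signed_integral_ge)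
  qed
  show "test_function I (signed_integral a g)"
    by (rule test_function_ivlI[OF C ab(1) zero])
qed

text \<open>Derivatives of test functions are the test functions of mean zero. So
  \<open>\<psi>\<close> is used after subtracting its mean times a fixed bump \<open>\<psi>0\<close>
  of mean 1, and \<open>k\<close> minus its average \<open>c\<close> against \<open>\<psi>0\<close>
  in the first variable turns out to be orthogonal to all products of test functions.\<close>

lemma du_Bois_Reymond_slice:
  fixes k :: "real \<times> real \<Rightarrow> real"
  assumes I1: "open I1" "is_interval I1" "I1 \<noteq> {}" and I2: "open I2" "is_interval I2" "I2 \<noteq> {}"
    and k: "locally_integrable (I1 \<times> I2) k" and km: "k \<in> borel_measurable borel"
    and orth: "\<And>\<psi> \<phi>. test_function I1 \<psi> \<Longrightarrow> test_function I2 \<phi> \<Longrightarrow>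
      (LINT z|lborel. k z * (deriv \<psi> (fst z) * \<phi> (snd z))) = 0"
  obtains c where "c \<in> borel_measurable borel" "AE z in lborel. z \<in> I1 \<times> I2 \<longrightarrow> k z = c (snd z)"
proof -
  obtain x0 x1 where x: "x0 < x1" "{x0..x1} \<subseteq> I1"
    using compact_subset_ivl[of "{}" I1] I1 by auto
  obtain \<beta> :: "nat \<Rightarrow> real \<Rightarrow> real" where \<beta>: "\<And>n k. C_k k (\<beta> n)" "\<And>n x. 0 \<le> \<beta> n x" "\<And>n x. \<beta> n x \<le> 1"
    "\<And>n x. 0 < \<beta> n x \<longleftrightarrow> x \<in> {x0<..<x1}" "\<And>x. (\<lambda>n. \<beta> n x) \<longlonglongrightarrow> indicator {x0<..<x1} x"
    using smooth_approx_indicator[of x0 x1] by blast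
  have z\<beta>: "\<beta> 0 x = 0" if "x \<notin> {x0<..<x1}" for x using \<beta>(2,4)[of 0 x] that by force
  have cont_int: "integrable lborel g" if g: "continuous_on UNIV g" "\<And>x. x \<notin> {a..b} \<Longrightarrow> g x = 0"
    for g :: "real \<Rightarrow> real" and a b
  proof -
    have "integrable lborel (\<lambda>x. indicator {a..b} x *\<^sub>R g x)"
      by (rule borel_integrable_compact) (use continuous_on_subset[OF g(1)] in auto)
    also have "(\<lambda>x. indicator {a..b} x *\<^sub>R g x) = g" using g(2) by (force simp: indicator_def fun_eq_iff)
    finally show ?thesis .
  qed
  have \<beta>cont: "continuous_on UNIV (\<beta> 0)" using \<beta>(1)[of 0 0] by simp
  have \<beta>int: "integrable lborel (\<beta> 0)"
    by (rule cont_int[OF \<beta>cont, of x0 x1]) (use z\<beta> in auto)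
  define m where "m = (LINT x|lborel. \<beta> 0 x)"
  have m: "m > 0"
  proof -
    have "m \<ge> 0" unfolding m_def using \<beta>(2) by simp
    moreover have "m \<noteq> 0"
    proof
      assume "m = 0"
      then have "AE x in lborel. \<beta> 0 x = 0"
        unfolding m_def using integral_nonneg_eq_0_iff_AE[OF \<beta>int] \<beta>(2) by simp
      then have "AE x in lborel. x \<notin> {x0<..<x1}"
        by eventually_elim (metis \<beta>(4) less_irrefl)
      then have "{x0<..<x1} \<in> null_sets lborel" by (subst AE_iff_null_sets) auto
      then show False using x(1) by (auto simp: null_sets_def)
    qed
    ultimately show ?thesis by simp
  qed
  define \<psi>0 where "\<psi>0 x = (1 / m) * \<beta> 0 x" for x
  have \<psi>0C: "C_k n \<psi>0" for n unfolding \<psi>0_def by (rule C_k_cmult[OF \<beta>(1)])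
  have \<psi>0: "C_k n \<psi>0" "x \<notin> {x0..x1} \<Longrightarrow> \<psi>0 x = 0" "integrable lborel \<psi>0" "(LINT x|lborel. \<psi>0 x) = 1"
    for n x
    using \<psi>0C m z\<beta>[of x] \<beta>int unfolding \<psi>0_def[abs_def] by (auto simp: m_def[symmetric])
  have \<psi>0c: "continuous_on UNIV \<psi>0" using \<psi>0(1)[of 0] by simp
  have [measurable]: "\<psi>0 \<in> borel_measurable borel" using \<psi>0c by (rule borel_measurable_continuous_onI)
  note km[measurable]
  define c where "c s = (LINT x|lborel. k (x, s) * \<psi>0 x)" for s
  have cm[measurable]: "c \<in> borel_measurable borel"
    unfolding c_def by measurable
  have cint: "set_integrable lborel {a..b} c" if ab: "{a..b} \<subseteq> I2" for a b
  proof -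
    have ki: "integrable lborel (\<lambda>z. indicator ({x0..x1} \<times> {a..b}) z *\<^sub>R k z)"
      using locally_integrable_rect[OF k x(2) ab] unfolding set_integrable_def .
    have "integrable lborel (\<lambda>z. indicator {a..b} (snd z) * (k z * \<psi>0 (fst z)))"
    proof (rule Bochner_Integration.integrable_bound[OF integrable_mult_right[OF ki, of "1 / m"]])
      show "(\<lambda>z. indicator {a..b} (snd z) * (k z * \<psi>0 (fst z))) \<in> borel_measurable lborel" by measurable
      show "AE z in lborel. norm (indicator {a..b} (snd z) * (k z * \<psi>0 (fst z)))
          \<le> norm (1 / m * (indicator ({x0..x1} \<times> {a..b}) z *\<^sub>R k z))"
      proof (rule AE_I2)
        fix z :: "real \<times> real"
        show "norm (indicator {a..b} (snd z) * (k z * \<psi>0 (fst z)))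
          \<le> norm (1 / m * (indicator ({x0..x1} \<times> {a..b}) z *\<^sub>R k z))"
        proof (cases "z \<in> {x0..x1} \<times> {a..b}")
          case True
          have "\<bar>\<psi>0 (fst z)\<bar> \<le> 1 / m" unfolding \<psi>0_def using \<beta>(2,3)[of 0 "fst z"] m by (simp add: divide_right_mono)
          then have "\<bar>\<psi>0 (fst z)\<bar> * \<bar>k z\<bar> \<le> 1 / m * \<bar>k z\<bar>" by (rule mult_right_mono) simp
          then show ?thesis using True m by (cases z) (simp add: abs_mult mult.commute)
        next
          case False
          then have "indicator {a..b} (snd z) = (0::real) \<or> \<psi>0 (fst z) = 0"
            using \<psi>0(2)[of "fst z"] by (cases z) auto
          then show ?thesis by auto
        qed
      qed
    qed
    from lborel_Fubini(4)[OF this] show ?thesis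
      unfolding set_integrable_def c_def by simp
  qed
  define h where "h z = k z - c (snd z)" for z
  have cloc: "set_integrable lborel ({a..b} \<times> {a'..b'}) (\<lambda>z. c (snd z))" if "{a'..b'} \<subseteq> I2" for a b a' b' :: real
  proof -
    have "integrable lborel (\<lambda>z. indicator {a..b} (fst z) * (indicator {a'..b'} (snd z) *\<^sub>R c (snd z)))"
      using integrable_tensor(1)[of "indicator {a..b}" "\<lambda>s. indicator {a'..b'} s *\<^sub>R c s"] cint[OF that]
        integrable_real_indicator[of "{a..b}" lborel]
      by (auto simp: set_integrable_def emeasure_lborel_Icc_eq)
    also have "(\<lambda>z. indicator {a..b} (fst z) * (indicator {a'..b'} (snd z) *\<^sub>R c (snd z)))
        = (\<lambda>z. indicator ({a..b} \<times> {a'..b'}) z *\<^sub>R c (snd z))"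
      by (auto simp: indicator_def fun_eq_iff)
    finally show ?thesis unfolding set_integrable_def .
  qed
  have hloc: "locally_integrable (I1 \<times> I2) h"
  proof (rule locally_integrable_rectI[OF I1 I2])
    fix a b a' b' assume r: "{a..b} \<subseteq> I1" "{a'..b'} \<subseteq> I2"
    show "set_integrable lborel ({a..b} \<times> {a'..b'}) h"
      unfolding h_def by (rule set_integral_diff(1)[OF locally_integrable_rect[OF k r] cloc[OF r(2)]])
  qed
  have "AE z in lborel. z \<in> I1 \<times> I2 \<longrightarrow> h z = 0"
  proof (rule orthogonal_tensor_imp_AE_0[OF I1(1) I2(1) hloc])
    fix \<psi> \<phi> assume \<psi>: "test_function I1 \<psi>" and \<phi>: "test_function I2 \<phi>"
    obtain a b where ab: "a < b" "{a..b} \<subseteq> I1" "\<And>x. x \<notin> {a..b} \<Longrightarrow> \<psi> x = 0"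
      using test_function_ivl[OF \<psi> I1] by blast
    obtain a' b' where ab': "a' < b'" "{a'..b'} \<subseteq> I2" "\<And>x. x \<notin> {a'..b'} \<Longrightarrow> \<phi> x = 0"
      using test_function_ivl[OF \<phi> I2] by blast
    \<comment> \<open>A common interval for the supports of \<open>\<psi>\<close> and
      \<open>\<psi>0\<close>.\<close>
    define A B where "A = min a x0" and "B = max b x1"
    have out: "x \<notin> {a..b} \<and> x \<notin> {x0..x1}" if "x \<notin> {A..B}" for x
      using that unfolding A_def B_def by auto
    have AB: "{A..B} \<subseteq> I1"
    proof -
      have "A \<in> I1" "B \<in> I1" unfolding A_def B_def min_def max_def using ab x by auto
      then show ?thesis using I1(2) by (meson atLeastAtMost_iff is_interval_1 subsetI)
    qed
    note \<psi>D = test_function_DERIV[OF \<psi>] and \<phi>D = test_function_DERIV[OF \<phi>]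
    have \<psi>i: "integrable lborel \<psi>" by (rule cont_int[OF \<psi>D(2) ab(3)])
    have \<phi>i: "integrable lborel \<phi>" by (rule cont_int[OF \<phi>D(2) ab'(3)])
    define M where "M = (LINT x|lborel. \<psi> x)"
    define g where "g x = \<psi> x - M * \<psi>0 x" for x
    have gC: "C_k n g" for n
      unfolding g_def using \<psi> \<psi>0(1) unfolding test_function_def by (intro C_k_diff C_k_cmult) auto
    have g0: "g x = 0" if "x \<notin> {A..B}" for x
      using out[OF that] ab(3)[of x] \<psi>0(2)[of x] unfolding g_def by auto
    have gm: "(LINT x|lborel. g x) = 0"
      unfolding g_def using \<psi>i \<psi>0(3,4) by (simp add: M_def)
    have rect: "set_integrable lborel ({A..B} \<times> {a'..b'}) k" by (rule locally_integrable_rect[OF k AB ab'(2)])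
    have i1: "integrable lborel (\<lambda>z. k z * (\<psi> (fst z) * \<phi> (snd z)))"
      by (rule integrable_mult_tensor[OF rect \<psi>D(2) _ \<phi>D(2) ab'(3)]) (use ab(3) out in blast)
    have i2: "integrable lborel (\<lambda>z. k z * (\<psi>0 (fst z) * \<phi> (snd z)))"
      by (rule integrable_mult_tensor[OF rect \<psi>0c _ \<phi>D(2) ab'(3)]) (use \<psi>0(2) out in blast)
    have "0 = (LINT z|lborel. k z * (g (fst z) * \<phi> (snd z)))"
      using orth[OF test_function_primitive(1)[OF gC AB g0 gm] \<phi>] test_function_primitive(2)[OF gC AB g0 gm]
      by simp
    also have "\<dots> = (LINT z|lborel. k z * (\<psi> (fst z) * \<phi> (snd z)) - M * (k z * (\<psi>0 (fst z) * \<phi> (snd z))))"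
      by (simp add: g_def algebra_simps)
    also have "\<dots> = (LINT z|lborel. k z * (\<psi> (fst z) * \<phi> (snd z)))
        - M * (LINT z|lborel. k z * (\<psi>0 (fst z) * \<phi> (snd z)))"
      using i1 i2 by simp
    also have "(LINT z|lborel. k z * (\<psi>0 (fst z) * \<phi> (snd z))) = (LINT s|lborel. c s * \<phi> s)"
    proof -
      have "(LINT x|lborel. k (x, s) * (\<psi>0 x * \<phi> s)) = c s * \<phi> s" for s
      proof -
        have "(LINT x|lborel. k (x, s) * (\<psi>0 x * \<phi> s)) = (LINT x|lborel. (k (x, s) * \<psi>0 x) * \<phi> s)"
          by (simp add: mult.assoc)
        then show ?thesis unfolding c_def by (simp only: integral_mult_left_zero)
      qed
      then show ?thesis using lborel_Fubini(6)[OF i2] by simp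
    qed
    finally have e1: "(LINT z|lborel. k z * (\<psi> (fst z) * \<phi> (snd z))) = M * (LINT s|lborel. c s * \<phi> s)" by simp
    have c\<phi>: "integrable lborel (\<lambda>s. c s * \<phi> s)"
    proof -
      have "set_integrable lborel {a'..b'} (\<lambda>s. \<phi> s * c s)"
        by (rule set_integrable_continuous_mult[OF continuous_on_subset[OF \<phi>D(2)] cint[OF ab'(2)]]) simp
      also have "set_integrable lborel {a'..b'} (\<lambda>s. \<phi> s * c s) \<longleftrightarrow> integrable lborel (\<lambda>s. c s * \<phi> s)"
        unfolding set_integrable_def
        by (rule Bochner_Integration.integrable_cong) (use ab'(3) in \<open>auto simp: indicator_def\<close>)
      finally show ?thesis .
    qed
    have e2: "integrable lborel (\<lambda>z. \<psi> (fst z) * (c (snd z) * \<phi> (snd z)))"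
      "(LINT z|lborel. \<psi> (fst z) * (c (snd z) * \<phi> (snd z))) = M * (LINT s|lborel. c s * \<phi> s)"
      using integrable_tensor[OF \<psi>i c\<phi>] by (auto simp: M_def)
    have "(LINT z|lborel. h z * (\<psi> (fst z) * \<phi> (snd z)))
      = (LINT z|lborel. k z * (\<psi> (fst z) * \<phi> (snd z)) - \<psi> (fst z) * (c (snd z) * \<phi> (snd z)))"
      by (simp add: h_def algebra_simps)
    also have "\<dots> = 0" using i1 e2 e1 by simp
    finally show "(LINT z|lborel. h z * (\<psi> (fst z) * \<phi> (snd z))) = 0" .
  qed
  then have "AE z in lborel. z \<in> I1 \<times> I2 \<longrightarrow> k z = c (snd z)"
    by eventually_elim (simp add: h_def)
  with cm show ?thesis by (rule that)
qed

text \<open>On almost every line \<open>G\<close> satisfies classically the integration by parts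
  formula that \<open>f\<close> satisfies weakly, with the same \<open>g\<close>. Hence
  \<open>f - G\<close> is orthogonal to all products of \<open>deriv \<psi>\<close> and
  \<open>\<phi>\<close>, and depends on the second variable only.\<close>

lemma weak_deriv_slice:
  fixes f g G :: "real \<times> real \<Rightarrow> real"
  assumes I1: "open I1" "is_interval I1" "I1 \<noteq> {}" and I2: "open I2" "is_interval I2" "I2 \<noteq> {}"
    and f: "locally_integrable (I1 \<times> I2) f" "f \<in> borel_measurable borel"
    and g: "locally_integrable (I1 \<times> I2) g"
    and G: "locally_integrable (I1 \<times> I2) G" "G \<in> borel_measurable borel"
    and prim: "AE s in lborel. s \<in> I2 \<longrightarrow> primitive_on I1 (\<lambda>x. G (x, s)) (\<lambda>x. g (x, s))"
    and weak: "\<And>\<psi> \<phi>. test_function I1 \<psi> \<Longrightarrow> test_function I2 \<phi> \<Longrightarrow>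
      (LINT z|lborel. f z * (deriv \<psi> (fst z) * \<phi> (snd z))) = - (LINT z|lborel. g z * (\<psi> (fst z) * \<phi> (snd z)))"
  obtains c where "c \<in> borel_measurable borel" "AE z in lborel. z \<in> I1 \<times> I2 \<longrightarrow> f z = c (snd z) + G z"
proof -
  define k where "k z = f z - G z" for z
  have km: "k \<in> borel_measurable borel" unfolding k_def using f(2) G(2) by simp
  have kloc: "locally_integrable (I1 \<times> I2) k"
    using f(1) G(1) unfolding locally_integrable_def k_def by auto
  have orth: "(LINT z|lborel. k z * (deriv \<psi> (fst z) * \<phi> (snd z))) = 0"
    if \<psi>: "test_function I1 \<psi>" and \<phi>: "test_function I2 \<phi>" for \<psi> \<phi>
  proof -
    obtain a b where ab: "a < b" "{a..b} \<subseteq> I1" "\<And>x. x \<notin> {a..b} \<Longrightarrow> \<psi> x = 0"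
      using test_function_ivl[OF \<psi> I1] by blast
    obtain c d where cd: "c < d" "{c..d} \<subseteq> I2" "\<And>x. x \<notin> {c..d} \<Longrightarrow> \<phi> x = 0"
      using test_function_ivl[OF \<phi> I2] by blast
    note \<psi>D = test_function_DERIV[OF \<psi>] and \<phi>D = test_function_DERIV[OF \<phi>]
    have d0: "deriv \<psi> x = 0" if "x \<notin> {a..b}" for x by (rule deriv_eq_0_outside[OF ab(3) that])
    \<comment> \<open>The endpoints lie in the closure of the region where \<open>\<psi>\<close>
      vanishes, so the integration by parts below has no boundary terms.\<close>
    have \<psi>ab: "\<psi> a = 0" "\<psi> b = 0"
    proof -
      have "closure (- {a..b}) \<subseteq> {x. \<psi> x = 0}"
        by (rule closure_minimal) (use ab(3) \<psi>D(2) in \<open>auto intro!: closed_Collect_eq\<close>)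
      moreover have "a \<in> closure (- {a..b})" "b \<in> closure (- {a..b})"
        using ab(1) by (simp_all add: closure_complement)
      ultimately show "\<psi> a = 0" "\<psi> b = 0" by auto
    qed
    note intf = integrable_mult_tensor[OF locally_integrable_rect[OF f(1) ab(2) cd(2)] \<psi>D(3) d0 \<phi>D(2) cd(3)]
    note intG = integrable_mult_tensor[OF locally_integrable_rect[OF G(1) ab(2) cd(2)] \<psi>D(3) d0 \<phi>D(2) cd(3)]
    note intg = integrable_mult_tensor[OF locally_integrable_rect[OF g ab(2) cd(2)] \<psi>D(2) ab(3) \<phi>D(2) cd(3)]
    define F where "F z = G z * (deriv \<psi> (fst z) * \<phi> (snd z)) + g z * (\<psi> (fst z) * \<phi> (snd z))" for z
    have Fint: "integrable lborel F" unfolding F_def using intG intg by simp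
    have "AE s in lborel. (LINT x|lborel. F (x, s)) = 0"
      using prim
    proof eventually_elim
      case (elim s)
      show ?case
      proof (cases "s \<in> I2")
        case False
        then have "\<phi> s = 0" using cd by blast
        then show ?thesis by (simp add: F_def)
      next
        case True
        then have P: "primitive_on {a..b} (\<lambda>x. G (x, s)) (\<lambda>x. g (x, s))"
          using elim ab(2) primitive_on_subset by blast
        have Q: "primitive_on {a..b} \<psi> (deriv \<psi>)"
          by (rule primitive_on_DERIV)
             (use \<psi>D(1) continuous_on_subset[OF \<psi>D(3)] in \<open>auto intro: has_field_derivative_at_within is_interval_cc\<close>)
        have PQ: "primitive_on {a..b} (\<lambda>x. G (x, s) * \<psi> x) (\<lambda>x. G (x, s) * deriv \<psi> x + g (x, s) * \<psi> x)"
          by (rule primitive_on_mult[OF _ P Q]) (simp add: is_interval_cc)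
        have 0: "(LINT x:{a..b}|lborel. G (x, s) * deriv \<psi> x + g (x, s) * \<psi> x) = 0"
          using primitive_onD(2)[OF PQ, of a b] \<psi>ab ab(1) by simp
        have "(LINT x|lborel. F (x, s)) =
            (LINT x|lborel. indicator {a..b} x *\<^sub>R (G (x, s) * deriv \<psi> x + g (x, s) * \<psi> x) * \<phi> s)"
          by (rule Bochner_Integration.integral_cong)
             (use ab(3) d0 in \<open>auto simp: F_def indicator_def algebra_simps\<close>)
        also have "\<dots> = 0" using 0 unfolding set_lebesgue_integral_def by (simp only: integral_mult_left_zero mult_zero_left)
        finally show ?thesis .
      qed
    qed
    then have "(LINT s|lborel. LINT x|lborel. F (x, s)) = 0" by (rule integral_eq_zero_AE)
    then have "(LINT z|lborel. F z) = 0" using lborel_Fubini(6)[OF Fint] by simp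
    then have "(LINT z|lborel. G z * (deriv \<psi> (fst z) * \<phi> (snd z))) = - (LINT z|lborel. g z * (\<psi> (fst z) * \<phi> (snd z)))"
      unfolding F_def using intG intg by simp
    moreover have "(LINT z|lborel. k z * (deriv \<psi> (fst z) * \<phi> (snd z)))
      = (LINT z|lborel. f z * (deriv \<psi> (fst z) * \<phi> (snd z)) - G z * (deriv \<psi> (fst z) * \<phi> (snd z)))"
      by (simp add: k_def algebra_simps)
    ultimately show ?thesis using intf intG weak[OF \<psi> \<phi>] by simp
  qed
  obtain c where "c \<in> borel_measurable borel" "AE z in lborel. z \<in> I1 \<times> I2 \<longrightarrow> k z = c (snd z)"
    by (rule du_Bois_Reymond_slice[OF I1 I2 kloc km orth])
  then show ?thesis
    by (intro that[of c]) (auto elim!: eventually_mono simp: k_def)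
qed

section \<open>Slices of weak derivatives\<close>

lemma AE_lborel_snd:
  assumes "AE t in lborel. P t"
  shows "AE z::real \<times> real in lborel. P (snd z)"
proof -
  obtain N where N: "{t \<in> space lborel. \<not> P t} \<subseteq> N" "emeasure lborel N = 0" "N \<in> sets lborel"
    using assms by (rule AE_E)
  have "{z::real \<times> real. snd z \<notin> N} = UNIV \<times> - N" by auto
  then have m: "{z::real \<times> real. snd z \<notin> N} \<in> sets borel" using N(3) by (auto intro!: borel_Times)
  have "AE t in lborel. t \<notin> N" using N by (intro AE_not_in null_setsI)
  then have "AE z::real \<times> real in lborel. snd z \<notin> N"
    by (intro AE_lborel_pairI1[OF m]) auto
  then show ?thesis using N(1) by (auto elim!: eventually_mono)
qed

lemma AE_lborel_fst:
  assumes "AE t in lborel. P t"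
  shows "AE z::real \<times> real in lborel. P (fst z)"
proof -
  obtain N where N: "{t \<in> space lborel. \<not> P t} \<subseteq> N" "emeasure lborel N = 0" "N \<in> sets lborel"
    using assms by (rule AE_E)
  have "{z::real \<times> real. fst z \<notin> N} = (- N) \<times> UNIV" by auto
  then have m: "{z::real \<times> real. fst z \<notin> N} \<in> sets borel" using N(3) by (auto intro!: borel_Times)
  have "AE t in lborel. t \<notin> N" using N by (intro AE_not_in null_setsI)
  then have "AE z::real \<times> real in lborel. fst z \<notin> N"
    by (intro AE_lborel_pairI1[OF m]) auto
  then show ?thesis using N(1) by (auto elim!: eventually_mono)
qed

lemma borel_measurable_rect:
  fixes f :: "real \<times> real \<Rightarrow> real"
  assumes "f \<in> borel_measurable borel" "A \<in> sets borel" "B \<in> sets borel"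
  shows "(\<lambda>z. indicat_real (A \<times> B) z *\<^sub>R f z) \<in> borel_measurable lborel"
  using assms by (intro borel_measurable_scaleR borel_measurable_indicator) (auto intro!: borel_Times)

text \<open>Serves to replace functions by their extensions by 0 outside the domain.\<close>

lemma weak_deriv_cong:
  assumes "weak_deriv \<Omega> b f g" "\<And>z. z \<in> \<Omega> \<Longrightarrow> f z = f' z" "\<And>z. z \<in> \<Omega> \<Longrightarrow> g z = g' z"
  shows "weak_deriv \<Omega> b f' g'"
proof -
  have si: "set_integrable lborel K f' \<longleftrightarrow> set_integrable lborel K f"
     "set_integrable lborel K g' \<longleftrightarrow> set_integrable lborel K g" if "K \<subseteq> \<Omega>" for K
    by (rule set_integrable_cong; use that assms(2,3) in auto)+
  have li: "(LINT x:\<Omega>|lborel. f' x * h x) = (LINT x:\<Omega>|lborel. f x * h x)"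
    "(LINT x:\<Omega>|lborel. g' x * h x) = (LINT x:\<Omega>|lborel. g x * h x)" for h
    unfolding set_lebesgue_integral_def
    by (rule Bochner_Integration.integral_cong; use assms(2,3) in \<open>auto simp: indicator_def\<close>)+
  show ?thesis
    using assms(1) unfolding weak_deriv_def locally_integrable_def li
    by (auto simp: si)
qed

lemma weak_deriv_tensor:
  fixes f g :: "real \<times> real \<Rightarrow> real"
  assumes "test_function I1 \<psi>" "test_function I2 \<phi>"
  shows "weak_deriv (I1 \<times> I2) (1, 0) f g \<Longrightarrow>
      (LINT z|lborel. f z * (deriv \<psi> (fst z) * \<phi> (snd z))) = - (LINT z|lborel. g z * (\<psi> (fst z) * \<phi> (snd z)))"
    and "weak_deriv (I1 \<times> I2) (0, 1) f g \<Longrightarrow>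
      (LINT z|lborel. f z * (\<psi> (fst z) * deriv \<phi> (snd z))) = - (LINT z|lborel. g z * (\<psi> (fst z) * \<phi> (snd z)))"
proof -
  have z1: "\<psi> x = 0" "deriv \<psi> x = 0" if xI: "x \<notin> I" and tf: "test_function I \<psi>" for x I and \<psi> :: "real \<Rightarrow> real"
  proof -
    obtain K where K: "compact K" "K \<subseteq> I" "\<And>x. x \<notin> K \<Longrightarrow> \<psi> x = 0"
      using tf unfolding test_function_def by blast
    show "\<psi> x = 0" using K(2,3) xI by blast
    have "((\<lambda>x. 0) has_real_derivative 0) (at x)" by simp
    then have "(\<psi> has_real_derivative 0) (at x)"
      by (rule has_field_derivative_transform_within_open[of _ _ _ "- K"])
         (use K xI in \<open>auto simp: compact_imp_closed open_Compl\<close>)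
    then show "deriv \<psi> x = 0" by (rule DERIV_imp_deriv)
  qed
  have ind: "(LINT z:I1 \<times> I2|lborel. h z * k z) = (LINT z|lborel. h z * k z)"
    if "\<And>z. z \<notin> I1 \<times> I2 \<Longrightarrow> k z = 0" for h k :: "real \<times> real \<Rightarrow> real"
    unfolding set_lebesgue_integral_def
    by (rule Bochner_Integration.integral_cong) (use that in \<open>auto simp: indicator_def\<close>)
  have i1: "(LINT z:I1 \<times> I2|lborel. h z * (deriv \<psi> (fst z) * \<phi> (snd z)))
        = (LINT z|lborel. h z * (deriv \<psi> (fst z) * \<phi> (snd z)))"
    "(LINT z:I1 \<times> I2|lborel. h z * (\<psi> (fst z) * deriv \<phi> (snd z)))
        = (LINT z|lborel. h z * (\<psi> (fst z) * deriv \<phi> (snd z)))"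
    "(LINT z:I1 \<times> I2|lborel. h z * (\<psi> (fst z) * \<phi> (snd z)))
        = (LINT z|lborel. h z * (\<psi> (fst z) * \<phi> (snd z)))" for h
    by (rule ind; use z1[OF _ assms(1)] z1[OF _ assms(2)] in \<open>auto simp: mem_Times_iff\<close>)+
  note tp = test_function_prod[OF assms]
  show "weak_deriv (I1 \<times> I2) (1, 0) f g \<Longrightarrow>
      (LINT z|lborel. f z * (deriv \<psi> (fst z) * \<phi> (snd z))) = - (LINT z|lborel. g z * (\<psi> (fst z) * \<phi> (snd z)))"
    using tp(1) unfolding weak_deriv_def by (auto simp: tp(2) i1 dest!: spec[of _ "\<lambda>z. \<psi> (fst z) * \<phi> (snd z)"])
  show "weak_deriv (I1 \<times> I2) (0, 1) f g \<Longrightarrow>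
      (LINT z|lborel. f z * (\<psi> (fst z) * deriv \<phi> (snd z))) = - (LINT z|lborel. g z * (\<psi> (fst z) * \<phi> (snd z)))"
    using tp(1) unfolding weak_deriv_def by (auto simp: tp(3) i1 dest!: spec[of _ "\<lambda>z. \<psi> (fst z) * \<phi> (snd z)"])
qed

section \<open>Oriented integrals depending on a parameter\<close>

lemma abs_signed_integral_le:
  assumes "set_integrable lborel {-r..r} g" "\<bar>y\<bar> \<le> r"
  shows "\<bar>signed_integral 0 g y\<bar> \<le> (LINT x:{-r..r}|lborel. \<bar>g x\<bar>)"
proof -
  have *: "\<bar>LINT x:{a..b}|lborel. g x\<bar> \<le> (LINT x:{-r..r}|lborel. \<bar>g x\<bar>)" if "{a..b} \<subseteq> {-r..r}" for a b
  proof -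
    have i: "set_integrable lborel {a..b} g" by (rule set_integrable_subset[OF assms(1)]) (use that in auto)
    have "\<bar>LINT x:{a..b}|lborel. g x\<bar> \<le> (LINT x:{a..b}|lborel. \<bar>g x\<bar>)"
      by (rule set_integral_abs_bound[OF i])
    also have "\<dots> \<le> (LINT x:{-r..r}|lborel. \<bar>g x\<bar>)"
      using set_integrable_abs[OF assms(1)] set_integrable_abs[OF i] that
      unfolding set_lebesgue_integral_def set_integrable_def
      by (intro integral_mono) (auto simp: indicator_def split: if_splits)
    finally show ?thesis .
  qed
  show ?thesis
    using *[of 0 y] *[of y 0] assms(2) unfolding signed_integral_def by (auto split: if_splits)
qed

text \<open>With the orientation moved into the integrand, the domain of integration no longer
  varies, and joint measurability in parameters follows from the theorem on parameter
  integrals.\<close>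

lemma signed_integral_eq_LINT:
  "signed_integral c g y =
    (LINT x|lborel. (if c \<le> y then if c \<le> x \<and> x \<le> y then g x else 0 else if y \<le> x \<and> x \<le> c then - g x else 0))"
proof -
  have "(LINT x|lborel. indicator {c..y} x *\<^sub>R g x) = (LINT x|lborel. (if c \<le> x \<and> x \<le> y then g x else 0))"
    by (rule Bochner_Integration.integral_cong) (auto simp: indicator_def)
  moreover have "- (LINT x|lborel. indicator {y..c} x *\<^sub>R g x) = (LINT x|lborel. (if y \<le> x \<and> x \<le> c then - g x else 0))"
    unfolding Bochner_Integration.integral_minus[symmetric]
    by (rule Bochner_Integration.integral_cong) (auto simp: indicator_def)
  ultimately show ?thesis
    unfolding signed_integral_def set_lebesgue_integral_def by simp
qed

lemma borel_measurable_signed_integral [measurable (raw)]: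
  fixes g :: "'a \<Rightarrow> real \<Rightarrow> real"
  assumes [measurable]: "case_prod g \<in> borel_measurable (M \<Otimes>\<^sub>M borel)" "y \<in> borel_measurable M"
  shows "(\<lambda>z. signed_integral c (g z) (y z)) \<in> borel_measurable M"
  unfolding signed_integral_eq_LINT
proof (rule lborel.borel_measurable_lebesgue_integral)
  have "(\<lambda>p. g (fst p) (snd p)) \<in> borel_measurable (M \<Otimes>\<^sub>M borel)"
    using assms(1) by (simp add: split_beta')
  then have [measurable]: "(\<lambda>p. g (fst p) (snd p)) \<in> borel_measurable (M \<Otimes>\<^sub>M lborel)"
    by (subst measurable_cong_sets[OF sets_pair_measure_cong[OF refl sets_lborel] refl])
  show "(\<lambda>(z, x). if c \<le> y z then if c \<le> x \<and> x \<le> y z then g z x else 0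
      else if y z \<le> x \<and> x \<le> c then - g z x else 0) \<in> borel_measurable (M \<Otimes>\<^sub>M lborel)"
    unfolding split_beta' by measurable
qed

text \<open>One exceptional set of times has to serve all intervals \<open>{a..b}\<close>; countably
  many time intervals that cover \<open>I\<close>, together with the space intervals
  \<open>{-n..n}\<close>, suffice.\<close>

lemma AE_slice_integrable:
  fixes g :: "real \<times> real \<Rightarrow> real"
  assumes I: "open I" and g: "locally_integrable (UNIV \<times> I) g"
  shows "AE t in lborel. t \<in> I \<longrightarrow> (\<forall>a b. set_integrable lborel {a..b} (\<lambda>x. g (x, t)))"
proof -
  obtain \<D> where \<D>: "countable \<D>" "\<D> \<subseteq> Pow I" "\<And>X. X \<in> \<D> \<Longrightarrow> \<exists>a b. X = cbox a b" "\<Union>\<D> = I"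
    using open_countable_Union_open_cbox[OF I] by blast
  have 1: "AE t in lborel. t \<in> X \<longrightarrow> set_integrable lborel {-real n..real n} (\<lambda>x. g (x, t))" if XD: "X \<in> \<D>" for X n
  proof -
    obtain c d where "X = cbox c d" using \<D>(3)[OF XD] by blast
    then have cd: "X = {c..d}" "{c..d} \<subseteq> I" using \<D>(2) XD by auto
    have "integrable lborel (\<lambda>z. indicator ({-real n..real n} \<times> {c..d}) z *\<^sub>R g z)"
      using locally_integrable_rect[OF g _ cd(2)] unfolding set_integrable_def by auto
    from lborel_Fubini(2)[OF this] show ?thesis
    proof eventually_elim
      case (elim t)
      show ?case
      proof
        assume "t \<in> X"
        then have "(\<lambda>x. indicator ({-real n..real n} \<times> {c..d}) (x, t) *\<^sub>R g (x, t)) =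
            (\<lambda>x. indicator {-real n..real n} x *\<^sub>R g (x, t))" by (auto simp: cd indicator_def)
        then show "set_integrable lborel {-real n..real n} (\<lambda>x. g (x, t))"
          using elim unfolding set_integrable_def by simp
      qed
    qed
  qed
  have "AE t in lborel. \<forall>X\<in>\<D>. \<forall>n. t \<in> X \<longrightarrow> set_integrable lborel {-real n..real n} (\<lambda>x. g (x, t))"
    unfolding AE_ball_countable[OF \<D>(1)] AE_all_countable using 1 by blast
  then show ?thesis
  proof eventually_elim
    case (elim t)
    show ?case
    proof (intro impI allI)
      fix a b assume "t \<in> I"
      then have i: "set_integrable lborel {-real n..real n} (\<lambda>x. g (x, t))" for n using elim \<D>(4) by blast
      obtain n where "real n \<ge> max \<bar>a\<bar> \<bar>b\<bar>" using real_arch_simple by blast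
      then show "set_integrable lborel {a..b} (\<lambda>x. g (x, t))"
        by (intro set_integrable_subset[OF i[of n]]) auto
    qed
  qed
qed

text \<open>With \<open>G\<close> the oriented integral of \<open>g\<close> from 0 in space,
  \<open>f - G\<close> is a function \<open>c\<close> of time only. For almost every time
  \<open>c t + G\<close> is then an everywhere defined, locally absolutely continuous representative
  of the slice of \<open>f\<close>.\<close>

lemma weak_deriv_space_slice:
  fixes f g :: "real \<times> real \<Rightarrow> real"
  assumes I: "open I" "is_interval I" "I \<noteq> {}"
    and f: "locally_integrable (UNIV \<times> I) f" "f \<in> borel_measurable borel"
    and g: "locally_integrable (UNIV \<times> I) g" "g \<in> borel_measurable borel"
    and weak: "\<And>\<psi> \<phi>. test_function UNIV \<psi> \<Longrightarrow> test_function I \<phi> \<Longrightarrow>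
      (LINT z|lborel. f z * (deriv \<psi> (fst z) * \<phi> (snd z))) = - (LINT z|lborel. g z * (\<psi> (fst z) * \<phi> (snd z)))"
  shows "AE t in lborel. t \<in> I \<longrightarrow>
    (\<exists>u. primitive_on UNIV u (\<lambda>y. g (y, t)) \<and> (AE y in lborel. f (y, t) = u y))"
proof -
  note [measurable] = f(2) g(2)
  define G where "G z = signed_integral 0 (\<lambda>x. g (x, snd z)) (fst z)" for z
  have Gm[measurable]: "G \<in> borel_measurable borel" unfolding G_def by measurable
  have sl: "AE t in lborel. t \<in> I \<longrightarrow> (\<forall>a b. set_integrable lborel {a..b} (\<lambda>x. g (x, t)))"
    by (rule AE_slice_integrable[OF I(1) g(1)])
  have prim: "AE t in lborel. t \<in> I \<longrightarrow> primitive_on UNIV (\<lambda>y. G (y, t)) (\<lambda>y. g (y, t))"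
    using sl
  proof eventually_elim
    case (elim t)
    have "primitive_on UNIV (signed_integral 0 (\<lambda>x. g (x, t))) (\<lambda>y. g (y, t))" if "t \<in> I"
      by (rule primitive_on_signed_integral) (use elim that in auto)
    then show ?case by (simp add: G_def)
  qed
  have U: "open (UNIV :: real set)" "is_interval (UNIV :: real set)" "(UNIV :: real set) \<noteq> {}" by auto
  have Gl: "locally_integrable (UNIV \<times> I) G"
  proof (rule locally_integrable_rectI[OF U I])
    fix a b c d :: real assume cd: "{c..d} \<subseteq> I"
    define r where "r = max \<bar>a\<bar> \<bar>b\<bar>"
    have gi: "integrable lborel (\<lambda>z. \<bar>indicator ({-r..r} \<times> {c..d}) z *\<^sub>R g z\<bar>)"
      using locally_integrable_rect[OF g(1) _ cd, of "-r" r] unfolding set_integrable_def by auto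
    \<comment> \<open>On the rectangle \<open>G\<close> is dominated by the integral of
      \<open>\<bar>g\<bar>\<close> over \<open>{-r..r}\<close> in space, an integrable function of
      time; this proves local integrability of \<open>G\<close>.\<close>
    define m where "m t = (LINT x|lborel. \<bar>indicator ({-r..r} \<times> {c..d}) (x, t) *\<^sub>R g (x, t)\<bar>)" for t
    have "integrable lborel m" unfolding m_def by (rule lborel_Fubini(4)[OF gi])
    moreover have "integrable lborel (indicat_real {a..b})"
      by (rule integrable_real_indicator) (auto simp: emeasure_lborel_Icc_eq)
    ultimately have mi: "integrable lborel (\<lambda>z. indicat_real {a..b} (fst z) * m (snd z))"
      by (intro integrable_tensor(1))
    show "set_integrable lborel ({a..b} \<times> {c..d}) G"
      unfolding set_integrable_def
    proof (rule Bochner_Integration.integrable_bound[OF mi])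
      show "(\<lambda>z. indicat_real ({a..b} \<times> {c..d}) z *\<^sub>R G z) \<in> borel_measurable lborel"
        by (intro borel_measurable_rect Gm) auto
      have "AE z::real \<times> real in lborel. snd z \<in> I \<longrightarrow> (\<forall>a b. set_integrable lborel {a..b} (\<lambda>x. g (x, snd z)))"
        by (rule AE_lborel_snd[OF sl])
      then have "AE z::real \<times> real in lborel. snd z \<in> {c..d} \<longrightarrow> set_integrable lborel {-r..r} (\<lambda>x. g (x, snd z))"
        by eventually_elim (use cd in blast)
      then show "AE z in lborel. norm (indicat_real ({a..b} \<times> {c..d}) z *\<^sub>R G z)
          \<le> norm (indicat_real {a..b} (fst z) * m (snd z))"
      proof eventually_elim
        case (elim z)
        show ?case
        proof (cases "z \<in> {a..b} \<times> {c..d}")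
          case True
          then have z: "fst z \<in> {a..b}" "snd z \<in> {c..d}" by auto
          have "\<bar>fst z\<bar> \<le> r" using z unfolding r_def by auto
          then have "\<bar>G z\<bar> \<le> (LINT x:{-r..r}|lborel. \<bar>g (x, snd z)\<bar>)"
            unfolding G_def using elim z by (intro abs_signed_integral_le) auto
          also have "\<dots> = m (snd z)"
            unfolding m_def set_lebesgue_integral_def
            by (rule Bochner_Integration.integral_cong) (use z in \<open>auto simp: indicator_def\<close>)
          finally show ?thesis using True z by simp
        next
          case False
          then show ?thesis by simp
        qed
      qed
    qed
  qed
  obtain c where c: "c \<in> borel_measurable borel" "AE z in lborel. z \<in> UNIV \<times> I \<longrightarrow> f z = c (snd z) + G z"
    using weak_deriv_slice[OF U I f(1,2) g(1) Gl Gm prim weak] by blast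
  show ?thesis
    using AE_lborel_pairD2[OF c(2)] prim
  proof eventually_elim
    case (elim t)
    show ?case
    proof
      assume t: "t \<in> I"
      have "primitive_on UNIV (\<lambda>y. c t + G (y, t)) (\<lambda>y. 0 + g (y, t))"
        by (rule primitive_on_add[OF primitive_on_const]) (use elim t in auto)
      then show "\<exists>u. primitive_on UNIV u (\<lambda>y. g (y, t)) \<and> (AE y in lborel. f (y, t) = u y)"
        using elim t by (intro exI[of _ "\<lambda>y. c t + G (y, t)"]) auto
    qed
  qed
qed

lemma borel_measurable_locally_integrable:
  fixes f :: "'a::euclidean_space \<Rightarrow> real"
  assumes "locally_integrable UNIV f"
  shows "f \<in> borel_measurable borel"
proof (rule borel_measurable_LIMSEQ_real)
  show "(\<lambda>x. indicator (cball 0 (real n)) x *\<^sub>R f x) \<in> borel_measurable borel" for n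
  proof -
    have "integrable lborel (\<lambda>x. indicator (cball 0 (real n)) x *\<^sub>R f x)"
      using assms unfolding locally_integrable_def set_integrable_def by auto
    then show ?thesis using borel_measurable_integrable by fastforce
  qed
  show "(\<lambda>n. indicator (cball 0 (real n)) x *\<^sub>R f x) \<longlonglongrightarrow> f x" for x
  proof (rule tendsto_eventually)
    obtain n where "norm x \<le> real n" using real_arch_simple by blast
    then show "\<forall>\<^sub>F n in sequentially. indicator (cball 0 (real n)) x *\<^sub>R f x = f x"
      by (intro eventually_sequentiallyI[of n]) (auto simp: indicator_def)
  qed
qed

lemma AE_lborel_ex_ivl:
  assumes "AE t in lborel. P t" "a < (b::real)"
  shows "\<exists>t\<in>{a<..<b}. P t"
proof (rule ccontr)
  assume "\<not> ?thesis"
  then have "AE t in lborel. t \<notin> {a<..<b}" using assms(1) by (auto elim!: eventually_mono)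
  then have "{a<..<b} \<in> null_sets lborel" by (subst AE_iff_null_sets) auto
  then show False using assms(2) by (auto simp: null_sets_def)
qed

text \<open>A dummy time variable in \<open>{0<..<1}\<close> turns the one-dimensional statement
  into an instance of \<open>weak_deriv_space_slice\<close>; any one of the good times supplies
  \<open>u\<close>.\<close>

lemma weak_deriv1_primitive:
  assumes "weak_deriv1 f g"
  obtains u where "primitive_on UNIV u g" "AE y in lborel. f y = u y"
proof -
  have loc: "locally_integrable UNIV f" "locally_integrable UNIV g"
    using assms unfolding weak_deriv_def by auto
  have [measurable]: "f \<in> borel_measurable borel" "g \<in> borel_measurable borel"
    using loc by (auto intro: borel_measurable_locally_integrable)
  define I :: "real set" where "I = {0<..<1}"
  have I: "open I" "is_interval I" "I \<noteq> {}" unfolding I_def by (auto simp: is_interval_oo)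
  have U: "open (UNIV :: real set)" "is_interval (UNIV :: real set)" "(UNIV :: real set) \<noteq> {}" by auto
  have lc: "locally_integrable (UNIV \<times> I) (\<lambda>z. h (fst z))" if h: "locally_integrable UNIV h" for h :: "real \<Rightarrow> real"
  proof (rule locally_integrable_rectI[OF U I])
    fix a b c d :: real
    have "integrable lborel (\<lambda>x. indicat_real {a..b} x *\<^sub>R h x)"
      using h unfolding locally_integrable_def set_integrable_def by auto
    moreover have "integrable lborel (indicat_real {c..d})"
      by (rule integrable_real_indicator) (auto simp: emeasure_lborel_Icc_eq)
    ultimately have "integrable lborel (\<lambda>z. (indicat_real {a..b} (fst z) *\<^sub>R h (fst z)) * indicat_real {c..d} (snd z))"
      by (rule integrable_tensor(1))
    also have "(\<lambda>z. (indicat_real {a..b} (fst z) *\<^sub>R h (fst z)) * indicat_real {c..d} (snd z))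
        = (\<lambda>z. indicat_real ({a..b} \<times> {c..d}) z *\<^sub>R h (fst z))"
      by (auto simp: indicator_def fun_eq_iff)
    finally show "set_integrable lborel ({a..b} \<times> {c..d}) (\<lambda>z. h (fst z))"
      unfolding set_integrable_def .
  qed
  have "AE t in lborel. t \<in> I \<longrightarrow>
    (\<exists>u. primitive_on UNIV u (\<lambda>y. g (fst (y, t))) \<and> (AE y in lborel. f (fst (y, t)) = u y))"
  proof (rule weak_deriv_space_slice[OF I lc[OF loc(1)] _ lc[OF loc(2)]])
    fix \<psi> \<phi> assume \<psi>: "test_function (UNIV :: real set) \<psi>" and \<phi>: "test_function I \<phi>"
    note \<psi>D = test_function_DERIV[OF \<psi>] and \<phi>D = test_function_DERIV[OF \<phi>]
    obtain a b where ab: "a < b" "{a..b} \<subseteq> UNIV" "\<And>x. x \<notin> {a..b} \<Longrightarrow> \<psi> x = 0"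
      using test_function_ivl[OF \<psi> U] by blast
    obtain c d where cd: "c < d" "{c..d} \<subseteq> I" "\<And>x. x \<notin> {c..d} \<Longrightarrow> \<phi> x = 0"
      using test_function_ivl[OF \<phi> I] by blast
    have fr: "frechet_derivative \<psi> (at x) 1 = deriv \<psi> x" for x
      using frechet_derivative_at[OF \<psi>D(1)[unfolded has_field_derivative_def], of x, symmetric] by simp
    have d0: "deriv \<psi> x = 0" if "x \<notin> {a..b}" for x by (rule deriv_eq_0_outside[OF ab(3) that])
    have int: "integrable lborel (\<lambda>x. h x * k x)"
      if h: "locally_integrable UNIV h" and k: "continuous_on UNIV k" "\<And>x. x \<notin> {a..b} \<Longrightarrow> k x = 0" for h k :: "real \<Rightarrow> real" and a b
    proof -
      have "set_integrable lborel {a..b} (\<lambda>x. k x * h x)"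
        by (rule set_integrable_continuous_mult[OF continuous_on_subset[OF k(1)]])
           (use h in \<open>auto simp: locally_integrable_def\<close>)
      also have "set_integrable lborel {a..b} (\<lambda>x. k x * h x) \<longleftrightarrow> integrable lborel (\<lambda>x. h x * k x)"
        unfolding set_integrable_def
        by (rule Bochner_Integration.integrable_cong) (use k(2) in \<open>auto simp: indicator_def\<close>)
      finally show ?thesis .
    qed
    have one: "locally_integrable UNIV (\<lambda>x::real. 1::real)"
      unfolding locally_integrable_def set_integrable_def
      by (intro allI impI borel_integrable_compact continuous_on_const)
    have \<phi>i: "integrable lborel \<phi>" using int[OF one \<phi>D(2) cd(3)] by simp
    have "(LINT z|lborel. f (fst z) * (deriv \<psi> (fst z) * \<phi> (snd z)))
        = (LINT x|lborel. f x * deriv \<psi> x) * (LINT s|lborel. \<phi> s)"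
      using integrable_tensor(2)[OF int[OF loc(1) \<psi>D(3) d0] \<phi>i] by (simp add: mult.assoc)
    also have "(LINT x|lborel. f x * deriv \<psi> x) = - (LINT x|lborel. g x * \<psi> x)"
      using assms \<psi> unfolding weak_deriv_def by (auto simp: fr set_lebesgue_integral_def)
    also have "- (LINT x|lborel. g x * \<psi> x) * (LINT s|lborel. \<phi> s)
        = - (LINT z|lborel. g (fst z) * (\<psi> (fst z) * \<phi> (snd z)))"
      using integrable_tensor(2)[OF int[OF loc(2) \<psi>D(2) ab(3)] \<phi>i] by (simp add: mult.assoc)
    finally show "(LINT z|lborel. f (fst z) * (deriv \<psi> (fst z) * \<phi> (snd z)))
        = - (LINT z|lborel. g (fst z) * (\<psi> (fst z) * \<phi> (snd z)))" .
  qed (measurable)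
  from AE_lborel_ex_ivl[OF this, of 0 1] show ?thesis
    using that unfolding I_def by auto
qed

section \<open>Time slices and the initial value\<close>

lemma AE_integrable_time_slice:
  fixes g :: "real \<times> real \<Rightarrow> real"
  assumes gi: "\<And>r. set_integrable lborel ({-r..r} \<times> UNIV) g"
  shows "AE y in lborel. integrable lborel (\<lambda>s. g (y, s))"
proof -
  have "AE y in lborel. \<forall>n::nat. integrable lborel (\<lambda>s. indicat_real ({-real n..real n} \<times> UNIV) (y, s) *\<^sub>R g (y, s))"
    unfolding AE_all_countable using gi lborel_Fubini(1) unfolding set_integrable_def by blast
  then show ?thesis
  proof eventually_elim
    case (elim y)
    obtain n where "\<bar>y\<bar> \<le> real n" using real_arch_simple by blast
    then have "(\<lambda>s. indicat_real ({-real n..real n} \<times> UNIV) (y, s) *\<^sub>R g (y, s)) = (\<lambda>s. g (y, s))"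
      by (auto simp: indicator_def fun_eq_iff)
    then show ?case using elim by metis
  qed
qed

text \<open>After an exchange of coordinates time is the differentiated variable, and
  \<open>f\<close> minus the time integral of \<open>g\<close> is a function \<open>c\<close> of
  space only. As \<open>g\<close> is integrable down to \<open>t = 0\<close>, that integral may
  start at 0 and tends to 0 with \<open>t\<close>, locally in L1; the initial condition then forces
  \<open>c = f0\<close>.\<close>

lemma weak_deriv_time_slice:
  fixes f g :: "real \<times> real \<Rightarrow> real" and f0 :: "real \<Rightarrow> real"
  assumes T: "T > 0" and w: "weak_deriv (strip T) (0, 1) f g"
    and f[measurable]: "f \<in> borel_measurable borel" and g[measurable]: "g \<in> borel_measurable borel"
    and gi: "\<And>r. set_integrable lborel ({-r..r} \<times> UNIV) g"
    and f0[measurable]: "f0 \<in> borel_measurable borel" and init: "attains_initial f f0"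
  shows "AE z in lborel. z \<in> strip T \<longrightarrow> f z = f0 (fst z) + (LINT s:{0..snd z}|lborel. g (fst z, s))"
proof -
  define I where "I = {0<..<T}"
  have I: "open I" "is_interval I" "I \<noteq> {}" unfolding I_def using T by (auto simp: is_interval_oo)
  have U: "open (UNIV :: real set)" "is_interval (UNIV :: real set)" "(UNIV :: real set) \<noteq> {}" by auto
  have wl: "locally_integrable (UNIV \<times> I) f" "locally_integrable (UNIV \<times> I) g"
    using w unfolding weak_deriv_def strip_def I_def by auto
  define F where "F z = f (snd z, fst z)" for z
  define g' where "g' z = g (snd z, fst z)" for z
  define G where "G z = (LINT s:{0..fst z}|lborel. g (snd z, s))" for z
  have [measurable]: "F \<in> borel_measurable borel" "g' \<in> borel_measurable borel"
    unfolding F_def g'_def by measurable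
  have Gs: "G z = (LINT s|lborel. (if 0 \<le> s \<and> s \<le> fst z then g (snd z, s) else 0))" for z
    unfolding G_def set_lebesgue_integral_def
    by (rule Bochner_Integration.integral_cong) (auto simp: indicator_def)
  have Gm[measurable]: "G \<in> borel_measurable borel" unfolding Gs by measurable
  have swapl: "locally_integrable (I \<times> UNIV) (\<lambda>z. h (snd z, fst z))" if h: "locally_integrable (UNIV \<times> I) h"
    for h :: "real \<times> real \<Rightarrow> real"
  proof (rule locally_integrable_rectI[OF I U])
    fix a b c d assume ab: "{a..b} \<subseteq> I"
    have "integrable lborel (\<lambda>z. indicat_real ({c..d} \<times> {a..b}) z *\<^sub>R h z)"
      using locally_integrable_rect[OF h _ ab, of c d] unfolding set_integrable_def by auto
    from integrable_lborel_swap(1)[OF this]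
    have "integrable lborel (\<lambda>z. indicat_real ({c..d} \<times> {a..b}) (snd z, fst z) *\<^sub>R h (snd z, fst z))" .
    also have "(\<lambda>z. indicat_real ({c..d} \<times> {a..b}) (snd z, fst z) *\<^sub>R h (snd z, fst z))
       = (\<lambda>z. indicat_real ({a..b} \<times> {c..d}) z *\<^sub>R h (snd z, fst z))"
      by (auto simp: indicator_def fun_eq_iff)
    finally show "set_integrable lborel ({a..b} \<times> {c..d}) (\<lambda>z. h (snd z, fst z))"
      unfolding set_integrable_def .
  qed
  have Fl: "locally_integrable (I \<times> UNIV) F" "locally_integrable (I \<times> UNIV) g'"
    unfolding F_def g'_def by (intro swapl wl)+
  have gabs: "integrable lborel (\<lambda>z. \<bar>indicat_real ({-r..r} \<times> UNIV) z *\<^sub>R g z\<bar>)" for r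
    using gi[of r] unfolding set_integrable_def by auto
  have sl: "AE y in lborel. integrable lborel (\<lambda>s. g (y, s))" by (rule AE_integrable_time_slice[OF gi])
  have sub_int: "set_integrable lborel A h" if "integrable lborel h" "A \<in> sets borel" for A and h :: "real \<Rightarrow> real"
    unfolding set_integrable_def by (rule integrable_mult_indicator) (use that in auto)
  have prim: "AE y in lborel. y \<in> UNIV \<longrightarrow> primitive_on I (\<lambda>t. G (t, y)) (\<lambda>t. g' (t, y))"
    using sl
  proof eventually_elim
    case (elim y)
    have "primitive_on {0..} (signed_integral 0 (\<lambda>s. g (y, s))) (\<lambda>s. g (y, s))"
      by (rule primitive_on_signed_integral) (auto intro!: sub_int elim)
    then have "primitive_on I (signed_integral 0 (\<lambda>s. g (y, s))) (\<lambda>s. g (y, s))"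
      by (rule primitive_on_subset) (auto simp: I_def)
    then show ?case
      by (auto simp: G_def g'_def I_def signed_integral_ge intro: primitive_on_cong)
  qed
  define m where "m r y = (LINT s|lborel. \<bar>indicat_real ({-r..r} \<times> UNIV) (y, s) *\<^sub>R g (y, s)\<bar>)" for r y
  have mi: "integrable lborel (m r)" for r
    unfolding m_def by (rule lborel_Fubini(3)[OF gabs])
  have Gl: "locally_integrable (I \<times> UNIV) G"
  proof (rule locally_integrable_rectI[OF I U])
    fix a b c d :: real
    define r where "r = max \<bar>c\<bar> \<bar>d\<bar>"
    have "integrable lborel (indicat_real {a..b})"
      by (rule integrable_real_indicator) (auto simp: emeasure_lborel_Icc_eq)
    then have mi': "integrable lborel (\<lambda>z. indicat_real {a..b} (fst z) * m r (snd z))"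
      using mi by (rule integrable_tensor(1))
    show "set_integrable lborel ({a..b} \<times> {c..d}) G"
      unfolding set_integrable_def
    proof (rule Bochner_Integration.integrable_bound[OF mi'])
      show "(\<lambda>z. indicat_real ({a..b} \<times> {c..d}) z *\<^sub>R G z) \<in> borel_measurable lborel"
        by (intro borel_measurable_rect Gm) auto
      have "AE z::real \<times> real in lborel. integrable lborel (\<lambda>s. g (snd z, s))"
        by (rule AE_lborel_snd[OF sl])
      then show "AE z in lborel. norm (indicat_real ({a..b} \<times> {c..d}) z *\<^sub>R G z)
          \<le> norm (indicat_real {a..b} (fst z) * m r (snd z))"
      proof eventually_elim
        case (elim z)
        show ?case
        proof (cases "z \<in> {a..b} \<times> {c..d}")
          case True
          then have z: "fst z \<in> {a..b}" "snd z \<in> {c..d}" by auto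
          have "\<bar>G z\<bar> \<le> (LINT s:{0..fst z}|lborel. \<bar>g (snd z, s)\<bar>)"
            unfolding G_def by (rule set_integral_abs_bound) (auto intro!: sub_int elim)
          also have "\<dots> \<le> m r (snd z)"
            unfolding m_def set_lebesgue_integral_def
            using z elim set_integrable_abs[OF sub_int[OF elim, of "{0..fst z}"]] unfolding set_integrable_def
            by (intro integral_mono) (auto simp: indicator_def r_def)
          finally show ?thesis using True z by simp
        next
          case False
          then show ?thesis by simp
        qed
      qed
    qed
  qed
  have weak: "(LINT z|lborel. F z * (deriv \<psi> (fst z) * \<phi> (snd z))) = - (LINT z|lborel. g' z * (\<psi> (fst z) * \<phi> (snd z)))"
    if \<psi>: "test_function I \<psi>" and \<phi>: "test_function (UNIV :: real set) \<phi>" for \<psi> \<phi>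
  proof -
    note \<psi>D = test_function_DERIV[OF \<psi>] and \<phi>D = test_function_DERIV[OF \<phi>]
    obtain a b where ab: "a < b" "{a..b} \<subseteq> I" "\<And>x. x \<notin> {a..b} \<Longrightarrow> \<psi> x = 0"
      using test_function_ivl[OF \<psi> I] by blast
    obtain c d where cd: "c < d" "{c..d} \<subseteq> UNIV" "\<And>x. x \<notin> {c..d} \<Longrightarrow> \<phi> x = 0"
      using test_function_ivl[OF \<phi> U] by blast
    have d0: "deriv \<psi> x = 0" if "x \<notin> {a..b}" for x by (rule deriv_eq_0_outside[OF ab(3) that])
    note i1 = integrable_mult_tensor[OF locally_integrable_rect[OF wl(1) cd(2) ab(2)] \<phi>D(2) cd(3) \<psi>D(3) d0]
    note i2 = integrable_mult_tensor[OF locally_integrable_rect[OF wl(2) cd(2) ab(2)] \<phi>D(2) cd(3) \<psi>D(2) ab(3)]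
    show ?thesis
      using weak_deriv_tensor(2)[OF \<phi> \<psi>, of f g] w integrable_lborel_swap(2)[OF i1] integrable_lborel_swap(2)[OF i2]
      unfolding F_def g'_def strip_def I_def by (simp add: mult.commute)
  qed
  obtain c where c[measurable]: "c \<in> borel_measurable borel"
    and cF: "AE z in lborel. z \<in> I \<times> UNIV \<longrightarrow> F z = c (snd z) + G z"
    using weak_deriv_slice[OF I U Fl(1) _ Fl(2) Gl Gm prim weak] by auto
  have cF1: "AE t in lborel. AE y in lborel. t \<in> I \<longrightarrow> f (y, t) = c y + G (t, y)"
    using AE_lborel_pairD1[OF cF] by (auto elim!: eventually_mono simp: F_def)
  \<comment> \<open>At one suitable small time \<open>t\<close>, \<open>c - f0\<close> is
    \<open>f (y, t) - f0 y\<close> minus the time integral of \<open>g\<close>. The first term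
    contributes \<open>2 r \<eta> + \<eta>\<close>, the second \<open>\<eta>\<close>.\<close>
  have small: "(\<integral>\<^sup>+ y\<in>{-r..r}. ennreal \<bar>c y - f0 y\<bar> \<partial>lborel) \<le> ennreal ((2 * r + 2) * \<eta>)"
    if r: "r > 0" and \<eta>: "\<eta> > 0" for r \<eta>
  proof -
    define \<Gamma> where "\<Gamma> t = (LINT z|lborel. \<bar>indicat_real ({-r..r} \<times> {0..t}) z *\<^sub>R g z\<bar>)" for t
    have rm: "(\<lambda>z. \<bar>indicat_real ({-r..r} \<times> {0..t}) z *\<^sub>R g z\<bar>) \<in> borel_measurable lborel" for t
      by (intro borel_measurable_abs borel_measurable_rect g) auto
    have \<Gamma>int: "integrable lborel (\<lambda>z. \<bar>indicat_real ({-r..r} \<times> {0..t}) z *\<^sub>R g z\<bar>)" for t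
      by (rule Bochner_Integration.integrable_bound[OF gabs[of r] rm])
         (auto simp: indicator_def intro!: AE_I2)
    have "(\<lambda>n. \<Gamma> (inverse (real (Suc n)))) \<longlonglongrightarrow> (LINT z::real \<times> real|lborel. 0)"
      unfolding \<Gamma>_def
    proof (rule integral_dominated_convergence[OF _ rm gabs[of r]])
      have "AE z::real \<times> real in lborel. snd z \<noteq> 0"
        by (rule AE_lborel_snd[OF AE_lborel_singleton])
      then show "AE z in lborel. (\<lambda>n. \<bar>indicat_real ({-r..r} \<times> {0..inverse (real (Suc n))}) z *\<^sub>R g z\<bar>) \<longlonglongrightarrow> 0"
      proof eventually_elim
        case (elim z)
        show ?case
        proof (rule tendsto_eventually)
          show "\<forall>\<^sub>F n in sequentially. \<bar>indicat_real ({-r..r} \<times> {0..inverse (real (Suc n))}) z *\<^sub>R g z\<bar> = 0"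
          proof (cases "snd z < 0")
            case True
            then show ?thesis by (auto simp: indicator_def mem_Times_iff)
          next
            case False
            with elim have "snd z > 0" by simp
            then have "\<forall>\<^sub>F n in sequentially. inverse (real (Suc n)) < snd z"
              using order_tendstoD(2)[OF LIMSEQ_inverse_real_of_nat] by auto
            then show ?thesis by eventually_elim (auto simp: indicator_def mem_Times_iff)
          qed
        qed
      qed
    qed (auto simp: indicator_def intro!: AE_I2)
    then have "\<forall>\<^sub>F n in sequentially. \<Gamma> (inverse (real (Suc n))) < \<eta>"
      using \<eta> by (auto dest: order_tendstoD(2))
    then obtain n where n: "\<Gamma> (inverse (real (Suc n))) < \<eta>" by (auto simp: eventually_sequentially)
    obtain \<delta> where \<delta>: "\<delta> > 0" "AE t in lborel. 0 < t \<and> t < \<delta> \<longrightarrow>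
        (\<integral>\<^sup>+ y\<in>{-r..r}. ennreal ((f (y, t) - f0 y)\<^sup>2) \<partial>lborel) < ennreal (\<eta>\<^sup>2)"
      using init \<eta> unfolding attains_initial_def by (meson zero_less_power)
    define e where "e = min \<delta> (min T (inverse (real (Suc n))))"
    have e: "e > 0" unfolding e_def using \<delta> T by auto
    have "AE t in lborel. (AE y in lborel. t \<in> I \<longrightarrow> f (y, t) = c y + G (t, y)) \<and>
        (0 < t \<and> t < \<delta> \<longrightarrow> (\<integral>\<^sup>+ y\<in>{-r..r}. ennreal ((f (y, t) - f0 y)\<^sup>2) \<partial>lborel) < ennreal (\<eta>\<^sup>2))"
      using cF1 \<delta>(2) by eventually_elim auto
    from AE_lborel_ex_ivl[OF this e] obtain t where t: "0 < t" "t < e"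
      and t1: "AE y in lborel. t \<in> I \<longrightarrow> f (y, t) = c y + G (t, y)"
      and t2: "0 < t \<and> t < \<delta> \<longrightarrow> (\<integral>\<^sup>+ y\<in>{-r..r}. ennreal ((f (y, t) - f0 y)\<^sup>2) \<partial>lborel) < ennreal (\<eta>\<^sup>2)" by auto
    have tI: "t \<in> I" "t < \<delta>" "t \<le> inverse (real (Suc n))" using t unfolding e_def I_def by auto
    \<comment> \<open>Passes from the bound \<open>\<eta>^2\<close> on the integral of the square,
      given by the initial condition, to a bound in L1 of the bounded interval.\<close>
    have pt: "\<bar>x\<bar> \<le> \<eta> + x\<^sup>2 / \<eta>" for x :: real
    proof (cases "\<bar>x\<bar> \<le> \<eta>")
      case True
      then show ?thesis using \<eta> by (simp add: add_increasing2)
    next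
      case False
      then have "\<eta> * \<bar>x\<bar> \<le> \<bar>x\<bar> * \<bar>x\<bar>" using \<eta> by (intro mult_right_mono) auto
      then have "\<bar>x\<bar> \<le> x\<^sup>2 / \<eta>" using \<eta> by (simp add: field_simps power2_eq_square)
      then show ?thesis using \<eta> by simp
    qed
    have Gb: "(\<integral>\<^sup>+ y\<in>{-r..r}. ennreal \<bar>G (t, y)\<bar> \<partial>lborel) \<le> ennreal \<eta>"
    proof -
      have "(\<integral>\<^sup>+ y\<in>{-r..r}. ennreal \<bar>G (t, y)\<bar> \<partial>lborel)
        \<le> (\<integral>\<^sup>+ y. ennreal (LINT s|lborel. \<bar>indicat_real ({-r..r} \<times> {0..t}) (y, s) *\<^sub>R g (y, s)\<bar>) \<partial>lborel)"
      proof (rule nn_integral_mono_AE)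
        show "AE y in lborel. ennreal \<bar>G (t, y)\<bar> * indicator {-r..r} y
          \<le> ennreal (LINT s|lborel. \<bar>indicat_real ({-r..r} \<times> {0..t}) (y, s) *\<^sub>R g (y, s)\<bar>)"
          using sl
        proof eventually_elim
          case (elim y)
          show ?case
          proof (cases "y \<in> {-r..r}")
            case True
            have "\<bar>G (t, y)\<bar> \<le> (LINT s:{0..t}|lborel. \<bar>g (y, s)\<bar>)"
              unfolding G_def fst_conv snd_conv by (rule set_integral_abs_bound) (auto intro!: sub_int elim)
            also have "\<dots> = (LINT s|lborel. \<bar>indicat_real ({-r..r} \<times> {0..t}) (y, s) *\<^sub>R g (y, s)\<bar>)"
              unfolding set_lebesgue_integral_def
              by (rule Bochner_Integration.integral_cong) (use True in \<open>auto simp: indicator_def\<close>)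
            finally show ?thesis using True by (simp add: ennreal_leI)
          qed simp
        qed
      qed
      also have "\<dots> = ennreal (LINT y|lborel. LINT s|lborel. \<bar>indicat_real ({-r..r} \<times> {0..t}) (y, s) *\<^sub>R g (y, s)\<bar>)"
        by (rule nn_integral_eq_integral[OF lborel_Fubini(3)[OF \<Gamma>int]]) auto
      also have "(LINT y|lborel. LINT s|lborel. \<bar>indicat_real ({-r..r} \<times> {0..t}) (y, s) *\<^sub>R g (y, s)\<bar>) = \<Gamma> t"
        unfolding \<Gamma>_def by (rule lborel_Fubini(5)[OF \<Gamma>int, symmetric])
      also have "\<Gamma> t \<le> \<Gamma> (inverse (real (Suc n)))"
        unfolding \<Gamma>_def using tI by (intro integral_mono \<Gamma>int) (auto simp: indicator_def)
      finally show ?thesis using n by (meson ennreal_leI less_imp_le order_trans)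
    qed
    have "(\<integral>\<^sup>+ y\<in>{-r..r}. ennreal \<bar>c y - f0 y\<bar> \<partial>lborel)
      \<le> (\<integral>\<^sup>+ y. (ennreal \<eta> * indicator {-r..r} y + ennreal (1 / \<eta>) * (ennreal ((f (y, t) - f0 y)\<^sup>2) * indicator {-r..r} y))
            + ennreal \<bar>G (t, y)\<bar> * indicator {-r..r} y \<partial>lborel)"
    proof (rule nn_integral_mono_AE)
      show "AE y in lborel. ennreal \<bar>c y - f0 y\<bar> * indicator {-r..r} y
        \<le> (ennreal \<eta> * indicator {-r..r} y + ennreal (1 / \<eta>) * (ennreal ((f (y, t) - f0 y)\<^sup>2) * indicator {-r..r} y))
            + ennreal \<bar>G (t, y)\<bar> * indicator {-r..r} y"
        using t1
      proof eventually_elim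
        case (elim y)
        show ?case
        proof (cases "y \<in> {-r..r}")
          case True
          have "\<bar>c y - f0 y\<bar> \<le> \<bar>f (y, t) - f0 y\<bar> + \<bar>G (t, y)\<bar>" using elim tI by simp
          also have "\<dots> \<le> (\<eta> + 1 / \<eta> * (f (y, t) - f0 y)\<^sup>2) + \<bar>G (t, y)\<bar>" using pt[of "f (y, t) - f0 y"] by simp
          finally have "ennreal \<bar>c y - f0 y\<bar> \<le> ennreal ((\<eta> + 1 / \<eta> * (f (y, t) - f0 y)\<^sup>2) + \<bar>G (t, y)\<bar>)"
            by (rule ennreal_leI)
          also have "\<dots> = ennreal \<eta> + ennreal (1 / \<eta>) * ennreal ((f (y, t) - f0 y)\<^sup>2) + ennreal \<bar>G (t, y)\<bar>"
            using \<eta> by (subst ennreal_plus, simp, simp, subst ennreal_plus, simp, simp, subst ennreal_mult, simp_all)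
          finally show ?thesis using True by simp
        qed simp
      qed
    qed
    also have "\<dots> = (\<integral>\<^sup>+ y. ennreal \<eta> * indicator {-r..r} y \<partial>lborel)
        + (\<integral>\<^sup>+ y. ennreal (1 / \<eta>) * (ennreal ((f (y, t) - f0 y)\<^sup>2) * indicator {-r..r} y) \<partial>lborel)
        + (\<integral>\<^sup>+ y\<in>{-r..r}. ennreal \<bar>G (t, y)\<bar> \<partial>lborel)"
      by (subst nn_integral_add, measurable, subst nn_integral_add, measurable)
    also have "(\<integral>\<^sup>+ y. ennreal \<eta> * indicator {-r..r} y \<partial>lborel) = ennreal (2 * r * \<eta>)"
      using r \<eta> by (simp add: nn_integral_cmult emeasure_lborel_Icc_eq ennreal_mult'[symmetric] mult.commute)
    also have "(\<integral>\<^sup>+ y. ennreal (1 / \<eta>) * (ennreal ((f (y, t) - f0 y)\<^sup>2) * indicator {-r..r} y) \<partial>lborel)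
        = ennreal (1 / \<eta>) * (\<integral>\<^sup>+ y\<in>{-r..r}. ennreal ((f (y, t) - f0 y)\<^sup>2) \<partial>lborel)"
      by (rule nn_integral_cmult) measurable
    also have "ennreal (2 * r * \<eta>) + ennreal (1 / \<eta>) * (\<integral>\<^sup>+ y\<in>{-r..r}. ennreal ((f (y, t) - f0 y)\<^sup>2) \<partial>lborel)
        + (\<integral>\<^sup>+ y\<in>{-r..r}. ennreal \<bar>G (t, y)\<bar> \<partial>lborel)
      \<le> ennreal (2 * r * \<eta>) + ennreal (1 / \<eta>) * ennreal (\<eta>\<^sup>2) + ennreal \<eta>"
      using t2 t(1) tI Gb by (intro add_mono mult_left_mono order_refl) (auto intro: less_imp_le)
    also have "\<dots> = ennreal ((2 * r + 2) * \<eta>)"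
      using r \<eta> by (simp add: ennreal_mult'[symmetric] ennreal_plus[symmetric] power2_eq_square algebra_simps del: ennreal_plus)
    finally show ?thesis .
  qed
  have "AE y in lborel. c y = f0 y"
  proof -
    have "AE y in lborel. y \<in> {-real (Suc n)..real (Suc n)} \<longrightarrow> c y = f0 y" for n
    proof -
      let ?r = "real (Suc n)"
      have "(\<integral>\<^sup>+ y\<in>{-?r..?r}. ennreal \<bar>c y - f0 y\<bar> \<partial>lborel) \<le> 0"
      proof (rule ennreal_le_epsilon)
        fix e :: real assume e: "0 < e"
        show "(\<integral>\<^sup>+ y\<in>{-?r..?r}. ennreal \<bar>c y - f0 y\<bar> \<partial>lborel) \<le> 0 + ennreal e"
          using small[of ?r "e / (2 * ?r + 2)"] e by simp
      qed
      then have "(\<integral>\<^sup>+ y. ennreal \<bar>c y - f0 y\<bar> * indicator {-?r..?r} y \<partial>lborel) = 0" by simp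
      then have "AE y in lborel. ennreal \<bar>c y - f0 y\<bar> * indicator {-?r..?r} y = 0"
        by (subst (asm) nn_integral_0_iff_AE) auto
      then show ?thesis by eventually_elim (auto simp: indicator_def split: if_splits)
    qed
    then have "AE y in lborel. \<forall>n. y \<in> {-real (Suc n)..real (Suc n)} \<longrightarrow> c y = f0 y"
      by (intro AE_all_countable[THEN iffD2] allI)
    then show ?thesis
    proof eventually_elim
      case (elim y)
      obtain n where "\<bar>y\<bar> \<le> real n" using real_arch_simple by blast
      then have "y \<in> {-real (Suc n)..real (Suc n)}" by auto
      then show ?case using elim by blast
    qed
  qed
  then have "AE y in lborel. AE t in lborel. t \<in> I \<longrightarrow> f (y, t) = f0 y + G (t, y)"
    using AE_lborel_pairD2[OF cF]
    by eventually_elim (auto elim!: eventually_mono simp: F_def)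
  then have "AE y in lborel. AE t in lborel. snd (y, t) \<in> I \<longrightarrow>
      f (y, t) = f0 (fst (y, t)) + G (snd (y, t), fst (y, t))" by simp
  then have "AE z in lborel. snd z \<in> I \<longrightarrow> f z = f0 (fst z) + G (snd z, fst z)"
    by (intro AE_lborel_pairI1) (measurable, auto simp: I_def)
  then show ?thesis
    by eventually_elim (auto simp: strip_def I_def G_def)
qed

section \<open>The weight\<close>

lemma primitive_on_cong2:
  assumes P: "primitive_on I u g" and I: "is_interval I"
    and "\<And>x. x \<in> I \<Longrightarrow> u x = v x" "\<And>x. x \<in> I \<Longrightarrow> g x = h x"
  shows "primitive_on I v h"
  unfolding primitive_on_def
proof (intro ballI impI)
  fix a b assume ab: "a \<in> I" "b \<in> I" "a \<le> b"
  have sub: "x \<in> I" if "x \<in> {a..b}" for x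
    using ab I that by (meson atLeastAtMost_iff is_interval_1)
  have "set_integrable lborel {a..b} g \<longleftrightarrow> set_integrable lborel {a..b} h"
    by (rule set_integrable_cong) (use sub assms(4) in auto)
  moreover have "(LINT x:{a..b}|lborel. g x) = (LINT x:{a..b}|lborel. h x)"
    by (rule set_lebesgue_integral_cong) (use sub assms(4) in auto)
  ultimately show "set_integrable lborel {a..b} h \<and> v b - v a = (LINT x:{a..b}|lborel. h x)"
    using primitive_onD[OF P ab] assms(3)[OF ab(1)] assms(3)[OF ab(2)] by simp
qed

lemma primitive_on_glue:
  assumes P: "primitive_on {c..} u g" and Q: "primitive_on {..c} u g"
  shows "primitive_on UNIV u g"
  unfolding primitive_on_def
proof (intro ballI impI)
  fix a b :: real assume ab: "a \<le> b"
  consider "c \<le> a" | "a \<le> c" "c \<le> b" | "b \<le> c" by linarith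
  then show "set_integrable lborel {a..b} g \<and> u b - u a = (LINT x:{a..b}|lborel. g x)"
  proof cases
    case 1
    then show ?thesis using primitive_onD[OF P, of a b] ab by auto
  next
    case 2
    have 1: "set_integrable lborel {a..c} g" "u c - u a = (LINT x:{a..c}|lborel. g x)"
      "set_integrable lborel {c..b} g" "u b - u c = (LINT x:{c..b}|lborel. g x)"
      using primitive_onD[OF Q, of a c] primitive_onD[OF P, of c b] 2 by auto
    have 3: "set_integrable lborel {a..b} g" by (rule set_integrable_combine_ivl[OF 1(1,3) 2])
    show ?thesis using set_integral_combine_ivl[OF 3 2] 1 3 by simp
  next
    case 3
    then show ?thesis using primitive_onD[OF Q, of a b] ab by auto
  qed
qed

lemma set_integral_reflect_ivl:
  fixes g :: "real \<Rightarrow> real"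
  shows "(LINT x:{a..b}|lborel. g (- x)) = (LINT x:{-b..-a}|lborel. g x)"
    and "set_integrable lborel {a..b} (\<lambda>x. g (- x)) \<longleftrightarrow> set_integrable lborel {-b..-a} g"
proof -
  have ind: "indicat_real {a..b} x = indicat_real {-b..-a} (- x)" for x by (auto simp: indicator_def)
  show "(LINT x:{a..b}|lborel. g (- x)) = (LINT x:{-b..-a}|lborel. g x)"
    using lborel_integral_real_affine[of "-1" "\<lambda>x. indicat_real {-b..-a} x *\<^sub>R g x" 0]
    unfolding set_lebesgue_integral_def ind by simp
  show "set_integrable lborel {a..b} (\<lambda>x. g (- x)) \<longleftrightarrow> set_integrable lborel {-b..-a} g"
    using lborel_integrable_real_affine_iff[of "-1" "\<lambda>x. indicat_real {-b..-a} x *\<^sub>R g x" 0]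
    unfolding set_integrable_def ind by simp
qed

lemma primitive_on_reflect:
  assumes "primitive_on UNIV u g"
  shows "primitive_on UNIV (\<lambda>x. u (- x)) (\<lambda>x. - g (- x))"
  unfolding primitive_on_def
proof (intro ballI impI)
  fix a b :: real assume ab: "a \<le> b"
  have i: "set_integrable lborel {-b..-a} g" "u (-a) - u (-b) = (LINT x:{-b..-a}|lborel. g x)"
    using primitive_onD[OF assms, of "-b" "-a"] ab by auto
  have i': "set_integrable lborel {a..b} (\<lambda>x. g (- x))" using i(1) by (simp add: set_integral_reflect_ivl(2))
  have "(LINT x:{a..b}|lborel. - g (- x)) = - (LINT x:{a..b}|lborel. g (- x))"
    by (rule set_integral_uminus[OF i'])
  moreover have "set_integrable lborel {a..b} (\<lambda>x. - g (- x))"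
    using set_integrable_mult_right[of "-1" lborel "{a..b}" "\<lambda>x. g (- x)"] i' by simp
  ultimately show "set_integrable lborel {a..b} (\<lambda>x. - g (- x)) \<and>
      u (- b) - u (- a) = (LINT x:{a..b}|lborel. - g (- x))"
    using i by (simp add: set_integral_reflect_ivl(1))
qed

lemma set_integrable_continuous_ivl:
  fixes g :: "real \<Rightarrow> real"
  assumes "continuous_on UNIV g"
  shows "set_integrable lborel {a..b} g"
  unfolding set_integrable_def
  by (rule borel_integrable_compact) (use continuous_on_subset[OF assms] in auto)

text \<open>\<open>H\<close> solves the relaxation equation \<open>H' = r (k - H)\<close>; testing it against a smooth version of
  \<open>sgn (H - k)\<close> bounds \<open>\<integral> r \<bar>H - k\<bar>\<close> by the total variation of \<open>k\<close>.\<close>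

lemma relaxation_half_line:
  fixes r k j :: "real \<Rightarrow> real"
  assumes r: "continuous_on UNIV r" "\<And>y. 0 \<le> r y"
    and k: "primitive_on UNIV k j" "\<And>y. 0 \<le> k y" "\<And>y. k y \<le> kmax"
    and V: "\<forall>Y\<ge>0. (LINT y:{0..Y}|lborel. \<bar>j y\<bar>) \<le> V"
  shows "\<exists>H h. H 0 = k 0 \<and> h 0 = 0 \<and> (\<forall>y. (H has_real_derivative h y) (at y)) \<and> continuous_on UNIV h \<and>
    (\<forall>y\<ge>0. 0 \<le> H y \<and> H y \<le> kmax \<and> \<bar>h y\<bar> \<le> kmax * r y) \<and>
    (\<forall>Y\<ge>0. (LINT y:{0..Y}|lborel. r y * \<bar>H y - k y\<bar>) \<le> V)"
proof -
  have kc: "continuous_on UNIV k" by (rule primitive_on_UNIV_continuous[OF k(1)])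
  \<comment> \<open>\<open>exp X\<close> is the integrating factor, and \<open>H\<close> is the
    variation of constants formula for the relaxation equation with initial value
    \<open>k 0\<close>.\<close>
  define X where "X = signed_integral 0 r"
  have X: "(X has_real_derivative r y) (at y)" for y unfolding X_def by (rule signed_integral_DERIV[OF r(1)])
  have Xc: "continuous_on UNIV X" using X by (auto intro!: continuous_at_imp_continuous_on DERIV_isCont)
  define W where "W = signed_integral 0 (\<lambda>y. exp (X y) * r y * k y)"
  have W: "(W has_real_derivative exp (X y) * r y * k y) (at y)" for y
    unfolding W_def by (rule signed_integral_DERIV) (intro continuous_intros Xc r kc)
  define H where "H y = exp (- X y) * (k 0 + W y)" for y
  define h where "h y = r y * (k y - H y)" for y
  have H: "(H has_real_derivative h y) (at y)" for y
  proof -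
    have "(H has_real_derivative (exp (- X y) * (exp (X y) * r y * k y) + exp (- X y) * (- r y) * (k 0 + W y))) (at y)"
      unfolding H_def[abs_def] by (auto intro!: derivative_eq_intros X W)
    also have "exp (- X y) * (exp (X y) * r y * k y) = r y * k y" by (simp add: exp_minus)
    also have "r y * k y + exp (- X y) * (- r y) * (k 0 + W y) = h y"
      by (simp add: h_def H_def algebra_simps)
    finally show ?thesis .
  qed
  have Hc: "continuous_on UNIV H" using H by (auto intro!: continuous_at_imp_continuous_on DERIV_isCont)
  have hc: "continuous_on UNIV h" unfolding h_def by (intro continuous_intros r kc Hc)
  have X0: "X 0 = 0" "W 0 = 0" by (auto simp: X_def W_def)
  have H0: "H 0 = k 0" by (simp add: H_def X0)
  have h0: "h 0 = 0" by (simp add: h_def H0)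
  have Hpos: "0 \<le> H y" if "y \<ge> 0" for y
  proof -
    have "W 0 \<le> W y"
      by (rule DERIV_nonneg_imp_nondecreasing[OF that]) (use W r k in \<open>auto intro!: exI\<close>)
    then show ?thesis unfolding H_def using X0 k(2)[of 0] by simp
  qed
  have Hmax: "H y \<le> kmax" if "y \<ge> 0" for y
  proof -
    \<comment> \<open>\<open>q - k 0\<close> is \<open>exp X\<close> times \<open>kmax - H\<close>;
      it starts at \<open>kmax - k 0\<close>, which is nonnegative, and increases because
      \<open>k \<le> kmax\<close>.\<close>
    define q where "q y = kmax * exp (X y) - W y" for y
    have "q 0 \<le> q y"
    proof (rule DERIV_nonneg_imp_nondecreasing[OF that])
      fix x
      have "(q has_real_derivative (exp (X x) * r x) * (kmax - k x)) (at x)"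
        unfolding q_def[abs_def] by (auto intro!: derivative_eq_intros X W simp: algebra_simps)
      moreover have "(exp (X x) * r x) * (kmax - k x) \<ge> 0" using r(2)[of x] k(3)[of x] by simp
      ultimately show "\<exists>y. (q has_real_derivative y) (at x) \<and> 0 \<le> y" by blast
    qed
    then have "k 0 + W y \<le> kmax * exp (X y)" using k(3)[of 0] by (simp add: q_def X0)
    then have "exp (- X y) * (k 0 + W y) \<le> exp (- X y) * (kmax * exp (X y))" by (intro mult_left_mono) auto
    also have "\<dots> = kmax" by (simp add: exp_minus)
    finally show ?thesis by (simp add: H_def)
  qed
  have hb: "\<bar>h y\<bar> \<le> kmax * r y" if "y \<ge> 0" for y
  proof -
    have "\<bar>k y - H y\<bar> \<le> kmax" using k(2,3)[of y] Hpos[OF that] Hmax[OF that] by linarith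
    then have "r y * \<bar>k y - H y\<bar> \<le> r y * kmax" using r(2) by (intro mult_left_mono) auto
    then show ?thesis using r(2)[of y] by (simp add: h_def abs_mult mult.commute)
  qed
  have est: "(LINT y:{0..Y}|lborel. r y * \<bar>H y - k y\<bar>) \<le> V" if Y: "Y \<ge> 0" for Y
  proof -
    define d where "d y = H y - k y" for y
    have dc: "continuous_on UNIV d" unfolding d_def by (intro continuous_intros Hc kc)
    have HP: "primitive_on UNIV H h"
      by (rule primitive_on_DERIV[OF _ has_field_derivative_at_within[OF H] hc]) simp
    have dP: "primitive_on UNIV d (\<lambda>y. h y - j y)" unfolding d_def by (rule primitive_on_diff[OF HP k(1)])
    have ji: "set_integrable lborel {0..Y} j" using primitive_onD(1)[OF k(1), of 0 Y] Y by simp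
    have ri: "set_integrable lborel {0..Y} r" by (rule set_integrable_continuous_ivl[OF r(1)])
    have rdi: "set_integrable lborel {0..Y} (\<lambda>y. r y * \<bar>d y\<bar>)"
      by (rule set_integrable_continuous_ivl) (intro continuous_intros r dc)
    define R where "R = (LINT y:{0..Y}|lborel. r y)"
    have R0: "R \<ge> 0" unfolding R_def set_lebesgue_integral_def using r(2) by (intro integral_nonneg_AE) auto
    have bound: "(LINT y:{0..Y}|lborel. r y * \<bar>d y\<bar>) \<le> V + \<epsilon> * R" if \<epsilon>: "\<epsilon> > 0" for \<epsilon>
    proof -
      \<comment> \<open>The derivative of \<open>sqrt (s^2 + \<epsilon>^2)\<close>, a smooth
        substitute for the sign of \<open>s\<close>. The substitution costs at most
        \<open>\<epsilon> r\<close> pointwise, because \<open>\<phi> s * s\<close> is at least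
        \<open>\<bar>s\<bar> - \<epsilon>\<close>.\<close>
      define \<phi> where "\<phi> s = s / sqrt (s\<^sup>2 + \<epsilon>\<^sup>2)" for s
      have pos: "s\<^sup>2 + \<epsilon>\<^sup>2 > 0" for s using \<epsilon> by (simp add: add_nonneg_pos)
      have c: "primitive_on UNIV (\<lambda>y. sqrt ((d y)\<^sup>2 + \<epsilon>\<^sup>2)) (\<lambda>y. \<phi> (d y) * (h y - j y))"
      proof (rule primitive_on_chain[OF _ dP open_UNIV])
        show "((\<lambda>s. sqrt (s\<^sup>2 + \<epsilon>\<^sup>2)) has_real_derivative \<phi> s) (at s)" for s
          unfolding \<phi>_def using pos[of s]
          by (auto intro!: derivative_eq_intros simp: field_simps)
        have "sqrt (s\<^sup>2 + \<epsilon>\<^sup>2) \<noteq> 0" for s using real_sqrt_gt_zero[OF pos[of s]] by linarith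
        then show "continuous_on UNIV \<phi>" unfolding \<phi>_def by (intro continuous_intros) auto
      qed auto
      \<comment> \<open>\<open>d\<close> starts at 0, where the smoothed modulus is smallest, so its
        increment is nonnegative.\<close>
      have "0 \<le> sqrt ((d Y)\<^sup>2 + \<epsilon>\<^sup>2) - sqrt ((d 0)\<^sup>2 + \<epsilon>\<^sup>2)"
        by (simp add: d_def H0)
      also have "\<dots> = (LINT y:{0..Y}|lborel. \<phi> (d y) * (h y - j y))"
        using primitive_onD(2)[OF c, of 0 Y] Y by simp
      also have "\<dots> \<le> (LINT y:{0..Y}|lborel. (\<epsilon> * r y - r y * \<bar>d y\<bar>) + \<bar>j y\<bar>)"
      proof (rule set_integral_mono)
        show "set_integrable lborel {0..Y} (\<lambda>y. \<phi> (d y) * (h y - j y))"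
          using primitive_onD(1)[OF c, of 0 Y] Y by simp
        show "set_integrable lborel {0..Y} (\<lambda>y. (\<epsilon> * r y - r y * \<bar>d y\<bar>) + \<bar>j y\<bar>)"
          by (intro set_integral_add set_integral_diff set_integrable_abs ji rdi) (use ri in simp)
        fix y
        define s where "s = d y"
        define q where "q = sqrt (s\<^sup>2 + \<epsilon>\<^sup>2)"
        have q: "q > 0" "q\<^sup>2 = s\<^sup>2 + \<epsilon>\<^sup>2" using pos[of s] by (auto simp: q_def)
        have qs: "\<bar>s\<bar> \<le> q" unfolding q_def by (rule real_le_rsqrt) simp
        have qe: "q \<le> \<bar>s\<bar> + \<epsilon>" unfolding q_def
          by (rule real_le_lsqrt) (use \<epsilon> in \<open>auto simp: power2_eq_square algebra_simps\<close>)
        have "(\<bar>s\<bar> - \<epsilon>) * q \<le> s\<^sup>2"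
        proof (cases "\<bar>s\<bar> \<le> \<epsilon>")
          case True
          then have "(\<bar>s\<bar> - \<epsilon>) * q \<le> 0" using q by (simp add: mult_le_0_iff)
          then show ?thesis by (meson order_trans zero_le_power2)
        next
          case False
          then have "(\<bar>s\<bar> - \<epsilon>) * q \<le> (\<bar>s\<bar> - \<epsilon>) * (\<bar>s\<bar> + \<epsilon>)" using qe by (intro mult_left_mono) auto
          also have "\<dots> = s\<^sup>2 - \<epsilon>\<^sup>2" by (simp add: power2_eq_square algebra_simps)
          finally show ?thesis by (smt (verit) zero_le_power2)
        qed
        then have "\<bar>s\<bar> - \<epsilon> \<le> \<phi> s * s"
          unfolding \<phi>_def q_def[symmetric] using q(1) by (simp add: field_simps power2_eq_square)
        then have "r y * (\<bar>s\<bar> - \<epsilon>) \<le> r y * (\<phi> s * s)" using r(2) by (intro mult_left_mono) auto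
        then have a: "\<phi> s * h y \<le> \<epsilon> * r y - r y * \<bar>s\<bar>"
          unfolding h_def s_def d_def by (simp add: algebra_simps)
        have "\<bar>\<phi> s\<bar> \<le> 1" unfolding \<phi>_def q_def[symmetric] using qs q(1) by (simp add: abs_div)
        then have "\<bar>\<phi> s * j y\<bar> \<le> 1 * \<bar>j y\<bar>" unfolding abs_mult by (intro mult_right_mono) auto
        then have b: "- (\<phi> s * j y) \<le> \<bar>j y\<bar>" by linarith
        show "\<phi> (d y) * (h y - j y) \<le> (\<epsilon> * r y - r y * \<bar>d y\<bar>) + \<bar>j y\<bar>"
          using a b unfolding s_def by (simp add: algebra_simps)
      qed
      also have "\<dots> = \<epsilon> * R - (LINT y:{0..Y}|lborel. r y * \<bar>d y\<bar>) + (LINT y:{0..Y}|lborel. \<bar>j y\<bar>)"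
        unfolding R_def using ri rdi set_integrable_abs[OF ji] by simp
      finally show ?thesis using V[rule_format, OF Y] by linarith
    qed
    have "(LINT y:{0..Y}|lborel. r y * \<bar>d y\<bar>) \<le> V"
    proof (rule field_le_epsilon)
      fix e :: real assume e: "e > 0"
      have "e / (R + 1) * R \<le> e" using e R0 by (simp add: field_simps)
      then show "(LINT y:{0..Y}|lborel. r y * \<bar>d y\<bar>) \<le> V + e"
        using bound[of "e / (R + 1)"] e R0 by simp
    qed
    then show ?thesis by (simp add: d_def)
  qed
  show ?thesis
    by (intro exI[of _ H] exI[of _ h] conjI allI impI H0 h0 H hc Hpos Hmax hb est)
qed

text \<open>Both half-lines are treated by relaxation away from the origin, the left one after
  reflection. The two pieces fit together since at 0 both values are \<open>k 0\<close> and both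
  derivatives are 0.\<close>

lemma relaxation:
  fixes r k j :: "real \<Rightarrow> real"
  assumes r: "continuous_on UNIV r" "\<And>y. 0 \<le> r y"
    and k: "primitive_on UNIV k j" "\<And>y. 0 \<le> k y" "\<And>y. k y \<le> kmax"
    and V: "\<And>a b. a \<le> b \<Longrightarrow> (LINT y:{a..b}|lborel. \<bar>j y\<bar>) \<le> V"
  shows "\<exists>H h. primitive_on UNIV H h \<and> h \<in> borel_measurable borel \<and>
    (\<forall>y. 0 \<le> H y \<and> H y \<le> kmax \<and> \<bar>h y\<bar> \<le> kmax * r y) \<and>
    (\<forall>Y\<ge>0. (LINT y:{0..Y}|lborel. r y * \<bar>H y - k y\<bar>) \<le> V) \<and>
    (\<forall>Y\<ge>0. (LINT y:{-Y..0}|lborel. r y * \<bar>H y - k y\<bar>) \<le> V)"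
proof -
  have V0: "\<forall>Y\<ge>0. (LINT y:{0..Y}|lborel. \<bar>j y\<bar>) \<le> V" using V by simp
  obtain H1 h1 where H1: "H1 0 = k 0 \<and> h1 0 = 0 \<and> (\<forall>y. (H1 has_real_derivative h1 y) (at y)) \<and> continuous_on UNIV h1 \<and>
    (\<forall>y\<ge>0. 0 \<le> H1 y \<and> H1 y \<le> kmax \<and> \<bar>h1 y\<bar> \<le> kmax * r y) \<and>
    (\<forall>Y\<ge>0. (LINT y:{0..Y}|lborel. r y * \<bar>H1 y - k y\<bar>) \<le> V)"
    using relaxation_half_line[OF r k V0] by (elim exE)
  note 1 = H1[THEN conjunct1] H1[THEN conjunct2, THEN conjunct1]
    H1[THEN conjunct2, THEN conjunct2, THEN conjunct1, rule_format]
    H1[THEN conjunct2, THEN conjunct2, THEN conjunct2, THEN conjunct1]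
  note B1 = H1[THEN conjunct2, THEN conjunct2, THEN conjunct2, THEN conjunct2, THEN conjunct1, rule_format]
  note V1 = H1[THEN conjunct2, THEN conjunct2, THEN conjunct2, THEN conjunct2, THEN conjunct2, rule_format]
  have r': "continuous_on UNIV (\<lambda>y. r (- y))"
    using continuous_on_compose2[of UNIV r UNIV uminus] r(1) continuous_on_minus[OF continuous_on_id] by auto
  have V': "\<forall>Y\<ge>0. (LINT y:{0..Y}|lborel. \<bar>- j (- y)\<bar>) \<le> V"
  proof (intro allI impI)
    fix Y :: real assume "Y \<ge> 0"
    then show "(LINT y:{0..Y}|lborel. \<bar>- j (- y)\<bar>) \<le> V"
      using V[of "-Y" 0] set_integral_reflect_ivl(1)[of 0 Y "\<lambda>y. \<bar>j y\<bar>"] by simp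
  qed
  obtain H2 h2 where H2: "H2 0 = k (- 0) \<and> h2 0 = 0 \<and> (\<forall>y. (H2 has_real_derivative h2 y) (at y)) \<and> continuous_on UNIV h2 \<and>
    (\<forall>y\<ge>0. 0 \<le> H2 y \<and> H2 y \<le> kmax \<and> \<bar>h2 y\<bar> \<le> kmax * r (- y)) \<and>
    (\<forall>Y\<ge>0. (LINT y:{0..Y}|lborel. r (- y) * \<bar>H2 y - k (- y)\<bar>) \<le> V)"
    using relaxation_half_line[OF r' r(2) primitive_on_reflect[OF k(1)] k(2,3) V'] by (elim exE)
  note 2 = H2[THEN conjunct1] H2[THEN conjunct2, THEN conjunct1]
    H2[THEN conjunct2, THEN conjunct2, THEN conjunct1, rule_format]
    H2[THEN conjunct2, THEN conjunct2, THEN conjunct2, THEN conjunct1]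
  note B2 = H2[THEN conjunct2, THEN conjunct2, THEN conjunct2, THEN conjunct2, THEN conjunct1, rule_format]
  note V2 = H2[THEN conjunct2, THEN conjunct2, THEN conjunct2, THEN conjunct2, THEN conjunct2, rule_format]
  define H where "H y = (if y \<ge> 0 then H1 y else H2 (- y))" for y
  define h where "h y = (if y \<ge> 0 then h1 y else - h2 (- y))" for y
  have P1: "primitive_on UNIV H1 h1" by (rule primitive_on_DERIV[OF _ has_field_derivative_at_within[OF 1(3)] 1(4)]) simp
  have P2: "primitive_on UNIV H2 h2" by (rule primitive_on_DERIV[OF _ has_field_derivative_at_within[OF 2(3)] 2(4)]) simp
  have "primitive_on {0..} H h"
    by (rule primitive_on_cong2[OF primitive_on_subset[OF P1]]) (auto simp: H_def h_def is_interval_ci)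
  moreover have "primitive_on {..0} H h"
    by (rule primitive_on_cong2[OF primitive_on_subset[OF primitive_on_reflect[OF P2]]])
       (use 1 2 in \<open>auto simp: H_def h_def is_interval_ic\<close>)
  ultimately have P: "primitive_on UNIV H h" by (rule primitive_on_glue)
  have [measurable]: "h1 \<in> borel_measurable borel" "h2 \<in> borel_measurable borel"
    using 1 2 by (auto intro: borel_measurable_continuous_onI)
  have m: "h \<in> borel_measurable borel" unfolding h_def by measurable
  have e1: "(LINT y:{0..Y}|lborel. r y * \<bar>H y - k y\<bar>) \<le> V" if "Y \<ge> 0" for Y
  proof -
    have "(LINT y:{0..Y}|lborel. r y * \<bar>H y - k y\<bar>) = (LINT y:{0..Y}|lborel. r y * \<bar>H1 y - k y\<bar>)"
      by (rule set_lebesgue_integral_cong) (auto simp: H_def)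
    then show ?thesis using V1[OF that] by simp
  qed
  have e2: "(LINT y:{-Y..0}|lborel. r y * \<bar>H y - k y\<bar>) \<le> V" if "Y \<ge> 0" for Y
  proof -
    have "(LINT y:{-Y..0}|lborel. r y * \<bar>H y - k y\<bar>) = (LINT y:{0..Y}|lborel. r (- y) * \<bar>H (- y) - k (- y)\<bar>)"
      using set_integral_reflect_ivl(1)[of 0 Y "\<lambda>y. r y * \<bar>H y - k y\<bar>"] by simp
    also have "\<dots> = (LINT y:{0..Y}|lborel. r (- y) * \<bar>H2 y - k (- y)\<bar>)"
      by (rule set_lebesgue_integral_cong) (use 1 2 in \<open>auto simp: H_def\<close>)
    finally show ?thesis using V2[OF that] by simp
  qed
  have "0 \<le> H y" "H y \<le> kmax" "\<bar>h y\<bar> \<le> kmax * r y" for y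
    unfolding H_def h_def using B1[of y] B2[of "-y"] by auto
  with P m e1 e2 show ?thesis by blast
qed

section \<open>Pointwise bounds and regularity of the density\<close>

lemma AE_le_imp_le:
  fixes f :: "real \<Rightarrow> real"
  assumes "AE y in lborel. c \<le> f y" "continuous_on UNIV f"
  shows "c \<le> f y"
proof (rule ccontr)
  assume "\<not> c \<le> f y"
  moreover have "isCont f y" using assms(2) by (simp add: continuous_on_eq_continuous_at)
  ultimately obtain d where d: "d > 0" "\<And>x. \<bar>x - y\<bar> < d \<Longrightarrow> \<bar>f x - f y\<bar> < c - f y"
    unfolding continuous_at_eps_delta dist_real_def by (metis diff_gt_0_iff_gt linorder_not_le dist_real_def)
  obtain t where "t \<in> {y<..<y + d}" "c \<le> f t" using AE_lborel_ex_ivl[OF assms(1), of y "y + d"] d by auto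
  then show False using d(2)[of t] by auto
qed

lemma AE_ge_imp_ge:
  fixes f :: "real \<Rightarrow> real"
  assumes "AE y in lborel. f y \<le> c" "continuous_on UNIV f"
  shows "f y \<le> c"
  using AE_le_imp_le[of "-c" "\<lambda>y. - f y" y] assms by (simp add: continuous_on_minus)

lemma L_infty_UNIV:
  fixes f :: "real \<Rightarrow> real"
  assumes "L_infty UNIV f"
  obtains C where "C > 0" "f \<in> borel_measurable borel" "AE y in lborel. \<bar>f y\<bar> \<le> C"
proof -
  obtain C where C: "AE y in lborel. \<bar>f y\<bar> \<le> C" and m: "set_borel_measurable lborel UNIV f"
    using assms unfolding L_infty_def by auto
  show ?thesis
    by (rule that[of "max C 1"])
       (use m C in \<open>auto simp: set_borel_measurable_def elim!: eventually_mono\<close>)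
qed

text \<open>The bound on \<open>D\<^sup>2\<close> is Landau's inequality for the positive function \<open>B\<close> with bounded second
  derivative.\<close>

lemma inverse_density_regularity:
  assumes \<rho>: "\<And>y. 0 < \<rho>0 y" "L_infty UNIV \<rho>0"
    and w: "weak_deriv1 (\<lambda>y. 1 / \<rho>0 y) d" "weak_deriv1 d dd" "L_infty UNIV dd"
  shows "\<exists>B D M b0. (\<forall>y. (B has_real_derivative D y) (at y)) \<and> primitive_on UNIV D dd \<and> M > 0 \<and>
    (AE y in lborel. \<bar>dd y\<bar> \<le> M) \<and> (AE y in lborel. \<rho>0 y = 1 / B y) \<and> b0 > 0 \<and>
    (\<forall>y. b0 \<le> B y \<and> (D y)\<^sup>2 \<le> 4 * M * B y)"
proof -
  obtain C where C: "C > 0" "AE y in lborel. \<bar>\<rho>0 y\<bar> \<le> C" using L_infty_UNIV[OF \<rho>(2)] by metis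
  obtain M where M: "M > 0" "AE y in lborel. \<bar>dd y\<bar> \<le> M" using L_infty_UNIV[OF w(3)] by metis
  obtain B where B: "primitive_on UNIV B d" "AE y in lborel. 1 / \<rho>0 y = B y"
    using weak_deriv1_primitive[OF w(1)] by blast
  obtain D where D: "primitive_on UNIV D dd" "AE y in lborel. d y = D y"
    using weak_deriv1_primitive[OF w(2)] by blast
  have Dc: "continuous_on UNIV D" by (rule primitive_on_UNIV_continuous[OF D(1)])
  have [measurable]: "D \<in> borel_measurable borel" using Dc by (rule borel_measurable_continuous_onI)
  \<comment> \<open>Replacing \<open>d\<close> by its continuous representative \<open>D\<close>
    shows that \<open>B\<close> is of class C^1.\<close>
  have BD: "primitive_on UNIV B D"
  proof (rule primitive_on_cong_deriv[OF B(1)])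
    show "set_borel_measurable lborel {a..b} D" for a b unfolding set_borel_measurable_def by measurable
    show "AE x in lborel. x \<in> UNIV \<longrightarrow> d x = D x" using D(2) by simp
  qed simp
  have Bd: "(B has_real_derivative D y) (at y)" for y
  proof -
    have "((\<lambda>y. B 0 + signed_integral 0 D y) has_real_derivative D y) (at y)"
      using DERIV_add[OF DERIV_const signed_integral_DERIV[OF Dc]] by simp
    then show ?thesis
      by (rule has_field_derivative_transform_within_open[OF _ open_UNIV])
         (simp, rule primitive_on_eq_signed_integral[OF BD UNIV_I UNIV_I, symmetric])
  qed
  have Bc: "continuous_on UNIV B" using Bd by (auto intro!: continuous_at_imp_continuous_on DERIV_isCont)
  have "AE y in lborel. 1 / C \<le> B y"
    using C(2) B(2)
  proof eventually_elim
    case (elim y)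
    have "1 / C \<le> 1 / \<rho>0 y" using elim(1) \<rho>(1)[of y] C(1) by (intro divide_left_mono) auto
    then show ?case unfolding elim(2) .
  qed
  then have Bpos: "1 / C \<le> B y" for y using Bc by (rule AE_le_imp_le)
  have lip: "\<bar>D b - D a\<bar> \<le> M * (b - a)" if "a \<le> b" for a b
  proof -
    have i: "set_integrable lborel {a..b} dd" "D b - D a = (LINT x:{a..b}|lborel. dd x)"
      using primitive_onD[OF D(1), of a b] that by auto
    have "\<bar>D b - D a\<bar> \<le> (LINT x:{a..b}|lborel. \<bar>dd x\<bar>)" using set_integral_abs_bound[OF i(1)] i(2) by simp
    also have "\<dots> \<le> (LINT x:{a..b}|lborel. M)"
      by (rule set_integral_mono_AE[OF set_integrable_abs[OF i(1)] set_integrable_continuous_ivl])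
         (use M(2) in \<open>auto elim!: eventually_mono\<close>)
    also have "\<dots> = M * (b - a)" using that by (simp add: set_lebesgue_integral_def)
    finally show ?thesis .
  qed
  have landau: "(D y)\<^sup>2 \<le> 4 * M * B y" for y
  proof -
    \<comment> \<open>The minimiser of \<open>B y + D y * h + M * h^2\<close> over \<open>h\<close>.
      The mean value inequality bounds the Taylor remainder by \<open>M * h^2\<close> rather than by
      half of it, hence the factor 4 in place of the sharp 2.\<close>
    define h where "h = - D y / (2 * M)"
    have "norm ((\<lambda>x. B x - D y * x) (y + h) - (\<lambda>x. B x - D y * x) y) \<le> (M * \<bar>h\<bar>) * norm (y + h - y)"
    proof (rule field_differentiable_bound[where S = "cball y \<bar>h\<bar>" and f' = "\<lambda>x. D x - D y"])
      fix x assume x: "x \<in> cball y \<bar>h\<bar>"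
      show "((\<lambda>x. B x - D y * x) has_field_derivative D x - D y) (at x within cball y \<bar>h\<bar>)"
        by (auto intro!: derivative_eq_intros has_field_derivative_at_within[OF Bd])
      have "\<bar>D x - D y\<bar> \<le> M * \<bar>x - y\<bar>"
        using lip[of x y] lip[of y x] by (cases "x \<le> y") (auto simp: abs_minus_commute)
      also have "\<dots> \<le> M * \<bar>h\<bar>" using x M by (intro mult_left_mono) (auto simp: dist_real_def abs_minus_commute)
      finally show "norm (D x - D y) \<le> M * \<bar>h\<bar>" by simp
    qed (auto simp: dist_real_def)
    then have "B (y + h) - B y - D y * h \<le> M * h\<^sup>2"
      by (simp add: algebra_simps power2_eq_square)
    moreover have "0 \<le> B (y + h)" using Bpos[of "y + h"] C(1) by (smt (verit) divide_pos_pos)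
    ultimately have "0 \<le> B y + D y * h + M * h\<^sup>2" by linarith
    also have "\<dots> = B y - (D y)\<^sup>2 / (4 * M)"
      unfolding h_def using M(1) by (simp add: field_simps power2_eq_square)
    finally show ?thesis using M(1) by (simp add: field_simps)
  qed
  have "AE y in lborel. \<rho>0 y = 1 / B y"
    using B(2) by eventually_elim (auto dest: sym)
  moreover have "0 < 1 / C" using C by simp
  ultimately show ?thesis using Bd D(1) M Bpos landau by blast
qed


text \<open>\<open>1 / \<rho>0\<close> agrees with a continuous function, which is bounded on
  compact intervals. The bound serves to divide out powers of \<open>\<rho>0\<close> from weighted
  estimates, locally in space.\<close>

lemma density_locally_bounded_below:
  assumes \<rho>: "\<And>y. 0 < \<rho>0 y" "L_infty UNIV \<rho>0"
    and w: "weak_deriv1 (\<lambda>y. 1 / \<rho>0 y) d" "weak_deriv1 d dd" "L_infty UNIV dd"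
  shows "\<exists>c>0. AE y in lborel. \<bar>y\<bar> \<le> N \<longrightarrow> c \<le> \<rho>0 y"
proof -
  obtain B D M b0 where B: "\<forall>y. (B has_real_derivative D y) (at y)" "AE y in lborel. \<rho>0 y = 1 / B y"
    "b0 > 0" "\<forall>y. b0 \<le> B y \<and> (D y)\<^sup>2 \<le> 4 * M * B y"
    using inverse_density_regularity[OF \<rho> w] by blast
  have "continuous_on {-N..N} B"
    using B(1) by (meson DERIV_isCont continuous_at_imp_continuous_on)
  then have "bounded (B ` {-N..N})" by (intro compact_imp_bounded compact_continuous_image) auto
  then obtain K where K: "\<And>y. y \<in> {-N..N} \<Longrightarrow> \<bar>B y\<bar> \<le> K" unfolding bounded_iff by (metis image_eqI real_norm_def)
  define K' where "K' = max K 1"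
  have "AE y in lborel. \<bar>y\<bar> \<le> N \<longrightarrow> 1 / K' \<le> \<rho>0 y"
    using B(2)
  proof eventually_elim
    case (elim y)
    show ?case
    proof
      assume "\<bar>y\<bar> \<le> N"
      then have "y \<in> {-N..N}" by auto
      then have "B y \<le> K'" using K[of y] unfolding K'_def by auto
      moreover have "0 < B y" using B(3,4) by (meson less_le_trans)
      ultimately show "1 / K' \<le> \<rho>0 y" unfolding elim by (intro divide_left_mono) auto
    qed
  qed
  then show ?thesis by (intro exI[of _ "1 / K'"]) (auto simp: K'_def)
qed

text \<open>The weight is \<open>e = H \<ell>\<close>, where \<open>\<ell> = - \<alpha> (ln \<rho>\<^sub>0)'\<close> and \<open>H\<close> is a relaxation of \<open>1 / J\<^sub>0\<close> at the
  length scale \<open>1 / \<surd>\<rho>\<^sub>0\<close>: this makes \<open>e'\<close> of size \<open>\<rho>\<^sub>0\<close> although \<open>J\<^sub>0'\<close> is unbounded, while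
  \<open>\<integral> J\<^sub>0 e\<close> still differs from \<open>- \<alpha> ln \<rho>\<^sub>0\<close> by a bounded amount.\<close>

lemma entropy_weight:
  fixes \<rho>0 J0 dJ0 d dd :: "real \<Rightarrow> real"
  assumes \<alpha>: "\<alpha> > 0" and \<rho>: "\<And>y. 0 < \<rho>0 y" "L_infty UNIV \<rho>0" "integrable lborel \<rho>0"
    and w: "weak_deriv1 (\<lambda>y. 1 / \<rho>0 y) d" "weak_deriv1 d dd" "L_infty UNIV dd"
    and J0: "Jlow > 0" "AE y in lborel. Jlow \<le> J0 y" "L_infty UNIV J0" "weak_deriv1 J0 dJ0"
      "L2 (\<lambda>y. dJ0 y / sqrt (\<rho>0 y))"
  shows "\<exists>e e' C. C > 0 \<and> continuous_on UNIV e \<and> primitive_on UNIV e e' \<and> e' \<in> borel_measurable borel \<and>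
    (AE y in lborel. \<bar>e y\<bar> \<le> C * sqrt (\<rho>0 y) \<and> \<bar>e' y\<bar> \<le> C * \<rho>0 y \<and>
       \<bar>signed_integral 0 (\<lambda>x. J0 x * e x) y + \<alpha> * ln (\<rho>0 y)\<bar> \<le> C)"
proof -
  obtain B D M b0 where B: "\<forall>y. (B has_real_derivative D y) (at y)" and D: "primitive_on UNIV D dd" and M: "M > 0"
    and dd: "AE y in lborel. \<bar>dd y\<bar> \<le> M" and \<rho>B: "AE y in lborel. \<rho>0 y = 1 / B y" and b0: "b0 > 0"
    and Bb: "\<forall>y. b0 \<le> B y \<and> (D y)\<^sup>2 \<le> 4 * M * B y"
    using inverse_density_regularity[OF \<rho>(1,2) w] by blast
  have B0: "0 < B y" for y using Bb b0 by (meson less_le_trans)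
  have Bc: "continuous_on UNIV B" using B by (meson DERIV_isCont continuous_at_imp_continuous_on)
  have Dc: "continuous_on UNIV D" by (rule primitive_on_UNIV_continuous[OF D])
  have BP: "primitive_on UNIV B D"
    by (rule primitive_on_DERIV[OF _ has_field_derivative_at_within Dc]) (use B in auto)
  have [measurable]: "dd \<in> borel_measurable borel" using L_infty_UNIV[OF w(3)] by metis
  have [measurable]: "B \<in> borel_measurable borel" "D \<in> borel_measurable borel"
    using Bc Dc by (auto intro: borel_measurable_continuous_onI)
  obtain Jh where Jh: "Jh > 0" "J0 \<in> borel_measurable borel" "AE y in lborel. \<bar>J0 y\<bar> \<le> Jh"
    using L_infty_UNIV[OF J0(3)] by metis
  note [measurable] = Jh(2)
  obtain Jr where Jr: "primitive_on UNIV Jr dJ0" "AE y in lborel. J0 y = Jr y"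
    using weak_deriv1_primitive[OF J0(4)] by blast
  have Jc: "continuous_on UNIV Jr" by (rule primitive_on_UNIV_continuous[OF Jr(1)])
  have "AE y in lborel. Jlow \<le> Jr y" using J0(2) Jr(2) by eventually_elim simp
  then have Jl: "Jlow \<le> Jr y" for y using Jc by (rule AE_le_imp_le)
  have "AE y in lborel. Jr y \<le> Jh" using Jh(3) Jr(2) by eventually_elim auto
  then have Ju: "Jr y \<le> Jh" for y using Jc by (rule AE_ge_imp_ge)
  have Jpos: "0 < Jr y" for y using Jl[of y] J0(1) by linarith
  define kmax where "kmax = 1 / Jlow"
  have kmax: "kmax > 0" using J0(1) by (simp add: kmax_def)
  define j where "j x = - (1 / (Jr x)\<^sup>2) * dJ0 x" for x
  have kP: "primitive_on UNIV (\<lambda>y. 1 / Jr y) j"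
    unfolding j_def
  proof (rule primitive_on_chain[OF _ Jr(1), of "{0<..}" "\<lambda>r. 1 / r" "\<lambda>r. - (1 / r\<^sup>2)"])
    show "((\<lambda>r. 1 / r) has_real_derivative - (1 / r\<^sup>2)) (at r)" if "r \<in> {0<..}" for r :: real
      using that by (auto intro!: derivative_eq_intros simp: power2_eq_square field_simps)
    show "continuous_on {0<..} (\<lambda>r::real. - (1 / r\<^sup>2))" by (intro continuous_intros) auto
  qed (use Jpos in auto)
  \<comment> \<open>A bound for the total variation of \<open>1 / J0\<close>: by Young's inequality
    \<open>\<bar>dJ0\<bar>\<close> is at most \<open>(dJ0 / sqrt \<rho>0)^2 + \<rho>0\<close>, and
    both summands are integrable by hypothesis.\<close>
  define V where "V = (1 / Jlow\<^sup>2) * (LINT y|lborel. (dJ0 y / sqrt (\<rho>0 y))\<^sup>2 + \<rho>0 y)"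
  have sqi: "integrable lborel (\<lambda>y. (dJ0 y / sqrt (\<rho>0 y))\<^sup>2 + \<rho>0 y)"
    using J0(5) \<rho>(3) unfolding L2_def by auto
  have V: "(LINT y:{a..b}|lborel. \<bar>j y\<bar>) \<le> V" if "a \<le> b" for a b
  proof -
    have ji: "set_integrable lborel {a..b} j" using primitive_onD(1)[OF kP, of a b] that by simp
    have pt: "\<bar>j y\<bar> \<le> (1 / Jlow\<^sup>2) * ((dJ0 y / sqrt (\<rho>0 y))\<^sup>2 + \<rho>0 y)" for y
    proof -
      have 1: "\<bar>dJ0 y\<bar> \<le> (dJ0 y / sqrt (\<rho>0 y))\<^sup>2 + \<rho>0 y"
      proof -
        define s where "s = sqrt (\<rho>0 y)"
        have s: "s > 0" "s\<^sup>2 = \<rho>0 y" using \<rho>(1)[of y] by (auto simp: s_def less_imp_le)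
        have "0 \<le> (\<bar>dJ0 y / s\<bar> - s)\<^sup>2" by simp
        also have "\<dots> = (dJ0 y / s)\<^sup>2 + s\<^sup>2 - 2 * \<bar>dJ0 y\<bar>"
          using s(1) by (simp add: power2_diff abs_div power_divide)
        finally show ?thesis using s by (simp add: s_def[symmetric])
      qed
      have "1 / (Jr y)\<^sup>2 \<le> 1 / Jlow\<^sup>2"
        using Jl[of y] J0(1) by (intro divide_left_mono power_mono) auto
      then have "(1 / (Jr y)\<^sup>2) * \<bar>dJ0 y\<bar> \<le> (1 / Jlow\<^sup>2) * ((dJ0 y / sqrt (\<rho>0 y))\<^sup>2 + \<rho>0 y)"
        using 1 by (intro mult_mono) auto
      then show ?thesis by (simp add: j_def abs_mult)
    qed
    have "(LINT y:{a..b}|lborel. \<bar>j y\<bar>) \<le> (LINT y|lborel. (1 / Jlow\<^sup>2) * ((dJ0 y / sqrt (\<rho>0 y))\<^sup>2 + \<rho>0 y))"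
      unfolding set_lebesgue_integral_def
    proof (rule integral_mono)
      show "integrable lborel (\<lambda>y. indicat_real {a..b} y *\<^sub>R \<bar>j y\<bar>)"
        using set_integrable_abs[OF ji] unfolding set_integrable_def .
      show "integrable lborel (\<lambda>y. (1 / Jlow\<^sup>2) * ((dJ0 y / sqrt (\<rho>0 y))\<^sup>2 + \<rho>0 y))" using sqi by (rule integrable_mult_right)
      fix y
      have "0 \<le> (1 / Jlow\<^sup>2) * ((dJ0 y / sqrt (\<rho>0 y))\<^sup>2 + \<rho>0 y)" using pt[of y] by linarith
      then show "indicat_real {a..b} y *\<^sub>R \<bar>j y\<bar> \<le> (1 / Jlow\<^sup>2) * ((dJ0 y / sqrt (\<rho>0 y))\<^sup>2 + \<rho>0 y)"
        using pt[of y] by (cases "y \<in> {a..b}") auto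
    qed
    then show ?thesis unfolding V_def by (simp only: integral_mult_right_zero)
  qed
  have V0: "V \<ge> 0" using V[of 0 0] by (metis order.refl order_trans set_integral_singleton_lborel)
  \<comment> \<open>The continuous version of \<open>sqrt \<rho>0\<close>. With this relaxation
    rate, \<open>h\<close> and the logarithmic derivative \<open>l\<close> are both of order
    \<open>r\<close>, so their product in \<open>e'\<close> is of order
    \<open>\<rho>0\<close>.\<close>
  define r where "r y = 1 / sqrt (B y)" for y
  have rc: "continuous_on UNIV r"
    unfolding r_def using B0 by (intro continuous_intros Bc) (auto simp: less_imp_neq[OF B0, symmetric])
  have r0: "0 \<le> r y" for y unfolding r_def using B0[of y] by simp
  have r2: "r y * r y = 1 / B y" for y unfolding r_def using B0[of y] by (simp add: real_sqrt_mult_self)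
  have k1: "0 \<le> 1 / Jr y" for y using Jpos[of y] by simp
  have k2: "1 / Jr y \<le> kmax" for y unfolding kmax_def using Jl[of y] J0(1) by (intro divide_left_mono) auto
  obtain H h where H: "primitive_on UNIV H h" and hm[measurable]: "h \<in> borel_measurable borel"
    and Hb: "\<forall>y. 0 \<le> H y \<and> H y \<le> kmax \<and> \<bar>h y\<bar> \<le> kmax * r y"
    and V1: "\<forall>Y\<ge>0. (LINT y:{0..Y}|lborel. r y * \<bar>H y - 1 / Jr y\<bar>) \<le> V"
    and V2: "\<forall>Y\<ge>0. (LINT y:{-Y..0}|lborel. r y * \<bar>H y - 1 / Jr y\<bar>) \<le> V"
    using relaxation[OF rc r0 kP k1 k2, of V] V by blast
  have Hc: "continuous_on UNIV H" by (rule primitive_on_UNIV_continuous[OF H])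
  have [measurable]: "H \<in> borel_measurable borel" using Hc by (rule borel_measurable_continuous_onI)
  define l where "l y = \<alpha> * (D y * (1 / B y))" for y
  define l' where "l' y = \<alpha> * (D y * (- (1 / (B y)\<^sup>2) * D y) + dd y * (1 / B y))" for y
  have invB: "primitive_on UNIV (\<lambda>y. 1 / B y) (\<lambda>y. - (1 / (B y)\<^sup>2) * D y)"
  proof (rule primitive_on_chain[OF _ BP, of "{0<..}" "\<lambda>r. 1 / r" "\<lambda>r. - (1 / r\<^sup>2)"])
    show "((\<lambda>r. 1 / r) has_real_derivative - (1 / r\<^sup>2)) (at r)" if "r \<in> {0<..}" for r :: real
      using that by (auto intro!: derivative_eq_intros simp: power2_eq_square field_simps)
    show "continuous_on {0<..} (\<lambda>r::real. - (1 / r\<^sup>2))" by (intro continuous_intros) auto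
  qed (use B0 in auto)
  have lP: "primitive_on UNIV l l'"
    unfolding l_def l'_def by (intro primitive_on_cmult primitive_on_mult D invB) simp
  define sM where "sM = 2 * sqrt M"
  have sM: "sM > 0" using M by (simp add: sM_def)
  \<comment> \<open>The Landau bound on \<open>D\<close> makes \<open>D / B\<close> of order
    \<open>1 / sqrt B\<close> and \<open>D^2 / B^2\<close> of order \<open>1 / B\<close>, the decay
    rates required of \<open>e\<close> and \<open>e'\<close>.\<close>
  have Db: "\<bar>D y\<bar> \<le> sM * sqrt (B y)" for y
  proof -
    have "\<bar>D y\<bar> = sqrt ((D y)\<^sup>2)" by simp
    also have "\<dots> \<le> sqrt (4 * M * B y)" using Bb by (intro real_sqrt_le_mono) auto
    finally show ?thesis by (simp add: sM_def real_sqrt_mult)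
  qed
  have lb: "\<bar>l y\<bar> \<le> \<alpha> * sM * r y" for y
  proof -
    have "\<bar>D y\<bar> * (1 / B y) \<le> (sM * sqrt (B y)) * (1 / B y)" using Db B0[of y] by (intro mult_right_mono) auto
    also have "\<dots> = sM * r y" unfolding r_def using B0[of y] by (simp add: real_div_sqrt field_simps)
    finally have "\<alpha> * (\<bar>D y\<bar> * (1 / B y)) \<le> \<alpha> * (sM * r y)" using \<alpha> by (intro mult_left_mono) auto
    then show ?thesis using \<alpha> B0[of y] by (simp add: l_def abs_mult mult.assoc)
  qed
  \<comment> \<open>Of the factor \<open>5 M\<close>, the part \<open>4 M\<close> comes from
    \<open>D^2 / B^2\<close> by the Landau bound and \<open>M\<close> from
    \<open>dd / B\<close>.\<close>
  have lb': "AE y in lborel. \<bar>l' y\<bar> \<le> \<alpha> * (5 * M) * (1 / B y)"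
    using dd
  proof eventually_elim
    case (elim y)
    have "\<bar>D y * (- (1 / (B y)\<^sup>2) * D y)\<bar> = (D y)\<^sup>2 / (B y)\<^sup>2"
      by (simp add: abs_mult power2_eq_square)
    also have "\<dots> \<le> (4 * M * B y) / (B y)\<^sup>2" using Bb by (intro divide_right_mono) auto
    also have "\<dots> = 4 * M * (1 / B y)" using B0[of y] by (simp add: power2_eq_square field_simps)
    finally have 1: "\<bar>D y * (- (1 / (B y)\<^sup>2) * D y)\<bar> \<le> 4 * M * (1 / B y)" .
    have 2: "\<bar>dd y * (1 / B y)\<bar> \<le> M * (1 / B y)"
      using elim B0[of y] by (simp add: abs_mult divide_right_mono)
    have "\<bar>l' y\<bar> = \<alpha> * \<bar>D y * (- (1 / (B y)\<^sup>2) * D y) + dd y * (1 / B y)\<bar>"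
      using \<alpha> by (simp add: l'_def abs_mult)
    also have "\<dots> \<le> \<alpha> * (4 * M * (1 / B y) + M * (1 / B y))"
      using \<alpha> 1 2 by (intro mult_left_mono) linarith+
    finally show ?case by (simp add: algebra_simps)
  qed
  define e where "e y = H y * l y" for y
  define e' where "e' y = H y * l' y + h y * l y" for y
  have eP: "primitive_on UNIV e e'" unfolding e_def e'_def by (rule primitive_on_mult[OF _ H lP]) simp
  have ec: "continuous_on UNIV e" by (rule primitive_on_UNIV_continuous[OF eP])
  have em: "e' \<in> borel_measurable borel" unfolding e'_def l'_def l_def by measurable
  have lc: "continuous_on UNIV l" by (rule primitive_on_UNIV_continuous[OF lP])
  have [measurable]: "e \<in> borel_measurable borel" "Jr \<in> borel_measurable borel"
    using ec Jc by (auto intro: borel_measurable_continuous_onI)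
  have eb: "\<bar>e y\<bar> \<le> kmax * (\<alpha> * sM) * r y" for y
  proof -
    have "\<bar>H y\<bar> * \<bar>l y\<bar> \<le> kmax * (\<alpha> * sM * r y)" using Hb lb[of y] kmax by (intro mult_mono) auto
    then show ?thesis by (simp add: e_def abs_mult mult.assoc)
  qed
  have eb': "AE y in lborel. \<bar>e' y\<bar> \<le> kmax * \<alpha> * (5 * M + sM) * (1 / B y)"
    using lb'
  proof eventually_elim
    case (elim y)
    have "\<bar>H y\<bar> * \<bar>l' y\<bar> \<le> kmax * (\<alpha> * (5 * M) * (1 / B y))" using Hb elim kmax by (intro mult_mono) auto
    moreover have "\<bar>h y\<bar> * \<bar>l y\<bar> \<le> (kmax * r y) * (\<alpha> * sM * r y)"
      using Hb lb[of y] kmax r0[of y] by (intro mult_mono) auto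
    moreover have "(kmax * r y) * (\<alpha> * sM * r y) = kmax * \<alpha> * sM * (1 / B y)"
      using r2[of y] by (metis (no_types, opaque_lifting) mult.assoc mult.left_commute)
    moreover have "\<bar>e' y\<bar> \<le> \<bar>H y\<bar> * \<bar>l' y\<bar> + \<bar>h y\<bar> * \<bar>l y\<bar>"
      unfolding e'_def by (metis abs_mult abs_triangle_ineq)
    ultimately show ?case by (simp add: algebra_simps)
  qed
  define S where "S = signed_integral 0 (\<lambda>x. Jr x * e x)"
  have SP: "primitive_on UNIV S (\<lambda>x. Jr x * e x)"
    unfolding S_def by (rule primitive_on_signed_integral) (auto intro!: set_integrable_continuous_ivl continuous_on_mult Jc ec)
  have LP: "primitive_on UNIV (\<lambda>y. \<alpha> * ln (B y)) l"
  proof (rule primitive_on_DERIV)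
    show "((\<lambda>y. \<alpha> * ln (B y)) has_real_derivative l y) (at y within UNIV)" for y
      using B B0[of y] unfolding l_def by (auto intro!: derivative_eq_intros simp: field_simps)
  qed (auto intro: lc)
  have PP: "primitive_on UNIV (\<lambda>y. S y - \<alpha> * ln (B y)) (\<lambda>x. Jr x * e x - l x)"
    by (rule primitive_on_diff[OF SP LP])
  \<comment> \<open>The defect factorises as \<open>Jr e - l = Jr l (H - 1 / Jr)\<close>. As
    \<open>l\<close> is of order \<open>r\<close>, its integral is controlled by that of
    \<open>r \<bar>H - 1 / Jr\<bar>\<close>, which the relaxation bounds by
    \<open>V\<close>.\<close>
  have gb: "\<bar>Jr x * e x - l x\<bar> \<le> Jh * \<alpha> * sM * (r x * \<bar>H x - 1 / Jr x\<bar>)" for x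
  proof -
    have "Jr x * e x - l x = Jr x * l x * (H x - 1 / Jr x)"
      unfolding e_def using Jpos[of x] by (simp add: field_simps)
    then have "\<bar>Jr x * e x - l x\<bar> = (Jr x * \<bar>l x\<bar>) * \<bar>H x - 1 / Jr x\<bar>"
      using Jpos[of x] by (simp add: abs_mult)
    also have "\<dots> \<le> (Jh * (\<alpha> * sM * r x)) * \<bar>H x - 1 / Jr x\<bar>"
      using Ju[of x] lb[of x] Jpos[of x] Jh(1) by (intro mult_right_mono mult_mono) auto
    finally show ?thesis by (simp add: mult.assoc)
  qed
  have rHc: "continuous_on UNIV (\<lambda>x. r x * \<bar>H x - 1 / Jr x\<bar>)"
    using less_imp_neq[OF Jpos] by (intro continuous_intros rc Hc Jc) (auto dest: sym)
  define CV where "CV = Jh * \<alpha> * sM * V"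
  have ivl: "\<bar>(S b - \<alpha> * ln (B b)) - (S a - \<alpha> * ln (B a))\<bar> \<le> CV"
    if ab: "a \<le> b" and v: "(LINT y:{a..b}|lborel. r y * \<bar>H y - 1 / Jr y\<bar>) \<le> V" for a b
  proof -
    have i: "set_integrable lborel {a..b} (\<lambda>x. Jr x * e x - l x)"
      using primitive_onD(1)[OF PP, of a b] ab by simp
    have "\<bar>(S b - \<alpha> * ln (B b)) - (S a - \<alpha> * ln (B a))\<bar> = \<bar>LINT x:{a..b}|lborel. Jr x * e x - l x\<bar>"
      using primitive_onD(2)[OF PP, of a b] ab by simp
    also have "\<dots> \<le> (LINT x:{a..b}|lborel. \<bar>Jr x * e x - l x\<bar>)" by (rule set_integral_abs_bound[OF i])
    also have "\<dots> \<le> (LINT x:{a..b}|lborel. Jh * \<alpha> * sM * (r x * \<bar>H x - 1 / Jr x\<bar>))"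
      by (rule set_integral_mono[OF set_integrable_abs[OF i] set_integrable_continuous_ivl gb])
         (intro continuous_on_mult continuous_on_const rHc)
    also have "\<dots> = Jh * \<alpha> * sM * (LINT x:{a..b}|lborel. r x * \<bar>H x - 1 / Jr x\<bar>)" by simp
    also have "\<dots> \<le> CV" unfolding CV_def using v Jh(1) \<alpha> sM by (intro mult_left_mono) auto
    finally show ?thesis .
  qed
  have Sb: "\<bar>S y - \<alpha> * ln (B y)\<bar> \<le> CV + \<bar>\<alpha> * ln (B 0)\<bar>" for y
  proof -
    have S0: "S 0 = 0" by (simp add: S_def)
    show ?thesis
    proof (cases "y \<ge> 0")
      case True
      then show ?thesis using ivl[of 0 y] V1 S0 by auto
    next
      case False
      then have "(LINT x:{y..0}|lborel. r x * \<bar>H x - 1 / Jr x\<bar>) \<le> V" using V2[rule_format, of "-y"] by simp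
      then show ?thesis using ivl[of y 0] False S0 by auto
    qed
  qed
  \<comment> \<open>\<open>J0\<close> and its continuous representative \<open>Jr\<close> have the
    same integrals against \<open>e\<close>.\<close>
  have SJ: "signed_integral 0 (\<lambda>x. J0 x * e x) y = S y" for y
  proof -
    have "(LINT x:{a..b}|lborel. J0 x * e x) = (LINT x:{a..b}|lborel. Jr x * e x)" for a b
      by (rule set_lebesgue_integral_cong_AE) (use Jr(2) in \<open>auto elim!: eventually_mono\<close>)
    then show ?thesis unfolding S_def signed_integral_def by simp
  qed
  \<comment> \<open>The sum of the constants of the three estimates, so that a single
    \<open>C\<close> serves them all; the 1 makes it positive.\<close>
  define C where "C = 1 + kmax * (\<alpha> * sM) + kmax * \<alpha> * (5 * M + sM) + (CV + \<bar>\<alpha> * ln (B 0)\<bar>)"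
  have pos: "0 \<le> kmax * (\<alpha> * sM)" "0 \<le> kmax * \<alpha> * (5 * M + sM)" "0 \<le> CV"
    unfolding CV_def using kmax \<alpha> sM M Jh(1) V0 by auto
  have "AE y in lborel. \<bar>e y\<bar> \<le> C * sqrt (\<rho>0 y) \<and> \<bar>e' y\<bar> \<le> C * \<rho>0 y \<and>
       \<bar>signed_integral 0 (\<lambda>x. J0 x * e x) y + \<alpha> * ln (\<rho>0 y)\<bar> \<le> C"
    using eb' \<rho>B
  proof eventually_elim
    case (elim y)
    have "\<bar>e y\<bar> \<le> C * r y"
      by (rule order_trans[OF eb mult_right_mono]) (use pos r0 in \<open>auto simp: C_def\<close>)
    moreover have "\<bar>e' y\<bar> \<le> C * (1 / B y)"
      by (rule order_trans[OF elim(1) mult_right_mono]) (use pos B0[of y] in \<open>auto simp: C_def\<close>)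
    moreover have "\<bar>S y + \<alpha> * ln (1 / B y)\<bar> \<le> C"
      using Sb[of y] pos B0[of y] by (simp add: C_def ln_div)
    moreover have "r y = sqrt (1 / B y)" by (simp add: r_def real_sqrt_divide)
    ultimately show ?case unfolding elim(2) SJ by simp
  qed
  moreover have "C > 0" using pos by (auto simp: C_def)
  ultimately show ?thesis using ec eP em by blast
qed

section \<open>The subsolution\<close>

lemma abs_signed_integral_le_LINT:
  assumes "integrable lborel g"
  shows "\<bar>signed_integral c g y\<bar> \<le> (LINT x|lborel. \<bar>g x\<bar>)"
proof -
  have *: "\<bar>LINT x:A|lborel. g x\<bar> \<le> (LINT x|lborel. \<bar>g x\<bar>)" if "A \<in> sets borel" for A
  proof -
    have i: "set_integrable lborel A g"
      unfolding set_integrable_def by (rule integrable_mult_indicator) (use assms that in auto)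
    have "\<bar>LINT x:A|lborel. g x\<bar> \<le> (LINT x:A|lborel. \<bar>g x\<bar>)" by (rule set_integral_abs_bound[OF i])
    also have "\<dots> \<le> (LINT x|lborel. \<bar>g x\<bar>)"
      using set_integrable_abs[OF i] assms unfolding set_lebesgue_integral_def set_integrable_def
      by (intro integral_mono) (auto simp: indicator_def)
    finally show ?thesis .
  qed
  show ?thesis unfolding signed_integral_def using *[of "{c..y}"] *[of "{y..c}"] by auto
qed

lemma set_integrable_AE_bounded:
  fixes g :: "'a::euclidean_space \<Rightarrow> real"
  assumes "g \<in> borel_measurable borel" "AE x in lborel. x \<in> A \<longrightarrow> \<bar>g x\<bar> \<le> c" "A \<in> sets borel" "emeasure lborel A < \<infinity>"
  shows "set_integrable lborel A g"
  unfolding set_integrable_def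
proof (rule Bochner_Integration.integrable_bound)
  show "integrable lborel (\<lambda>x. indicat_real A x * c)"
    using assms(3,4) by (intro integrable_mult_left integrable_real_indicator) auto
  show "(\<lambda>x. indicat_real A x *\<^sub>R g x) \<in> borel_measurable lborel" using assms(1,3) by measurable
  show "AE x in lborel. norm (indicat_real A x *\<^sub>R g x) \<le> norm (indicat_real A x * c)"
    using assms(2) by eventually_elim (auto simp: indicator_def)
qed

lemma set_integrable_ivl_AE_bounded:
  fixes g :: "real \<Rightarrow> real"
  assumes "g \<in> borel_measurable borel" "AE x in lborel. \<bar>g x\<bar> \<le> c"
  shows "set_integrable lborel {a..b} g"
  by (rule set_integrable_AE_bounded) (use assms in \<open>auto elim!: eventually_mono simp: emeasure_lborel_Icc_eq\<close>)

lemma set_integral_ivl_const: "a \<le> b \<Longrightarrow> (LINT x:{a..b}|lborel. (c::real)) = c * (b - a)"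
  by (simp add: set_lebesgue_integral_def)

text \<open>Of the system only the differential inequality \<open>super\<close> and the regularity
  of \<open>J\<close> and \<open>\<theta>\<close> are kept; in the application \<open>b\<close> is
  \<open>R^2 / (4 \<mu>)\<close>. The hypotheses on \<open>Jt\<close> and \<open>\<theta>t\<close>
  range over all times, with extensions by 0 outside the strip in mind, so that integrals starting
  at time 0 make sense.\<close>

locale heat_supersolution =
  fixes T \<kappa> cv b \<alpha> Jl Ju J0m \<rho>m c0 C CJ :: real
    and \<rho>0 J0 \<theta>0 e e' :: "real \<Rightarrow> real"
    and J Jt \<theta> \<theta>t \<theta>y Qy :: "real \<times> real \<Rightarrow> real"
  assumes T: "T > 0" and \<kappa>: "\<kappa> > 0" and cv: "cv > 0" and b: "b \<ge> 0" and \<alpha>: "\<alpha> > 0" and Jl: "Jl > 0"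
    and c0: "c0 > 0" and C: "C > 0" and \<rho>m: "\<rho>m > 0" and CJ: "CJ \<ge> 0"
    and meas1 [measurable]: "\<rho>0 \<in> borel_measurable borel" "J0 \<in> borel_measurable borel"
      "\<theta>0 \<in> borel_measurable borel" "e' \<in> borel_measurable borel"
    and meas2 [measurable]: "J \<in> borel_measurable borel" "Jt \<in> borel_measurable borel"
      "\<theta> \<in> borel_measurable borel" "\<theta>t \<in> borel_measurable borel"
      "\<theta>y \<in> borel_measurable borel" "Qy \<in> borel_measurable borel"
    and \<rho>0_pos: "\<And>y. 0 < \<rho>0 y" and \<rho>0_le: "AE y in lborel. \<rho>0 y \<le> \<rho>m" and \<rho>0_int: "integrable lborel \<rho>0"
    and J_bounds: "AE z in lborel. z \<in> strip T \<longrightarrow> Jl \<le> J z \<and> J z \<le> Ju"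
    and J0_bound: "AE y in lborel. \<bar>J0 y\<bar> \<le> J0m"
    and Jt_int: "\<And>r. set_integrable lborel ({-r..r} \<times> UNIV) Jt"
    and Jt_L2: "AE t in lborel. (\<integral>\<^sup>+ y. ennreal ((Jt (y, t))\<^sup>2) \<partial>lborel) \<le> ennreal CJ"
    and J_eq: "AE z in lborel. z \<in> strip T \<longrightarrow> J z = J0 (fst z) + (LINT s:{0..snd z}|lborel. Jt (fst z, s))"
    and \<theta>t_int: "\<And>r. set_integrable lborel ({-r..r} \<times> UNIV) \<theta>t"
    and \<theta>_eq: "AE z in lborel. z \<in> strip T \<longrightarrow> \<theta> z = \<theta>0 (fst z) + (LINT s:{0..snd z}|lborel. \<theta>t (fst z, s))"
    and \<theta>_nonneg: "AE z in lborel. z \<in> strip T \<longrightarrow> 0 \<le> \<theta> z"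
    and \<theta>_slice: "AE t in lborel. t \<in> {0<..<T} \<longrightarrow>
      (\<exists>u. primitive_on UNIV u (\<lambda>y. \<theta>y (y, t)) \<and> (AE y in lborel. \<theta> (y, t) = u y))"
    and flux_slice: "AE t in lborel. t \<in> {0<..<T} \<longrightarrow>
      (\<exists>u. primitive_on UNIV u (\<lambda>y. Qy (y, t)) \<and> (AE y in lborel. \<theta>y (y, t) / J (y, t) = u y))"
    and super: "AE z in lborel. z \<in> strip T \<longrightarrow>
      \<kappa> * Qy z - b * (\<rho>0 (fst z))\<^sup>2 * (\<theta> z)\<^sup>2 / J z \<le> cv * \<rho>0 (fst z) * \<theta>t z"
    and e_cont: "continuous_on UNIV e" and e_prim: "primitive_on UNIV e e'"
    and e_bounds: "AE y in lborel. \<bar>e y\<bar> \<le> C * sqrt (\<rho>0 y) \<and> \<bar>e' y\<bar> \<le> C * \<rho>0 y \<and>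
       \<bar>signed_integral 0 (\<lambda>x. J0 x * e x) y + \<alpha> * ln (\<rho>0 y)\<bar> \<le> C"
    and init: "AE y in lborel. c0 * \<rho>0 y powr \<alpha> \<le> \<theta>0 y"
begin

lemma e_meas [measurable]: "e \<in> borel_measurable borel"
  using e_cont by (rule borel_measurable_continuous_onI)

text \<open>The time derivative of \<open>E\<close>. The exponent is defined by integrating
  \<open>a\<close> in time from its initial profile, which makes its regularity in time immediate;
  its space derivative \<open>J e\<close> is recovered in \<open>E_space\<close>.\<close>

definition a :: "real \<times> real \<Rightarrow> real" where
  "a z = signed_integral 0 (\<lambda>x. Jt (x, snd z) * e x) (fst z)"

definition E :: "real \<times> real \<Rightarrow> real" where
  "E z = signed_integral 0 (\<lambda>x. J0 x * e x) (fst z) + (LINT s:{0..snd z}|lborel. a (fst z, s))"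

text \<open>\<open>C1\<close> bounds \<open>\<bar>a\<bar>\<close>; \<open>\<delta>\<close> is chosen
  so that \<open>w\<close> starts below \<open>c0 * \<rho>0 powr \<alpha>\<close>, and
  \<open>W\<close> is the resulting upper bound of \<open>w\<close>. In \<open>K\<close> the summand
  \<open>C1\<close> compensates the drift of the exponent, the quotient by \<open>cv\<close>
  compensates diffusion and the quadratic sink.\<close>

definition C1 :: real where "C1 = CJ + C\<^sup>2 * (LINT y|lborel. \<rho>0 y)"
definition \<delta> :: real where "\<delta> = c0 * exp (- C)"
definition W :: real where "W = c0 * \<rho>m powr \<alpha>"
definition K :: real where "K = C1 + (\<kappa> * C + b * \<rho>m * W / Jl) / cv"

definition w :: "real \<times> real \<Rightarrow> real" where
  "w z = \<delta> * exp (- K * snd z - E z)"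

definition wt :: "real \<times> real \<Rightarrow> real" where
  "wt z = - (w z * (K + a z))"

lemma a_meas [measurable]: "a \<in> borel_measurable borel"
  unfolding a_def by measurable

lemma E_eq_LINT: "E z = signed_integral 0 (\<lambda>x. J0 x * e x) (fst z)
    + (LINT s|lborel. (if 0 \<le> s \<and> s \<le> snd z then a (fst z, s) else 0))"
  unfolding E_def set_lebesgue_integral_def
  by (intro arg_cong2[where f = "(+)"] refl Bochner_Integration.integral_cong) (auto simp: indicator_def)

lemma E_meas [measurable]: "E \<in> borel_measurable borel"
  unfolding E_eq_LINT by measurable

lemma w_meas [measurable]: "w \<in> borel_measurable borel"
  unfolding w_def by measurable

lemma wt_meas [measurable]: "wt \<in> borel_measurable borel"
  unfolding wt_def by measurable

lemma C1_nonneg: "C1 \<ge> 0"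
  unfolding C1_def using CJ \<rho>0_pos by (auto intro!: add_nonneg_nonneg mult_nonneg_nonneg simp: less_imp_le)

lemma \<delta>_pos: "\<delta> > 0" using c0 by (simp add: \<delta>_def)

lemma W_pos: "W > 0" using c0 \<rho>m by (simp add: W_def)

lemma K_ge: "C1 \<le> K" "cv * (K - C1) = \<kappa> * C + b * \<rho>m * W / Jl"
  unfolding K_def using \<kappa> C b \<rho>m W_pos Jl cv by auto

lemma w_pos: "w z > 0" unfolding w_def using \<delta>_pos by simp

text \<open>\<open>\<bar>Jt e\<bar>\<close> is at most \<open>Jt^2 + C^2 \<rho>0\<close>, whose
  integral over the whole line is at most \<open>C1\<close>. The exceptional set of times does not
  depend on \<open>y\<close>, so the exponent is absolutely continuous in time for every
  \<open>y\<close>.\<close>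

lemma a_bound: "AE s in lborel. \<forall>y. \<bar>a (y, s)\<bar> \<le> C1"
  using Jt_L2
proof eventually_elim
  case (elim s)
  have i1: "integrable lborel (\<lambda>x. (Jt (x, s))\<^sup>2)"
    by (rule integrableI_bounded) (use elim in \<open>auto simp: le_less_trans\<close>)
  have l1: "(LINT x|lborel. (Jt (x, s))\<^sup>2) \<le> CJ"
    using elim nn_integral_eq_integral[OF i1] CJ by simp
  have i2: "integrable lborel (\<lambda>x. (Jt (x, s))\<^sup>2 + C\<^sup>2 * \<rho>0 x)" using i1 \<rho>0_int by simp
  have pt: "AE x in lborel. \<bar>Jt (x, s) * e x\<bar> \<le> (Jt (x, s))\<^sup>2 + C\<^sup>2 * \<rho>0 x"
    using e_bounds
  proof eventually_elim
    case (elim x)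
    have "(e x)\<^sup>2 \<le> (C * sqrt (\<rho>0 x))\<^sup>2" using elim by (metis abs_ge_zero power2_abs power_mono)
    also have "\<dots> = C\<^sup>2 * \<rho>0 x" using \<rho>0_pos[of x] by (simp add: power_mult_distrib less_imp_le)
    finally have 1: "(e x)\<^sup>2 \<le> C\<^sup>2 * \<rho>0 x" .
    have "0 \<le> (\<bar>Jt (x, s)\<bar> - \<bar>e x\<bar>)\<^sup>2" by simp
    then have "2 * \<bar>Jt (x, s) * e x\<bar> \<le> (Jt (x, s))\<^sup>2 + (e x)\<^sup>2" by (simp add: power2_diff abs_mult)
    then show ?case using 1 by (smt (verit) abs_ge_zero)
  qed
  have i3: "integrable lborel (\<lambda>x. Jt (x, s) * e x)"
    by (rule Bochner_Integration.integrable_bound[OF i2])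
       (use pt in \<open>auto elim!: eventually_mono\<close>)
  have "(LINT x|lborel. \<bar>Jt (x, s) * e x\<bar>) \<le> (LINT x|lborel. (Jt (x, s))\<^sup>2 + C\<^sup>2 * \<rho>0 x)"
    by (rule integral_mono_AE[OF integrable_abs[OF i3] i2 pt])
  also have "\<dots> \<le> C1" using i1 \<rho>0_int l1 by (simp add: C1_def)
  finally have "(LINT x|lborel. \<bar>Jt (x, s) * e x\<bar>) \<le> C1" .
  then show ?case
    unfolding a_def using abs_signed_integral_le_LINT[OF i3, of 0] order_trans by fastforce
qed

section \<open>Regularity of the exponent in time and space\<close>

lemma a_int: "set_integrable lborel {p..q} (\<lambda>s. a (y, s))"
  by (rule set_integrable_ivl_AE_bounded[of _ C1]) (measurable, use a_bound in \<open>auto elim!: eventually_mono\<close>)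

lemma E_0: "E (y, 0) = signed_integral 0 (\<lambda>x. J0 x * e x) y"
  using set_integral_singleton_lborel[of 0 "\<lambda>s. a (y, s)"] by (simp add: E_def)

lemma E_time: "primitive_on {0..} (\<lambda>t. E (y, t)) (\<lambda>s. a (y, s))"
proof -
  have "primitive_on {0..} (signed_integral 0 (\<lambda>s. a (y, s))) (\<lambda>s. a (y, s))"
    by (rule primitive_on_signed_integral) (auto intro: a_int)
  from primitive_on_add[OF primitive_on_const this, of "E (y, 0)"]
  have "primitive_on {0..} (\<lambda>t. E (y, 0) + signed_integral 0 (\<lambda>s. a (y, s)) t) (\<lambda>s. a (y, s))" by simp
  then show ?thesis
    by (rule primitive_on_cong) (simp add: E_0 signed_integral_ge, simp add: E_def)
qed

lemma E_diff: "\<bar>E (y, t) - E (y, 0)\<bar> \<le> C1 * t" if t: "t \<ge> 0"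
proof -
  have "\<bar>E (y, t) - E (y, 0)\<bar> = \<bar>LINT s:{0..t}|lborel. a (y, s)\<bar>"
    using primitive_onD(2)[OF E_time, of 0 t y] t by simp
  also have "\<dots> \<le> (LINT s:{0..t}|lborel. \<bar>a (y, s)\<bar>)" by (rule set_integral_abs_bound[OF a_int])
  also have "\<dots> \<le> (LINT s:{0..t}|lborel. C1)"
    by (rule set_integral_mono_AE[OF set_integrable_abs[OF a_int] set_integrable_continuous_ivl])
       (use a_bound in \<open>auto elim!: eventually_mono\<close>)
  also have "\<dots> = C1 * t" using t by (simp add: set_integral_ivl_const)
  finally show ?thesis .
qed

lemma e_bounded_ivl: "\<exists>c. \<forall>x\<in>{p..q}. \<bar>e x\<bar> \<le> c"
proof -
  have "bounded (e ` {p..q})"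
    by (intro compact_imp_bounded compact_continuous_image continuous_on_subset[OF e_cont]) auto
  then show ?thesis by (auto simp: bounded_iff)
qed

lemma J0e_int: "set_integrable lborel {p..q} (\<lambda>x. J0 x * e x)"
proof -
  have "set_integrable lborel {p..q} J0" by (rule set_integrable_ivl_AE_bounded[OF _ J0_bound]) simp
  then have "set_integrable lborel {p..q} (\<lambda>x. e x * J0 x)"
    by (rule set_integrable_continuous_mult[OF continuous_on_subset[OF e_cont], rotated]) simp
  then show ?thesis by (simp add: mult.commute)
qed

lemma Jte_rect: "integrable lborel (\<lambda>z. indicat_real ({p..q} \<times> {r..s}) z *\<^sub>R (Jt z * e (fst z)))"
proof -
  define m where "m = max \<bar>p\<bar> \<bar>q\<bar>"
  obtain c where c: "\<forall>x\<in>{p..q}. \<bar>e x\<bar> \<le> c" using e_bounded_ivl by blast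
  show ?thesis
  proof (rule Bochner_Integration.integrable_bound)
    show "integrable lborel (\<lambda>z. c * (indicat_real ({-m..m} \<times> UNIV) z *\<^sub>R Jt z))"
      using Jt_int[of m] unfolding set_integrable_def by (rule integrable_mult_right)
    show "(\<lambda>z. indicat_real ({p..q} \<times> {r..s}) z *\<^sub>R (Jt z * e (fst z))) \<in> borel_measurable lborel"
      by (rule borel_measurable_rect) auto
    show "AE z in lborel. norm (indicat_real ({p..q} \<times> {r..s}) z *\<^sub>R (Jt z * e (fst z)))
        \<le> norm (c * (indicat_real ({-m..m} \<times> UNIV) z *\<^sub>R Jt z))"
    proof (rule AE_I2)
      fix z :: "real \<times> real"
      show "norm (indicat_real ({p..q} \<times> {r..s}) z *\<^sub>R (Jt z * e (fst z)))
        \<le> norm (c * (indicat_real ({-m..m} \<times> UNIV) z *\<^sub>R Jt z))"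
      proof (cases "z \<in> {p..q} \<times> {r..s}")
        case True
        then have z: "fst z \<in> {p..q}" by auto
        then have "z \<in> {-m..m} \<times> UNIV" unfolding m_def by (auto simp: mem_Times_iff)
        moreover have "\<bar>e (fst z)\<bar> \<le> \<bar>c\<bar>" using c z by fastforce
        then have "\<bar>Jt z\<bar> * \<bar>e (fst z)\<bar> \<le> \<bar>Jt z\<bar> * \<bar>c\<bar>" by (intro mult_left_mono) auto
        ultimately show ?thesis using True by (simp add: abs_mult mult.commute)
      qed simp
    qed
  qed
qed

lemma Jte_swap: "(LINT s:{0..t}|lborel. LINT x:{p..q}|lborel. Jt (x, s) * e x)
    = (LINT x:{p..q}|lborel. (LINT s:{0..t}|lborel. Jt (x, s)) * e x)"
proof -
  let ?f = "\<lambda>z. indicat_real ({p..q} \<times> {0..t}) z *\<^sub>R (Jt z * e (fst z))"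
  have 1: "(LINT s:{0..t}|lborel. LINT x:{p..q}|lborel. Jt (x, s) * e x) = (LINT s|lborel. LINT x|lborel. ?f (x, s))"
    unfolding set_lebesgue_integral_def
  proof (rule Bochner_Integration.integral_cong[OF refl])
    fix s
    show "indicat_real {0..t} s *\<^sub>R (LINT x|lborel. indicat_real {p..q} x *\<^sub>R (Jt (x, s) * e x)) = (LINT x|lborel. ?f (x, s))"
      by (cases "s \<in> {0..t}") (auto intro!: Bochner_Integration.integral_cong simp: indicator_def)
  qed
  have 2: "(LINT x:{p..q}|lborel. (LINT s:{0..t}|lborel. Jt (x, s)) * e x) = (LINT x|lborel. LINT s|lborel. ?f (x, s))"
    unfolding set_lebesgue_integral_def
  proof (rule Bochner_Integration.integral_cong[OF refl])
    fix x
    have "(LINT s|lborel. ?f (x, s)) = (LINT s|lborel. (indicat_real {0..t} s *\<^sub>R Jt (x, s)) * (indicat_real {p..q} x * e x))"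
      by (intro Bochner_Integration.integral_cong refl) (auto simp: indicator_def)
    also have "\<dots> = (LINT s|lborel. indicat_real {0..t} s *\<^sub>R Jt (x, s)) * (indicat_real {p..q} x * e x)"
      by (rule integral_mult_left_zero)
    finally show "indicat_real {p..q} x *\<^sub>R ((LINT s|lborel. indicat_real {0..t} s *\<^sub>R Jt (x, s)) * e x) = (LINT s|lborel. ?f (x, s))"
      by simp
  qed
  show ?thesis unfolding 1 2 using lborel_Fubini(5,6)[OF Jte_rect] by metis
qed

text \<open>For almost every time \<open>J\<close> is \<open>J0\<close> plus the time integral of
  \<open>Jt\<close>. Exchanging the order of integration turns the definition of \<open>E\<close>
  into the oriented integral of \<open>J e\<close> from 0.\<close>

lemma E_space: "AE t in lborel. t \<in> {0<..<T} \<longrightarrow> primitive_on UNIV (\<lambda>y. E (y, t)) (\<lambda>y. J (y, t) * e y)"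
proof -
  have J1: "AE t in lborel. AE x in lborel. t \<in> {0<..<T} \<longrightarrow> J (x, t) = J0 x + (LINT s:{0..t}|lborel. Jt (x, s))"
    using AE_lborel_pairD2[OF J_eq] by (auto simp: strip_def elim!: eventually_mono)
  have J2: "AE t in lborel. AE x in lborel. t \<in> {0<..<T} \<longrightarrow> Jl \<le> J (x, t) \<and> J (x, t) \<le> Ju"
    using AE_lborel_pairD2[OF J_bounds] by (auto simp: strip_def elim!: eventually_mono)
  show ?thesis
    using J1 J2
  proof eventually_elim
    case (elim t)
    show ?case
    proof
      assume t: "t \<in> {0<..<T}"
      have "AE x in lborel. \<bar>J (x, t)\<bar> \<le> Ju"
        using elim(2) by eventually_elim (use t Jl in auto)
      then have "set_integrable lborel {p..q} (\<lambda>x. J (x, t))" for p q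
        by (intro set_integrable_ivl_AE_bounded) measurable
      then have "set_integrable lborel {p..q} (\<lambda>x. e x * J (x, t))" for p q
        by (rule set_integrable_continuous_mult[OF continuous_on_subset[OF e_cont], rotated]) simp
      then have Je: "set_integrable lborel {p..q} (\<lambda>x. J (x, t) * e x)" for p q by (simp add: mult.commute)
      have P: "primitive_on UNIV (signed_integral 0 (\<lambda>x. J (x, t) * e x)) (\<lambda>x. J (x, t) * e x)"
        by (rule primitive_on_signed_integral) (auto intro: Je)
      have piece: "(LINT x:{p..q}|lborel. J0 x * e x) + (LINT s:{0..t}|lborel. LINT x:{p..q}|lborel. Jt (x, s) * e x)
          = (LINT x:{p..q}|lborel. J (x, t) * e x)" for p q
      proof -
        have eq: "AE x in lborel. x \<in> {p..q} \<longrightarrow>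
            (LINT s:{0..t}|lborel. Jt (x, s)) * e x = J (x, t) * e x - J0 x * e x"
          using elim(1) by eventually_elim (use t in \<open>auto simp: algebra_simps\<close>)
        have m: "(\<lambda>x. LINT s:{0..t}|lborel. Jt (x, s)) \<in> borel_measurable borel"
          unfolding set_lebesgue_integral_def by measurable
        have "(LINT s:{0..t}|lborel. LINT x:{p..q}|lborel. Jt (x, s) * e x)
            = (LINT x:{p..q}|lborel. J (x, t) * e x - J0 x * e x)"
          unfolding Jte_swap
          by (rule set_lebesgue_integral_cong_AE[OF _ _ _ eq]) (use m in measurable)
        then show ?thesis using Je J0e_int by simp
      qed
      have "signed_integral 0 (\<lambda>x. J (x, t) * e x) y = E (y, t)" for y
      proof (cases "0 \<le> y")
        case True
        then show ?thesis
          unfolding E_def a_def using piece[of 0 y] by (simp add: signed_integral_ge)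
      next
        case False
        then have y: "y \<le> 0" by simp
        have "(LINT s:{0..t}|lborel. - (LINT x:{y..0}|lborel. Jt (x, s) * e x))
          = - (LINT s:{0..t}|lborel. LINT x:{y..0}|lborel. Jt (x, s) * e x)"
          unfolding set_lebesgue_integral_def by simp
        then show ?thesis
          unfolding E_def a_def using piece[of y 0] y by (simp add: signed_integral_le)
      qed
      then show "primitive_on UNIV (\<lambda>y. E (y, t)) (\<lambda>y. J (y, t) * e y)"
        by (intro primitive_on_cong[OF P])
    qed
  qed
qed

section \<open>Initial comparison and two-sided bounds of the subsolution\<close>

lemma w_0: "AE y in lborel. w (y, 0) \<le> \<theta>0 y"
  using e_bounds init
proof eventually_elim
  case (elim y)
  have "- E (y, 0) \<le> C + \<alpha> * ln (\<rho>0 y)" using elim unfolding E_0 by linarith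
  then have "exp (- E (y, 0)) \<le> exp C * \<rho>0 y powr \<alpha>"
    using \<rho>0_pos[of y] by (simp add: powr_def exp_add[symmetric])
  then have "w (y, 0) \<le> \<delta> * (exp C * \<rho>0 y powr \<alpha>)"
    unfolding w_def using \<delta>_pos by simp
  also have "\<dots> = c0 * \<rho>0 y powr \<alpha>" by (simp add: \<delta>_def exp_minus)
  finally show ?case using elim by simp
qed

text \<open>The exponent drifts by at most \<open>C1 * t\<close>, and \<open>C1 \<le> K\<close>, so
  \<open>exp (- K * t)\<close> outweighs the drift and the initial bound
  \<open>c0 * \<rho>0 powr \<alpha>\<close> persists for all times.\<close>

lemma w_le: "AE y in lborel. \<forall>t\<ge>0. w (y, t) \<le> W"
  using e_bounds \<rho>0_le
proof eventually_elim
  case (elim y)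
  show ?case
  proof (intro allI impI)
    fix t :: real assume t: "t \<ge> 0"
    have "C1 * t \<le> K * t" using K_ge(1) t by (rule mult_right_mono)
    then have "- K * t - E (y, t) \<le> C + \<alpha> * ln (\<rho>0 y)"
      using E_diff[OF t, of y] elim unfolding E_0 by linarith
    then have "exp (- K * t - E (y, t)) \<le> exp C * \<rho>0 y powr \<alpha>"
      using \<rho>0_pos[of y] by (simp add: powr_def exp_add[symmetric])
    also have "\<dots> \<le> exp C * \<rho>m powr \<alpha>"
      using elim(2) \<rho>0_pos[of y] \<alpha> by (intro mult_left_mono powr_mono2) auto
    finally have "w (y, t) \<le> \<delta> * (exp C * \<rho>m powr \<alpha>)"
      unfolding w_def using \<delta>_pos by simp
    also have "\<dots> = W" by (simp add: \<delta>_def W_def exp_minus)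
    finally show "w (y, t) \<le> W" .
  qed
qed

lemma w_ge: "\<exists>c>0. AE y in lborel. \<forall>t\<in>{0..T}. c * \<rho>0 y powr \<alpha> \<le> w (y, t)"
proof -
  \<comment> \<open>The losses up to time \<open>T\<close>: a factor \<open>exp (- C)\<close> from
    the initial profile, \<open>K * T\<close> in the exponent from the decay and
    \<open>C1 * T\<close> from the drift.\<close>
  define c where "c = \<delta> * exp (- C - (K + C1) * T)"
  have "AE y in lborel. \<forall>t\<in>{0..T}. c * \<rho>0 y powr \<alpha> \<le> w (y, t)"
    using e_bounds
  proof eventually_elim
    case (elim y)
    show ?case
    proof
      fix t assume t: "t \<in> {0..T}"
      have "(K + C1) * t \<le> (K + C1) * T" using K_ge(1) C1_nonneg t by (intro mult_left_mono) auto
      then have "- C - (K + C1) * T + \<alpha> * ln (\<rho>0 y) \<le> - K * t - E (y, t)"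
        using E_diff[of t y] t elim unfolding E_0 by (auto simp: algebra_simps)
      then have "exp (- C - (K + C1) * T + \<alpha> * ln (\<rho>0 y)) \<le> exp (- K * t - E (y, t))" by simp
      then have "exp (- C - (K + C1) * T) * \<rho>0 y powr \<alpha> \<le> exp (- K * t - E (y, t))"
        using \<rho>0_pos[of y] by (simp add: powr_def exp_add[symmetric])
      then show "c * \<rho>0 y powr \<alpha> \<le> w (y, t)"
        unfolding w_def c_def using \<delta>_pos by (simp add: mult.assoc)
    qed
  qed
  moreover have "c > 0" unfolding c_def using \<delta>_pos by simp
  ultimately show ?thesis by blast
qed

section \<open>Derivatives of the subsolution and its differential inequality\<close>

lemma primitive_on_exp:
  assumes "is_interval I" "primitive_on I u g"
  shows "primitive_on I (\<lambda>x. c * exp (u x)) (\<lambda>x. c * exp (u x) * g x)"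
  using primitive_on_cmult[OF primitive_on_chain[OF assms open_UNIV UNIV_I DERIV_exp
      continuous_on_exp[OF continuous_on_id]], of c]
  by (simp add: mult.assoc)

lemma w_time: "primitive_on {0..} (\<lambda>t. w (y, t)) (\<lambda>t. wt (y, t))"
proof -
  have id: "primitive_on {0..} (\<lambda>t. - K * t) (\<lambda>t. - K)"
    by (rule primitive_on_DERIV) (auto intro!: derivative_eq_intros simp: is_interval_ci)
  have "primitive_on {0..} (\<lambda>t. \<delta> * exp (- K * t - E (y, t))) (\<lambda>t. \<delta> * exp (- K * t - E (y, t)) * (- K - a (y, t)))"
    by (rule primitive_on_exp[OF _ primitive_on_diff[OF id E_time]]) (simp add: is_interval_ci)
  then show ?thesis
    by (rule primitive_on_cong2) (auto simp: w_def wt_def algebra_simps is_interval_ci)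
qed

text \<open>By the first part \<open>w_y / J = - e w\<close>. The flux is thus a product of
  functions absolutely continuous in space and can be differentiated once more by the product
  rule.\<close>

lemma w_space:
  assumes "primitive_on UNIV (\<lambda>y. E (y, t)) (\<lambda>y. J (y, t) * e y)"
  shows "primitive_on UNIV (\<lambda>y. w (y, t)) (\<lambda>y. - (w (y, t) * (J (y, t) * e y)))"
    and "primitive_on UNIV (\<lambda>y. - (e y * w (y, t))) (\<lambda>y. w (y, t) * (J (y, t) * (e y)\<^sup>2 - e' y))"
proof -
  have "primitive_on UNIV (\<lambda>y. \<delta> * exp (- K * t - E (y, t))) (\<lambda>y. \<delta> * exp (- K * t - E (y, t)) * (0 - J (y, t) * e y))"
    by (rule primitive_on_exp[OF _ primitive_on_diff[OF primitive_on_const assms]]) simp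
  then show 1: "primitive_on UNIV (\<lambda>y. w (y, t)) (\<lambda>y. - (w (y, t) * (J (y, t) * e y)))"
    by (simp add: w_def)
  have "primitive_on UNIV (\<lambda>y. - (e y * w (y, t)))
     (\<lambda>y. - (e y * - (w (y, t) * (J (y, t) * e y)) + e' y * w (y, t)))"
    by (intro primitive_on_minus primitive_on_mult e_prim 1) simp
  then show "primitive_on UNIV (\<lambda>y. - (e y * w (y, t))) (\<lambda>y. w (y, t) * (J (y, t) * (e y)\<^sup>2 - e' y))"
    by (rule primitive_on_cong2) (auto simp: algebra_simps power2_eq_square)
qed

text \<open>Once the nonnegative term \<open>J e^2\<close> is dropped, everything is a multiple of
  \<open>\<rho>0 w\<close>: the bound on \<open>e'\<close> contributes \<open>\<kappa> C\<close>,
  and \<open>\<rho>0 \<le> \<rho>m\<close>, \<open>w \<le> W\<close>, \<open>J \<ge> Jl\<close>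
  linearise the sink to \<open>b \<rho>m W / Jl\<close>. These two sum exactly to
  \<open>cv (K - C1)\<close>, which is at most \<open>cv (K + a)\<close>.\<close>

lemma subsolution: "AE z in lborel. z \<in> strip T \<longrightarrow>
   cv * \<rho>0 (fst z) * wt z \<le> \<kappa> * (w z * (J z * (e (fst z))\<^sup>2 - e' (fst z))) - b * (\<rho>0 (fst z))\<^sup>2 * (w z)\<^sup>2 / J z"
  using J_bounds AE_lborel_fst[OF e_bounds] AE_lborel_fst[OF \<rho>0_le] AE_lborel_fst[OF w_le] AE_lborel_snd[OF a_bound]
proof eventually_elim
  case (elim z)
  show ?case
  proof
    assume z: "z \<in> strip T"
    obtain y t where yt: "z = (y, t)" by (cases z)
    have t: "0 < t" "t < T" using z yt by (auto simp: strip_def)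
    define r where "r = \<rho>0 y"
    have r: "0 < r" "r \<le> \<rho>m" using \<rho>0_pos elim(3) by (auto simp: r_def yt)
    have wW: "w z \<le> W" "0 < w z" using elim(4) t w_pos by (auto simp: yt)
    have Jz: "Jl \<le> J z" "0 < J z" using elim(1) z Jl by auto
    have az: "- C1 \<le> a z" using elim(5) by (auto simp: yt abs_le_iff dest: spec[of _ y])
    have rw: "0 < r * w z" using r wW by simp
    have A: "cv * r * wt z \<le> - (r * w z * (\<kappa> * C + b * \<rho>m * W / Jl))"
    proof -
      have "(r * w z) * (cv * (K - C1)) \<le> (r * w z) * (cv * (K + a z))"
        using az rw cv by (intro mult_left_mono) auto
      then show ?thesis unfolding K_ge(2) wt_def by (simp add: algebra_simps)
    qed
    have B: "- (r * w z * (\<kappa> * C)) \<le> \<kappa> * (w z * (J z * (e y)\<^sup>2 - e' y))"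
    proof -
      have "e' y \<le> C * r" using elim(2) by (auto simp: yt r_def)
      moreover have "0 \<le> J z * (e y)\<^sup>2" using Jz by simp
      ultimately have "- (C * r) \<le> J z * (e y)\<^sup>2 - e' y" by linarith
      then have "(\<kappa> * w z) * (- (C * r)) \<le> (\<kappa> * w z) * (J z * (e y)\<^sup>2 - e' y)"
        using \<kappa> wW by (intro mult_left_mono) auto
      then show ?thesis by (simp add: algebra_simps)
    qed
    have D: "b * r\<^sup>2 * (w z)\<^sup>2 / J z \<le> r * w z * (b * \<rho>m * W / Jl)"
    proof -
      have "(r * w z) * (b * (r * w z)) / J z \<le> (r * w z) * (b * (\<rho>m * W)) / Jl"
        using r wW Jz Jl b rw by (intro frac_le mult_mono mult_nonneg_nonneg) auto
      then show ?thesis by (simp add: power2_eq_square algebra_simps)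
    qed
    show "cv * \<rho>0 (fst z) * wt z \<le> \<kappa> * (w z * (J z * (e (fst z))\<^sup>2 - e' (fst z))) - b * (\<rho>0 (fst z))\<^sup>2 * (w z)\<^sup>2 / J z"
      using A B D unfolding yt fst_conv r_def by (simp add: algebra_simps)
  qed
qed

end

section \<open>The comparison principle\<close>

text \<open>The exponent \<open>Suc k\<close> is at least 2, so the power of the positive part is
  differentiable at 0 as well; \<open>k \<ge> 1\<close> excludes the value \<open>0 ^ 0 = 1\<close>
  in the derivative.\<close>

lemma DERIV_pos_part_power:
  fixes s :: real
  assumes k: "k \<ge> 1"
  shows "((\<lambda>s. max 0 s ^ Suc k) has_real_derivative real (Suc k) * max 0 s ^ k) (at s)"
proof -
  have k0: "(0::real) ^ k = 0" using k by simp
  consider "s < 0" | "s = 0" | "s > 0" by linarith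
  then show ?thesis
  proof cases
    case 1
    have "((\<lambda>s. 0) has_real_derivative 0) (at s)" by simp
    then have "((\<lambda>s. max 0 s ^ Suc k) has_real_derivative 0) (at s)"
      by (rule has_field_derivative_transform_within_open[of _ _ _ "{..<0}"]) (use 1 in auto)
    then show ?thesis using 1 by (simp add: k0)
  next
    case 2
    have "((\<lambda>h. max 0 h ^ k) \<longlongrightarrow> max 0 0 ^ k) (at (0::real))"
      by (intro tendsto_intros)
    then have "((\<lambda>h. max 0 h ^ k) \<longlongrightarrow> 0) (at (0::real))" by (simp only: max.idem k0)
    then have "((\<lambda>h. (max 0 (0 + h) ^ Suc k - max 0 0 ^ Suc k) / h) \<longlongrightarrow> 0) (at (0::real))"
      by (rule Lim_transform_eventually) (use k in \<open>auto simp: eventually_at_filter max_def\<close>)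
    then have "((\<lambda>s. max 0 s ^ Suc k) has_real_derivative 0) (at (0::real))" by (simp only: DERIV_def)
    then show ?thesis using 2 by (simp add: k0)
  next
    case 3
    have "((\<lambda>s. s ^ Suc k) has_real_derivative real (Suc k) * s ^ k) (at s)"
      using DERIV_pow[of "Suc k" s] by simp
    then have "((\<lambda>s. max 0 s ^ Suc k) has_real_derivative real (Suc k) * s ^ k) (at s)"
      by (rule has_field_derivative_transform_within_open[of _ _ _ "{0<..}"]) (use 3 in auto)
    then show ?thesis using 3 by simp
  qed
qed

lemma primitive_on_pos_part_power:
  assumes "is_interval I" "primitive_on I u g" "k \<ge> 1"
  shows "primitive_on I (\<lambda>x. max 0 (u x) ^ Suc k) (\<lambda>x. (real (Suc k) * max 0 (u x) ^ k) * g x)"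
proof (rule primitive_on_chain[OF assms(1,2) open_UNIV UNIV_I DERIV_pos_part_power[OF assms(3)]])
  show "continuous_on UNIV (\<lambda>r::real. real (Suc k) * max 0 r ^ k)"
    by (intro continuous_on_mult continuous_on_power continuous_on_max continuous_on_const continuous_on_id)
qed

context heat_supersolution
begin

text \<open>The representative of \<open>\<theta>\<close> with a value at every time, including the
  initial one; for almost every \<open>y\<close> it is absolutely continuous in time. The function
  \<open>\<theta>\<close> is determined only almost everywhere.\<close>

definition th :: "real \<times> real \<Rightarrow> real" where
  "th z = \<theta>0 (fst z) + (LINT s:{0..snd z}|lborel. \<theta>t (fst z, s))"

definition pp :: "real \<times> real \<Rightarrow> real" where
  "pp z = max 0 (w z - th z)"

text \<open>It vanishes at the endpoints of \<open>{-N..N}\<close> and, being a square, has there a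
  derivative of size at most \<open>4 / N\<close> times its square root, which is what completing
  the square requires. It does not vanish outside \<open>{-N..N}\<close>, so integrals are
  restricted to this interval.\<close>

definition cutoff :: "real \<Rightarrow> real \<Rightarrow> real" where
  "cutoff N y = (1 - y\<^sup>2 / N\<^sup>2)\<^sup>2"

lemma th_meas [measurable]: "th \<in> borel_measurable borel"
proof -
  have eq: "th = (\<lambda>z. \<theta>0 (fst z) + (LINT s|lborel. (if 0 \<le> s \<and> s \<le> snd z then \<theta>t (fst z, s) else 0)))"
    unfolding th_def set_lebesgue_integral_def
    by (intro ext arg_cong2[where f = "(+)"] refl Bochner_Integration.integral_cong) (auto simp: indicator_def)
  show ?thesis unfolding eq by measurable
qed

lemma pp_meas [measurable]: "pp \<in> borel_measurable borel"
  unfolding pp_def by measurable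

lemma cutoff_meas [measurable]: "cutoff N \<in> borel_measurable borel"
  unfolding cutoff_def by measurable

lemma pp_nonneg: "0 \<le> pp z" by (simp add: pp_def)

lemma cutoff_bounds:
  assumes "N > 0" "y \<in> {-N..N}"
  shows "0 \<le> 1 - y\<^sup>2 / N\<^sup>2" "0 \<le> cutoff N y" "cutoff N y \<le> 1"
proof -
  have "y\<^sup>2 \<le> N\<^sup>2" using assms by (intro abs_le_square_iff[THEN iffD1]) auto
  then have q: "0 \<le> y\<^sup>2 / N\<^sup>2" "y\<^sup>2 / N\<^sup>2 \<le> 1" using assms(1) by (auto simp: field_simps)
  then show "0 \<le> 1 - y\<^sup>2 / N\<^sup>2" by simp
  then show "0 \<le> cutoff N y" "cutoff N y \<le> 1" unfolding cutoff_def using q by (auto intro: power_le_one)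
qed

lemma th_time: "AE y in lborel. primitive_on {0..} (\<lambda>t. th (y, t)) (\<lambda>s. \<theta>t (y, s))"
  using AE_integrable_time_slice[OF \<theta>t_int]
proof eventually_elim
  case (elim y)
  have i: "set_integrable lborel {p..q} (\<lambda>s. \<theta>t (y, s))" for p q
    unfolding set_integrable_def by (rule integrable_mult_indicator) (use elim in auto)
  have "primitive_on {0..} (signed_integral 0 (\<lambda>s. \<theta>t (y, s))) (\<lambda>s. \<theta>t (y, s))"
    by (rule primitive_on_signed_integral) (auto intro: i)
  from primitive_on_add[OF primitive_on_const this, of "\<theta>0 y"]
  have "primitive_on {0..} (\<lambda>t. \<theta>0 y + signed_integral 0 (\<lambda>s. \<theta>t (y, s)) t) (\<lambda>s. \<theta>t (y, s))" by simp
  then show ?case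
    by (rule primitive_on_cong) (simp add: th_def signed_integral_ge)
qed

lemma th_eq: "AE z in lborel. z \<in> strip T \<longrightarrow> th z = \<theta> z"
  using \<theta>_eq by eventually_elim (auto simp: th_def)

text \<open>One third of the time derivative of
  \<open>cv * \<rho>0 * cutoff N * pp^3\<close>.\<close>

definition integrand :: "real \<Rightarrow> real \<times> real \<Rightarrow> real" where
  "integrand N z = cv * \<rho>0 (fst z) * cutoff N (fst z) * (pp z)\<^sup>2 * (wt z - \<theta>t z)"

lemma integrand_meas [measurable]: "integrand N \<in> borel_measurable borel"
  unfolding integrand_def by measurable

text \<open>The time slice of the comparison estimate: the equation for \<open>w - \<theta>\<close> is tested with
  \<open>cutoff N * pp\<^sup>2\<close> and integrated by parts in space.\<close>

lemma space_estimate: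
  assumes N: "N > 0"
  shows "AE t in lborel. t \<in> {0<..<T} \<longrightarrow> set_integrable lborel {-N..N} (\<lambda>y. integrand N (y, t)) \<longrightarrow>
    (LINT y:{-N..N}|lborel. integrand N (y, t)) \<le> \<kappa> * (4 * W ^ 3 / (N * Jl))"
  using E_space \<theta>_slice flux_slice AE_lborel_pairD2[OF J_bounds] AE_lborel_pairD2[OF th_eq]
    AE_lborel_pairD2[OF subsolution] AE_lborel_pairD2[OF super] AE_lborel_pairD2[OF \<theta>_nonneg]
proof eventually_elim
  case (elim t)
  show ?case
  proof (intro impI)
    assume t: "t \<in> {0<..<T}" and ii: "set_integrable lborel {-N..N} (\<lambda>y. integrand N (y, t))"
    have strip: "(y, t) \<in> strip T" for y using t by (auto simp: strip_def)
    obtain u where u: "primitive_on UNIV u (\<lambda>y. \<theta>y (y, t))" "AE y in lborel. \<theta> (y, t) = u y"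
      using elim(2) t by blast
    obtain q where q: "primitive_on UNIV q (\<lambda>y. Qy (y, t))" "AE y in lborel. \<theta>y (y, t) / J (y, t) = q y"
      using elim(3) t by blast
    note ws = w_space[OF elim(1)[rule_format, OF t]]
    have int: "is_interval {-N..N}" by (rule is_interval_cc)
    define P where "P y = w (y, t) - u y" for y
    define P' where "P' y = - (w (y, t) * (J (y, t) * e y)) - \<theta>y (y, t)" for y
    have PP: "primitive_on {-N..N} P P'"
      unfolding P_def P'_def by (rule primitive_on_subset[OF primitive_on_diff[OF ws(1) u(1)]]) simp
    define \<eta>' where "\<eta>' y = 2 * (1 - y\<^sup>2 / N\<^sup>2) * (- (2 * y / N\<^sup>2))" for y
    have \<eta>: "primitive_on {-N..N} (cutoff N) \<eta>'"
    proof (rule primitive_on_DERIV[OF int])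
      fix y
      show "(cutoff N has_real_derivative \<eta>' y) (at y within {-N..N})"
      proof -
        define c where "c = 1 / N\<^sup>2"
        have d: "((\<lambda>y. 1 - y\<^sup>2 * c) has_real_derivative - (2 * y * c)) (at y within {-N..N})"
          by (auto intro!: derivative_eq_intros)
        have "((\<lambda>y. (1 - y\<^sup>2 * c)\<^sup>2) has_real_derivative 2 * (1 - y\<^sup>2 * c) * (- (2 * y * c))) (at y within {-N..N})"
          by (rule DERIV_cong[OF DERIV_power[OF d, of 2]]) (simp add: algebra_simps)
        moreover have "cutoff N = (\<lambda>y. (1 - y\<^sup>2 * c)\<^sup>2)" "\<eta>' y = 2 * (1 - y\<^sup>2 * c) * (- (2 * y * c))"
          by (simp_all add: cutoff_def[abs_def] \<eta>'_def c_def)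
        ultimately show ?thesis by simp
      qed
      show "continuous_on {-N..N} \<eta>'"
        unfolding \<eta>'_def using N by (intro continuous_intros) auto
    qed
    have sq: "primitive_on {-N..N} (\<lambda>y. max 0 (P y) ^ 2) (\<lambda>y. (2 * max 0 (P y)) * P' y)"
      using primitive_on_pos_part_power[OF int PP, of 1] by (simp add: numeral_2_eq_2)
    define U where "U y = cutoff N y * max 0 (P y) ^ 2" for y
    define U' where "U' y = cutoff N y * ((2 * max 0 (P y)) * P' y) + \<eta>' y * max 0 (P y) ^ 2" for y
    have UP: "primitive_on {-N..N} U U'"
      unfolding U_def U'_def by (rule primitive_on_mult[OF int \<eta> sq])
    define F where "F y = - (e y * w (y, t)) - q y" for y
    define g where "g y = w (y, t) * (J (y, t) * (e y)\<^sup>2 - e' y) - Qy (y, t)" for y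
    have FP: "primitive_on {-N..N} F g"
      unfolding F_def g_def by (rule primitive_on_subset[OF primitive_on_diff[OF ws(2) q(1)]]) simp
    have UF: "primitive_on {-N..N} (\<lambda>y. U y * F y) (\<lambda>y. U y * g y + U' y * F y)"
      by (rule primitive_on_mult[OF int UP FP])
    have ends: "-N \<in> {-N..N}" "N \<in> {-N..N}" "-N \<le> N" using N by auto
    \<comment> \<open>The cutoff removes the boundary terms; the flux difference \<open>F\<close> is
      not controlled at the endpoints.\<close>
    have "U N = 0" "U (-N) = 0" using N by (auto simp: U_def cutoff_def)
    then have tot: "set_integrable lborel {-N..N} (\<lambda>y. U y * g y + U' y * F y)"
      "(LINT y:{-N..N}|lborel. U y * g y + U' y * F y) = 0"
      using primitive_onD[OF UF ends] by auto
    have Uc: "continuous_on {-N..N} U" by (rule primitive_on_continuous_ivl[OF UP ends(1)]) simp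
    have Ug: "set_integrable lborel {-N..N} (\<lambda>y. U y * g y)"
      by (rule set_integrable_continuous_mult[OF Uc primitive_onD(1)[OF FP ends]])
    have U'F: "set_integrable lborel {-N..N} (\<lambda>y. (U y * g y + U' y * F y) - U y * g y)"
      by (rule set_integral_diff(1)[OF tot(1) Ug])
    then have U'F: "set_integrable lborel {-N..N} (\<lambda>y. U' y * F y)" by simp
    have U'Fm: "set_integrable lborel {-N..N} (\<lambda>y. - (U' y * F y))"
      using set_integrable_mult_right[of "-1" lborel "{-N..N}" "\<lambda>y. U' y * F y"] U'F by simp
    \<comment> \<open>Almost everywhere \<open>F\<close> equals \<open>P' / J\<close>, so
      \<open>U' F\<close> is a nonnegative quadratic term in \<open>P'\<close> plus a cross term
      from the cutoff. Completing the square leaves a bound that is free of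
      \<open>P'\<close>.\<close>
    have bnd: "AE y in lborel. y \<in> {-N..N} \<longrightarrow> - (U' y * F y) \<le> 2 * W ^ 3 / (N\<^sup>2 * Jl)"
      using u(2) q(2) elim(4) elim(8) w_le
    proof eventually_elim
      case (elim y)
      show ?case
      proof
        assume y: "y \<in> {-N..N}"
        define m where "m = 1 - y\<^sup>2 / N\<^sup>2"
        define p where "p = max 0 (P y)"
        have Jy: "Jl \<le> J (y, t)" "0 < J (y, t)" using elim(3) strip Jl by auto
        have wW: "w (y, t) \<le> W" using elim(5) t by auto
        \<comment> \<open>As \<open>\<theta>\<close> is nonnegative, the positive part of
          \<open>w - \<theta>\<close> inherits the upper bound of \<open>w\<close>.\<close>
        have p: "0 \<le> p" "p \<le> W" using elim(1,4) strip wW W_pos by (auto simp: p_def P_def)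
        have FJ: "F y = P' y / J (y, t)"
          unfolding F_def P'_def elim(2)[symmetric] using Jy by (simp add: field_simps)
        have "- (2 * W ^ 3 / N\<^sup>2) \<le> U' y * P' y"
        proof -
          have "U' y * P' y = 2 * p * ((m * P' y)\<^sup>2 - 2 * (y / N\<^sup>2) * p * (m * P' y))"
            unfolding U'_def cutoff_def \<eta>'_def m_def[symmetric] p_def[symmetric]
            by (simp add: power2_eq_square algebra_simps)
          moreover have "0 \<le> (m * P' y - (y / N\<^sup>2) * p)\<^sup>2" by simp
          then have "- ((y / N\<^sup>2) * p)\<^sup>2 \<le> (m * P' y)\<^sup>2 - 2 * (y / N\<^sup>2) * p * (m * P' y)"
            by (simp add: power2_diff algebra_simps)
          then have "2 * p * (- ((y / N\<^sup>2) * p)\<^sup>2) \<le> 2 * p * ((m * P' y)\<^sup>2 - 2 * (y / N\<^sup>2) * p * (m * P' y))"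
            using p(1) by (intro mult_left_mono) auto
          moreover have "2 * p * ((y / N\<^sup>2) * p)\<^sup>2 \<le> 2 * W ^ 3 / N\<^sup>2"
          proof -
            have "(y / N\<^sup>2)\<^sup>2 \<le> 1 / N\<^sup>2"
            proof -
              have "\<bar>y / N\<^sup>2\<bar> \<le> 1 / N" using y N by (auto simp: power2_eq_square field_simps abs_le_iff)
              then have "\<bar>y / N\<^sup>2\<bar>\<^sup>2 \<le> (1 / N)\<^sup>2" by (intro power_mono) auto
              then show ?thesis by (simp add: power_divide)
            qed
            moreover have "p ^ 3 \<le> W ^ 3" using p by (intro power_mono) auto
            ultimately have "2 * (p ^ 3 * (y / N\<^sup>2)\<^sup>2) \<le> 2 * (W ^ 3 * (1 / N\<^sup>2))"
              using p W_pos by (intro mult_left_mono mult_mono) auto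
            then show ?thesis by (simp add: power_mult_distrib power2_eq_square power3_eq_cube mult_ac)
          qed
          ultimately show ?thesis by linarith
        qed
        then have "- (U' y * P' y) / J (y, t) \<le> (2 * W ^ 3 / N\<^sup>2) / J (y, t)"
          using Jy by (intro divide_right_mono) auto
        also have "\<dots> \<le> (2 * W ^ 3 / N\<^sup>2) / Jl"
          using Jy Jl W_pos by (intro divide_left_mono) auto
        finally show "- (U' y * F y) \<le> 2 * W ^ 3 / (N\<^sup>2 * Jl)" by (simp add: FJ)
      qed
    qed
    have "(LINT y:{-N..N}|lborel. U y * g y) = (LINT y:{-N..N}|lborel. - (U' y * F y))"
      using tot(2) Ug U'F set_integral_uminus[OF U'F] by simp
    \<comment> \<open>The integrand is of order \<open>1 / N^2\<close> and the interval has length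
      \<open>2 N\<close>, which leaves a quantity of order \<open>1 / N\<close>.\<close>
    also have "\<dots> \<le> (LINT y:{-N..N}|lborel. 2 * W ^ 3 / (N\<^sup>2 * Jl))"
      by (rule set_integral_mono_AE[OF U'Fm set_integrable_continuous_ivl bnd]) simp
    also have "\<dots> = 4 * W ^ 3 / (N * Jl)"
      using N Jl by (simp add: set_integral_ivl_const power2_eq_square field_simps)
    finally have Ugb: "(LINT y:{-N..N}|lborel. U y * g y) \<le> 4 * W ^ 3 / (N * Jl)" .
    have cmp: "AE y in lborel. y \<in> {-N..N} \<longrightarrow> integrand N (y, t) \<le> \<kappa> * (U y * g y)"
      using u(2) elim(4,5,6,7,8)
    proof eventually_elim
      case (elim y)
      show ?case
      proof
        assume y: "y \<in> {-N..N}"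
        have thu: "th (y, t) = u y" "\<theta> (y, t) = u y" using elim(1,3) strip by auto
        have ppP: "pp (y, t) = max 0 (P y)" by (simp add: pp_def thu P_def)
        show "integrand N (y, t) \<le> \<kappa> * (U y * g y)"
        proof (cases "P y > 0")
          case False
          then show ?thesis by (simp add: integrand_def ppP U_def)
        next
          \<comment> \<open>Where \<open>w > \<theta>\<close> and \<open>\<theta> \<ge> 0\<close>,
            the sink of \<open>w\<close> dominates that of \<open>\<theta>\<close>, so the sinks
            enter the difference with the favourable sign.\<close>
          case True
          have Jy: "0 < J (y, t)" using elim(2) strip Jl by (meson less_le_trans)
          have uw: "0 \<le> u y" "u y < w (y, t)" using elim(6) strip thu True by (auto simp: P_def)
          have "cv * \<rho>0 y * wt (y, t) \<le> \<kappa> * (w (y, t) * (J (y, t) * (e y)\<^sup>2 - e' y)) - b * (\<rho>0 y)\<^sup>2 * (w (y, t))\<^sup>2 / J (y, t)"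
            using elim(4) strip by auto
          moreover have "\<kappa> * Qy (y, t) - b * (\<rho>0 y)\<^sup>2 * (u y)\<^sup>2 / J (y, t) \<le> cv * \<rho>0 y * \<theta>t (y, t)"
            using elim(5) strip thu by auto
          moreover have "b * (\<rho>0 y)\<^sup>2 * (u y)\<^sup>2 / J (y, t) \<le> b * (\<rho>0 y)\<^sup>2 * (w (y, t))\<^sup>2 / J (y, t)"
            using Jy uw b by (intro divide_right_mono mult_left_mono power_mono) auto
          ultimately have "cv * \<rho>0 y * (wt (y, t) - \<theta>t (y, t)) \<le> \<kappa> * g y"
            by (simp add: g_def algebra_simps)
          moreover have "0 \<le> U y" unfolding U_def using cutoff_bounds(2)[OF N y] by simp
          ultimately have "U y * (cv * \<rho>0 y * (wt (y, t) - \<theta>t (y, t))) \<le> U y * (\<kappa> * g y)"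
            by (rule mult_left_mono)
          then show ?thesis by (simp add: integrand_def ppP U_def mult_ac)
        qed
      qed
    qed
    have "(LINT y:{-N..N}|lborel. integrand N (y, t)) \<le> (LINT y:{-N..N}|lborel. \<kappa> * (U y * g y))"
      by (rule set_integral_mono_AE[OF ii _ cmp]) (use Ug in simp)
    also have "\<dots> = \<kappa> * (LINT y:{-N..N}|lborel. U y * g y)" by simp
    also have "\<dots> \<le> \<kappa> * (4 * W ^ 3 / (N * Jl))" using Ugb \<kappa> by (intro mult_left_mono) auto
    finally show "(LINT y:{-N..N}|lborel. integrand N (y, t)) \<le> \<kappa> * (4 * W ^ 3 / (N * Jl))" .
  qed
qed

text \<open>Justifies Fubini on the rectangle. The prefactor is at most
  \<open>cv * \<rho>m * W^2\<close>, and the difference of time derivatives is bounded by a constant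
  plus \<open>\<bar>\<theta>t\<bar>\<close>, which is integrable down to time 0.\<close>

lemma integrand_integrable:
  assumes N: "N > 0" and \<tau>: "0 < \<tau>" "\<tau> < T"
  shows "integrable lborel (\<lambda>z. indicat_real ({-N..N} \<times> {0..\<tau>}) z *\<^sub>R integrand N z)"
proof -
  let ?R = "{-N..N} \<times> {0..\<tau>}"
  define c where "c = cv * \<rho>m * W\<^sup>2"
  have c: "c \<ge> 0" unfolding c_def using cv \<rho>m by simp
  have Rb: "?R \<in> sets borel" by (intro borel_Times) auto
  have "emeasure lborel ?R = emeasure lborel (cbox (-N, 0) (N, \<tau>))" by (simp add: cbox_Pair_eq)
  also have "\<dots> < \<infinity>" using emeasure_lborel_cbox_finite by blast
  finally have "integrable lborel (indicat_real ?R)" using Rb by (intro integrable_real_indicator) auto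
  then have i: "integrable lborel (\<lambda>z. c * (W * (K + C1)) * indicat_real ?R z + c * \<bar>indicat_real ({-N..N} \<times> UNIV) z *\<^sub>R \<theta>t z\<bar>)"
    using \<theta>t_int[of N] unfolding set_integrable_def by (intro Bochner_Integration.integrable_add integrable_mult_right integrable_abs)
  show ?thesis
  proof (rule Bochner_Integration.integrable_bound[OF i])
    show "(\<lambda>z. indicat_real ?R z *\<^sub>R integrand N z) \<in> borel_measurable lborel"
      by (rule borel_measurable_rect) auto
    have "AE z::real \<times> real in lborel. snd z \<noteq> 0" by (rule AE_lborel_snd[OF AE_lborel_singleton])
    then show "AE z in lborel. norm (indicat_real ?R z *\<^sub>R integrand N z)
       \<le> norm (c * (W * (K + C1)) * indicat_real ?R z + c * \<bar>indicat_real ({-N..N} \<times> UNIV) z *\<^sub>R \<theta>t z\<bar>)"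
      using th_eq \<theta>_nonneg AE_lborel_fst[OF \<rho>0_le] AE_lborel_fst[OF w_le] AE_lborel_snd[OF a_bound]
    proof eventually_elim
      case (elim z)
      show ?case
      proof (cases "z \<in> ?R")
        case True
        obtain y t where z: "z = (y, t)" by (cases z)
        have yt: "y \<in> {-N..N}" "0 < t" "t < T" using True elim(1) \<tau> by (auto simp: z)
        have st: "z \<in> strip T" using yt by (auto simp: z strip_def)
        have ww: "0 < w z" "w z \<le> W" using w_pos elim(5) yt by (auto simp: z)
        have pW: "0 \<le> pp z" "pp z \<le> W" using elim(2,3) st ww W_pos by (auto simp: pp_def)
        have "\<bar>cv * \<rho>0 y * cutoff N y * (pp z)\<^sup>2\<bar> = cv * \<rho>0 y * cutoff N y * (pp z)\<^sup>2"
          using cv \<rho>0_pos[of y] cutoff_bounds(2)[OF N yt(1)] by (intro abs_of_nonneg mult_nonneg_nonneg) auto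
        also have "\<dots> \<le> cv * \<rho>m * 1 * W\<^sup>2"
          using cv \<rho>0_pos[of y] elim(4) cutoff_bounds[OF N yt(1)] pW \<rho>m
          by (intro mult_mono power_mono mult_nonneg_nonneg) (auto simp: z)
        finally have 1: "\<bar>cv * \<rho>0 y * cutoff N y * (pp z)\<^sup>2\<bar> \<le> c" by (simp add: c_def)
        have K0: "0 \<le> K" using K_ge(1) C1_nonneg by linarith
        have "\<bar>K + a z\<bar> \<le> K + C1" using elim(6) K0 by (auto simp: z dest!: spec[of _ y])
        then have "w z * \<bar>K + a z\<bar> \<le> W * (K + C1)" using ww by (intro mult_mono) auto
        then have "\<bar>wt z\<bar> \<le> W * (K + C1)" unfolding wt_def using ww by (simp add: abs_mult)
        then have 2: "\<bar>wt z - \<theta>t z\<bar> \<le> W * (K + C1) + \<bar>\<theta>t z\<bar>" by linarith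
        have "\<bar>integrand N z\<bar> \<le> c * (W * (K + C1) + \<bar>\<theta>t z\<bar>)"
          unfolding integrand_def z fst_conv abs_mult[of _ "wt (y, t) - \<theta>t (y, t)"]
          using 1 2 c by (intro mult_mono) (auto simp: z)
        moreover have "z \<in> {-N..N} \<times> UNIV" using yt z by auto
        moreover have "0 \<le> c * (W * (K + C1) + \<bar>\<theta>t z\<bar>)"
          using c W_pos K0 C1_nonneg by (intro mult_nonneg_nonneg add_nonneg_nonneg) auto
        ultimately show ?thesis using True by (simp add: algebra_simps)
      qed simp
    qed
  qed
qed

definition C4 :: real where "C4 = 3 * (T * (\<kappa> * (4 * W ^ 3 / Jl))) / cv"

text \<open>Fubini in both orders over \<open>{-N..N} \<times> {0..\<tau>}\<close>. With space
  innermost, \<open>space_estimate\<close> bounds the integral by a multiple of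
  \<open>1 / N\<close>; with time innermost, it is \<open>cv / 3\<close> times the cubic energy at
  time \<open>\<tau>\<close>, since \<open>pp\<close> vanishes at time 0 for almost every
  \<open>y\<close>.\<close>

lemma cutoff_estimate:
  assumes N: "N > 0" and \<tau>: "0 < \<tau>" "\<tau> < T"
  shows "set_integrable lborel {-N..N} (\<lambda>y. \<rho>0 y * cutoff N y * pp (y, \<tau>) ^ 3)"
    and "(LINT y:{-N..N}|lborel. \<rho>0 y * cutoff N y * pp (y, \<tau>) ^ 3) \<le> C4 / N"
proof -
  let ?f = "\<lambda>z. indicat_real ({-N..N} \<times> {0..\<tau>}) z *\<^sub>R integrand N z"
  have fi: "integrable lborel ?f" by (rule integrand_integrable[OF N \<tau>])
  define k where "k = \<kappa> * (4 * W ^ 3 / (N * Jl))"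
  have k: "k \<ge> 0" unfolding k_def using \<kappa> W_pos N Jl by simp
  have eqt: "(LINT y|lborel. ?f (y, t)) = indicat_real {0..\<tau>} t * (LINT y:{-N..N}|lborel. integrand N (y, t))" for t
    unfolding set_lebesgue_integral_def
    by (cases "t \<in> {0..\<tau>}") (auto intro!: Bochner_Integration.integral_cong simp: indicator_def)
  have up: "(LINT z|lborel. ?f z) \<le> T * k"
  proof -
    have "(LINT z|lborel. ?f z) = (LINT t|lborel. LINT y|lborel. ?f (y, t))" by (rule lborel_Fubini(6)[OF fi])
    also have "\<dots> \<le> (LINT t|lborel. indicat_real {0..\<tau>} t *\<^sub>R k)"
    proof (rule integral_mono_AE[OF lborel_Fubini(4)[OF fi]])
      show "integrable lborel (\<lambda>t. indicat_real {0..\<tau>} t *\<^sub>R k)"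
        using set_integrable_continuous_ivl[of "\<lambda>t. k" 0 \<tau>] unfolding set_integrable_def by simp
      show "AE t in lborel. (LINT y|lborel. ?f (y, t)) \<le> indicat_real {0..\<tau>} t *\<^sub>R k"
        using space_estimate[OF N] lborel_Fubini(2)[OF fi] AE_lborel_singleton[of 0]
      proof eventually_elim
        case (elim t)
        show ?case
        proof (cases "t \<in> {0..\<tau>}")
          case True
          then have t: "t \<in> {0<..<T}" using elim(3) \<tau> by auto
          have "(\<lambda>y. ?f (y, t)) = (\<lambda>y. indicat_real {-N..N} y *\<^sub>R integrand N (y, t))"
            using True by (auto simp: indicator_def)
          then have "set_integrable lborel {-N..N} (\<lambda>y. integrand N (y, t))"
            using elim(2) unfolding set_integrable_def by simp
          then have "(LINT y:{-N..N}|lborel. integrand N (y, t)) \<le> k"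
            using elim(1) t by (auto simp: k_def)
          then show ?thesis unfolding eqt using True by simp
        next
          case False
          then show ?thesis unfolding eqt by simp
        qed
      qed
    qed
    also have "\<dots> = \<tau> * k" using set_integral_ivl_const[of 0 \<tau> k] \<tau> unfolding set_lebesgue_integral_def by (simp add: mult.commute)
    also have "\<dots> \<le> T * k" using \<tau> k by (intro mult_right_mono) auto
    finally show ?thesis .
  qed
  let ?g = "\<lambda>y. indicat_real {-N..N} y *\<^sub>R (\<rho>0 y * cutoff N y * pp (y, \<tau>) ^ 3)"
  have inner: "AE y in lborel. (LINT t|lborel. ?f (y, t)) = cv / 3 * ?g y"
    using th_time w_0
  proof eventually_elim
    case (elim y)
    have int: "is_interval {0..(\<tau>::real)}" by (rule is_interval_cc)
    have "primitive_on {0..\<tau>} (\<lambda>t. w (y, t) - th (y, t)) (\<lambda>t. wt (y, t) - \<theta>t (y, t))"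
      by (rule primitive_on_subset[OF primitive_on_diff[OF w_time elim(1)]]) auto
    from primitive_on_pos_part_power[OF int this, of 2]
    have P: "primitive_on {0..\<tau>} (\<lambda>t. pp (y, t) ^ 3) (\<lambda>t. 3 * (pp (y, t))\<^sup>2 * (wt (y, t) - \<theta>t (y, t)))"
      by (simp add: pp_def numeral_3_eq_3)
    have "th (y, 0) = \<theta>0 y" using set_integral_singleton_lborel[of 0 "\<lambda>s. \<theta>t (y, s)"] by (simp add: th_def)
    then have "pp (y, 0) = 0" using elim(2) by (simp add: pp_def)
    then have v: "(LINT t:{0..\<tau>}|lborel. 3 * (pp (y, t))\<^sup>2 * (wt (y, t) - \<theta>t (y, t))) = pp (y, \<tau>) ^ 3"
      using primitive_onD(2)[OF P, of 0 \<tau>] \<tau> by simp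
    have "(LINT t|lborel. ?f (y, t)) = (LINT t|lborel. (indicat_real {-N..N} y * (cv / 3 * \<rho>0 y * cutoff N y)) *
        (indicat_real {0..\<tau>} t *\<^sub>R (3 * (pp (y, t))\<^sup>2 * (wt (y, t) - \<theta>t (y, t)))))"
      by (intro Bochner_Integration.integral_cong refl) (auto simp: indicator_def integrand_def)
    also have "\<dots> = (indicat_real {-N..N} y * (cv / 3 * \<rho>0 y * cutoff N y)) * pp (y, \<tau>) ^ 3"
      using v unfolding set_lebesgue_integral_def by (simp only: integral_mult_right_zero)
    finally show ?case by simp
  qed
  have gm: "?g \<in> borel_measurable lborel" by measurable
  have im: "(\<lambda>y. LINT t|lborel. ?f (y, t)) \<in> borel_measurable lborel" using lborel_Fubini(3)[OF fi] by auto
  have gi': "integrable lborel (\<lambda>y. cv / 3 * ?g y)"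
    using integrable_cong_AE[OF im _ inner] gm lborel_Fubini(3)[OF fi] by auto
  have gi: "integrable lborel ?g"
  proof -
    have "integrable lborel (\<lambda>y. 3 / cv * (cv / 3 * ?g y))" by (rule integrable_mult_right[OF gi'])
    moreover have "3 / cv * (cv / 3 * ?g y) = ?g y" for y using cv by simp
    ultimately show ?thesis by (simp only:)
  qed
  then show "set_integrable lborel {-N..N} (\<lambda>y. \<rho>0 y * cutoff N y * pp (y, \<tau>) ^ 3)"
    unfolding set_integrable_def .
  have "cv / 3 * (LINT y|lborel. ?g y) = (LINT y|lborel. cv / 3 * ?g y)" by (rule integral_mult_right_zero[symmetric])
  also have "\<dots> = (LINT y|lborel. LINT t|lborel. ?f (y, t))"
    by (rule integral_cong_AE[OF borel_measurable_integrable[OF gi'] im]) (use inner in \<open>auto elim!: eventually_mono\<close>)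
  also have "\<dots> = (LINT z|lborel. ?f z)" by (rule lborel_Fubini(5)[OF fi, symmetric])
  also have "\<dots> \<le> T * k" by (rule up)
  finally have "cv / 3 * (LINT y|lborel. ?g y) \<le> T * k" .
  then have "(LINT y|lborel. ?g y) \<le> 3 * (T * k) / cv" using cv by (simp add: field_simps)
  also have "\<dots> = C4 / N" unfolding C4_def k_def using N Jl cv by (simp add: field_simps)
  finally show "(LINT y:{-N..N}|lborel. \<rho>0 y * cutoff N y * pp (y, \<tau>) ^ 3) \<le> C4 / N"
    unfolding set_lebesgue_integral_def .
qed

text \<open>On a fixed interval \<open>{-M..M}\<close> the cutoff stays above a positive constant
  for all \<open>N \<ge> 2 M\<close>, while the bound on the cubic energy tends to 0 as
  \<open>N\<close> grows. Positivity of \<open>\<rho>0\<close> then gives \<open>pp = 0\<close>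
  almost everywhere on that interval.\<close>

lemma pp_eq_0: "AE y in lborel. pp (y, \<tau>) = 0" if \<tau>: "0 < \<tau>" "\<tau> < T"
proof -
  have "AE y in lborel. y \<in> {-real (Suc n)..real (Suc n)} \<longrightarrow> pp (y, \<tau>) = 0" for n
  proof -
    define M where "M = real (Suc n)"
    have M: "M > 0" by (simp add: M_def)
    let ?g = "\<lambda>y. indicat_real {-M..M} y *\<^sub>R (\<rho>0 y * pp (y, \<tau>) ^ 3)"
    have g0: "0 \<le> ?g y" for y using \<rho>0_pos[of y] pp_nonneg by simp
    \<comment> \<open>For \<open>\<bar>y\<bar> \<le> N / 2\<close> the cutoff is at least
      \<open>(3 / 4)^2 = 9 / 16\<close>, whence the factor \<open>16 / 9\<close>.\<close>
    have cmp: "?g y \<le> 16 / 9 * (indicat_real {-N..N} y *\<^sub>R (\<rho>0 y * cutoff N y * pp (y, \<tau>) ^ 3))" if N: "N \<ge> 2 * M" for y N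
    proof (cases "y \<in> {-M..M}")
      case True
      have N0: "N > 0" using N M by linarith
      have yN: "y \<in> {-N..N}" using True N M by auto
      have "y\<^sup>2 \<le> (N / 2)\<^sup>2" using True N by (intro abs_le_square_iff[THEN iffD1]) auto
      then have "3 / 4 \<le> 1 - y\<^sup>2 / N\<^sup>2" using N0 by (simp add: field_simps power2_eq_square)
      then have "(3 / 4)\<^sup>2 \<le> cutoff N y" unfolding cutoff_def by (intro power_mono) auto
      then have "1 \<le> 16 / 9 * cutoff N y" by (simp add: power2_eq_square)
      then have "(\<rho>0 y * pp (y, \<tau>) ^ 3) * 1 \<le> (\<rho>0 y * pp (y, \<tau>) ^ 3) * (16 / 9 * cutoff N y)"
        using \<rho>0_pos[of y] pp_nonneg by (intro mult_left_mono) auto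
      then show ?thesis using True yN by (simp add: mult_ac)
    next
      case False
      then show ?thesis
        using \<rho>0_pos[of y] pp_nonneg[of "(y, \<tau>)"] cutoff_bounds(2)[of N y] N M
        by (cases "y \<in> {-N..N}") auto
    qed
    have gm: "?g \<in> borel_measurable lborel" by measurable
    have gi: "integrable lborel ?g"
    proof (rule Bochner_Integration.integrable_bound[OF integrable_mult_right])
      show "integrable lborel (\<lambda>y. indicat_real {-(2*M)..2*M} y *\<^sub>R (\<rho>0 y * cutoff (2*M) y * pp (y, \<tau>) ^ 3))"
        using cutoff_estimate(1)[of "2*M", OF _ \<tau>] M unfolding set_integrable_def by simp
      show "AE y in lborel. norm (?g y) \<le> norm (16 / 9 * (indicat_real {-(2*M)..2*M} y *\<^sub>R (\<rho>0 y * cutoff (2*M) y * pp (y, \<tau>) ^ 3)))"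
      proof (rule AE_I2)
        fix y
        show "norm (?g y) \<le> norm (16 / 9 * (indicat_real {-(2*M)..2*M} y *\<^sub>R (\<rho>0 y * cutoff (2*M) y * pp (y, \<tau>) ^ 3)))"
          using cmp[of "2*M" y] g0[of y] by (simp only: real_norm_def) linarith
      qed
    qed (rule gm)
    have le: "(LINT y|lborel. ?g y) \<le> 16 / 9 * (C4 / N)" if N: "N \<ge> 2 * M" for N
    proof -
      have N0: "N > 0" using N M by linarith
      note ce = cutoff_estimate[OF N0 \<tau>]
      have "(LINT y|lborel. ?g y) \<le> (LINT y|lborel. 16 / 9 * (indicat_real {-N..N} y *\<^sub>R (\<rho>0 y * cutoff N y * pp (y, \<tau>) ^ 3)))"
        by (rule integral_mono[OF gi integrable_mult_right cmp[OF N]]) (use ce(1) in \<open>simp add: set_integrable_def\<close>)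
      also have "\<dots> = 16 / 9 * (LINT y:{-N..N}|lborel. \<rho>0 y * cutoff N y * pp (y, \<tau>) ^ 3)"
        unfolding set_lebesgue_integral_def by (rule integral_mult_right_zero)
      also have "\<dots> \<le> 16 / 9 * (C4 / N)" using ce(2) by simp
      finally show ?thesis .
    qed
    have "(LINT y|lborel. ?g y) \<le> 0"
    proof (rule field_le_epsilon)
      fix \<epsilon> :: real assume \<epsilon>: "\<epsilon> > 0"
      define N where "N = max (2 * M) (16 / 9 * \<bar>C4\<bar> / \<epsilon>)"
      have N0: "N > 0" unfolding N_def using M by auto
      have "16 / 9 * \<bar>C4\<bar> / \<epsilon> \<le> N" by (simp add: N_def)
      then have "16 / 9 * (\<bar>C4\<bar> / N) \<le> \<epsilon>" using \<epsilon> N0 by (simp add: field_simps)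
      moreover have "16 / 9 * (C4 / N) \<le> 16 / 9 * (\<bar>C4\<bar> / N)" using N0 by (simp add: divide_right_mono)
      ultimately show "(LINT y|lborel. ?g y) \<le> 0 + \<epsilon>" using le[of N] by (simp add: N_def)
    qed
    moreover have "0 \<le> (LINT y|lborel. ?g y)" by (rule integral_nonneg_AE) (use g0 in auto)
    ultimately have "(LINT y|lborel. ?g y) = 0" by linarith
    then have "AE y in lborel. ?g y = 0" using integral_nonneg_eq_0_iff_AE[OF gi] g0 by auto
    then show ?thesis
      unfolding M_def[symmetric]
      by eventually_elim (use \<rho>0_pos in \<open>auto simp: indicator_def less_imp_neq[OF \<rho>0_pos, symmetric] split: if_splits\<close>)
  qed
  then have "AE y in lborel. \<forall>n. y \<in> {-real (Suc n)..real (Suc n)} \<longrightarrow> pp (y, \<tau>) = 0"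
    by (intro AE_all_countable[THEN iffD2] allI)
  then show ?thesis
  proof eventually_elim
    case (elim y)
    obtain n where "\<bar>y\<bar> \<le> real n" using real_arch_simple by blast
    then have "y \<in> {-real (Suc n)..real (Suc n)}" by auto
    then show ?case using elim by blast
  qed
qed

text \<open>Joint measurability of \<open>pp\<close> turns vanishing at each fixed time, for almost
  every \<open>y\<close>, into vanishing almost everywhere on the strip. There
  \<open>\<theta>\<close> is at least \<open>w\<close>, and \<open>w_ge\<close> applies.\<close>

lemma temperature_lower_bound:
  "\<exists>c>0. AE z in lborel. z \<in> strip T \<longrightarrow> c * \<rho>0 (fst z) powr \<alpha> \<le> \<theta> z"
proof -
  obtain c where c: "c > 0" "AE y in lborel. \<forall>t\<in>{0..T}. c * \<rho>0 y powr \<alpha> \<le> w (y, t)"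
    using w_ge by blast
  have m: "{z. snd z \<in> {0<..<T} \<longrightarrow> pp z = 0} \<in> sets borel" by measurable
  have "AE t in lborel. AE y in lborel. snd (y, t) \<in> {0<..<T} \<longrightarrow> pp (y, t) = 0"
  proof (rule AE_I2)
    fix t
    show "AE y in lborel. snd (y, t) \<in> {0<..<T} \<longrightarrow> pp (y, t) = 0"
    proof (cases "0 < t \<and> t < T")
      case True
      then have "AE y in lborel. pp (y, t) = 0" using pp_eq_0 by blast
      then show ?thesis by eventually_elim simp
    qed auto
  qed
  then have "AE z in lborel. snd z \<in> {0<..<T} \<longrightarrow> pp z = 0"
    using AE_lborel_pair_commute[OF m] by (intro AE_lborel_pairI1[OF m]) blast
  then have "AE z in lborel. z \<in> strip T \<longrightarrow> c * \<rho>0 (fst z) powr \<alpha> \<le> \<theta> z"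
    using AE_lborel_fst[OF c(2)] th_eq
  proof eventually_elim
    case (elim z)
    show ?case
    proof
      assume z: "z \<in> strip T"
      then have t: "snd z \<in> {0<..<T}" by (auto simp: strip_def)
      have "w z \<le> th z" using elim(1) t by (auto simp: pp_def max_def split: if_splits)
      moreover have "c * \<rho>0 (fst z) powr \<alpha> \<le> w (fst z, snd z)" using bspec[OF elim(2), of "snd z"] t by auto
      ultimately show "c * \<rho>0 (fst z) powr \<alpha> \<le> \<theta> z" using elim(3) z by simp
    qed
  qed
  with c(1) show ?thesis by blast
qed

end

section \<open>The lower bound of the entropy\<close>

lemma borel_measurable_cut:
  assumes "set_borel_measurable lborel S f" "S \<in> sets borel"
  shows "(\<lambda>z. indicat_real S z * f z) \<in> borel_measurable borel"
  using assms unfolding set_borel_measurable_def by simp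

text \<open>For unknowns whose measurability is recorded only for the product with a weight in
  \<open>\<rho>0\<close>: the weight never vanishes and can be divided out.\<close>

lemma borel_measurable_cut_weight:
  fixes k :: "real \<Rightarrow> real" and f :: "real \<times> real \<Rightarrow> real"
  assumes "set_borel_measurable lborel S (\<lambda>(y, t). k y * f (y, t))" "k \<in> borel_measurable borel" "\<And>y. k y \<noteq> 0"
  shows "(\<lambda>z. indicat_real S z * f z) \<in> borel_measurable borel"
proof -
  have m: "(\<lambda>z. indicat_real S z * (k (fst z) * f z)) \<in> borel_measurable borel"
    using assms(1) unfolding set_borel_measurable_def by (simp add: split_beta')
  have eq: "(\<lambda>z. indicat_real S z * f z) = (\<lambda>z. (indicat_real S z * (k (fst z) * f z)) / k (fst z))"
    using assms(3) by (auto simp: fun_eq_iff)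
  show ?thesis
    by (subst eq) (rule borel_measurable_divide[OF m measurable_compose[OF borel_measurable_fst_snd(1) assms(2)]])
qed

text \<open>\<open>\<bar>x\<bar> \<le> 1 + x^2\<close> on the bounded rectangle
  \<open>{-r..r} \<times> {0..T}\<close>; at all other times \<open>f\<close> is 0.\<close>

lemma set_integrable_rect_of_L2:
  fixes f :: "real \<times> real \<Rightarrow> real"
  assumes f[measurable]: "f \<in> borel_measurable borel" and 0: "\<And>z. z \<notin> strip T \<Longrightarrow> f z = 0"
    and fin: "(\<integral>\<^sup>+ t\<in>{0<..<T}. (\<integral>\<^sup>+ y. ennreal ((f (y, t))\<^sup>2) \<partial>lborel) \<partial>lborel) < \<infinity>"
  shows "set_integrable lborel ({-r..r} \<times> UNIV) f"
proof -
  have "(\<integral>\<^sup>+ z. ennreal ((f z)\<^sup>2) \<partial>lborel) = (\<integral>\<^sup>+ t. (\<integral>\<^sup>+ y. ennreal ((f (y, t))\<^sup>2) \<partial>lborel) \<partial>lborel)"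
    using lborel_pair.nn_integral_snd[of "\<lambda>z. ennreal ((f z)\<^sup>2)"] by (simp add: lborel_prod)
  also have "\<dots> = (\<integral>\<^sup>+ t\<in>{0<..<T}. (\<integral>\<^sup>+ y. ennreal ((f (y, t))\<^sup>2) \<partial>lborel) \<partial>lborel)"
    by (rule nn_integral_cong) (auto simp: indicator_def 0 strip_def)
  finally have "(\<integral>\<^sup>+ z. ennreal ((f z)\<^sup>2) \<partial>lborel) < \<infinity>" using fin by simp
  then have f2: "integrable lborel (\<lambda>z. (f z)\<^sup>2)" by (intro integrableI_bounded) auto
  let ?R = "{-r..r} \<times> {0..T}"
  have "?R \<in> sets borel" by (intro borel_Times) auto
  moreover have "emeasure lborel ?R = emeasure lborel (cbox (-r, 0) (r, T))" by (simp add: cbox_Pair_eq)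
  then have "emeasure lborel ?R < \<infinity>" using emeasure_lborel_cbox_finite by metis
  ultimately have i: "integrable lborel (\<lambda>z. indicat_real ?R z + (f z)\<^sup>2)"
    using f2 by (intro Bochner_Integration.integrable_add integrable_real_indicator) auto
  show ?thesis
    unfolding set_integrable_def
  proof (rule Bochner_Integration.integrable_bound[OF i])
    show "(\<lambda>z. indicat_real ({-r..r} \<times> UNIV) z *\<^sub>R f z) \<in> borel_measurable lborel"
      by (rule borel_measurable_rect) auto
    show "AE z in lborel. norm (indicat_real ({-r..r} \<times> UNIV) z *\<^sub>R f z) \<le> norm (indicat_real ?R z + (f z)\<^sup>2)"
    proof (rule AE_I2)
      fix z
      have sq: "\<bar>x\<bar> \<le> 1 + x\<^sup>2" for x :: real
      proof -
        have "0 \<le> (\<bar>x\<bar> - 1)\<^sup>2" by simp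
        then have "2 * \<bar>x\<bar> \<le> 1 + x\<^sup>2" by (simp add: power2_diff)
        then show ?thesis using abs_ge_zero[of x] by linarith
      qed
      show "norm (indicat_real ({-r..r} \<times> UNIV) z *\<^sub>R f z) \<le> norm (indicat_real ?R z + (f z)\<^sup>2)"
      proof (cases "z \<in> {-r..r} \<times> UNIV \<and> z \<in> strip T")
        case True
        then have "z \<in> ?R" by (auto simp: strip_def)
        then show ?thesis using True sq[of "f z"] by simp
      next
        case False
        then have "indicat_real ({-r..r} \<times> UNIV) z *\<^sub>R f z = 0" using 0[of z] by (auto simp: indicator_def)
        then show ?thesis by (simp only: norm_zero norm_ge_zero)
      qed
    qed
  qed
qed

lemma L_infty_L2_imp_L2_L2:
  assumes "L_infty_L2 T f"
  shows "(\<integral>\<^sup>+ t\<in>{0<..<T}. (\<integral>\<^sup>+ y. ennreal ((f (y, t))\<^sup>2) \<partial>lborel) \<partial>lborel) < \<infinity>"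
proof -
  obtain C where C: "AE t in lborel. t \<in> {0<..<T} \<longrightarrow> (\<integral>\<^sup>+ y. ennreal ((f (y, t))\<^sup>2) \<partial>lborel) \<le> ennreal C"
    using assms unfolding L_infty_L2_def by auto
  have "(\<integral>\<^sup>+ t\<in>{0<..<T}. (\<integral>\<^sup>+ y. ennreal ((f (y, t))\<^sup>2) \<partial>lborel) \<partial>lborel) \<le> (\<integral>\<^sup>+ t. ennreal C * indicator {0<..<T} t \<partial>lborel)"
    by (rule nn_integral_mono_AE) (use C in \<open>auto elim!: eventually_mono simp: indicator_def\<close>)
  also have "\<dots> = ennreal C * emeasure lborel {0<..<T}" by (simp add: nn_integral_cmult)
  also have "\<dots> < \<infinity>" by (cases "0 \<le> T") (auto simp: ennreal_mult_less_top)
  finally show ?thesis .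
qed

text \<open>Only small positive times matter, so shrinking \<open>\<delta>\<close> below
  \<open>T\<close> keeps the comparison inside the strip.\<close>

lemma attains_initial_cong:
  assumes "attains_initial f f0" "T > 0" "\<And>z. z \<in> strip T \<Longrightarrow> f' z = f z"
  shows "attains_initial f' f0"
  unfolding attains_initial_def
proof (intro allI impI)
  fix a b \<epsilon> :: real assume "\<epsilon> > 0"
  then obtain \<delta> where \<delta>: "\<delta> > 0" "AE t in lborel. 0 < t \<and> t < \<delta> \<longrightarrow>
      (\<integral>\<^sup>+ y\<in>{a..b}. ennreal ((f (y, t) - f0 y)\<^sup>2) \<partial>lborel) < ennreal \<epsilon>"
    using assms(1) unfolding attains_initial_def by blast
  have "AE t in lborel. 0 < t \<and> t < min \<delta> T \<longrightarrow>
      (\<integral>\<^sup>+ y\<in>{a..b}. ennreal ((f' (y, t) - f0 y)\<^sup>2) \<partial>lborel) < ennreal \<epsilon>"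
    using \<delta>(2)
  proof eventually_elim
    case (elim t)
    show ?case
    proof
      assume t: "0 < t \<and> t < min \<delta> T"
      then have "f' (y, t) = f (y, t)" for y using assms(3)[of "(y, t)"] by (simp add: strip_def)
      then show "(\<integral>\<^sup>+ y\<in>{a..b}. ennreal ((f' (y, t) - f0 y)\<^sup>2) \<partial>lborel) < ennreal \<epsilon>" using elim t by simp
    qed
  qed
  then show "\<exists>\<delta>>0. AE t in lborel. 0 < t \<and> t < \<delta> \<longrightarrow>
      (\<integral>\<^sup>+ y\<in>{a..b}. ennreal ((f' (y, t) - f0 y)\<^sup>2) \<partial>lborel) < ennreal \<epsilon>"
    using \<delta>(1) assms(2) by (intro exI[of _ "min \<delta> T"]) auto
qed

lemma strip_space_slice:
  fixes f g :: "real \<times> real \<Rightarrow> real"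
  assumes T: "T > 0" and w: "weak_deriv (strip T) (1, 0) f g"
    and f: "f \<in> borel_measurable borel" and g: "g \<in> borel_measurable borel"
  shows "AE t in lborel. t \<in> {0<..<T} \<longrightarrow>
    (\<exists>u. primitive_on UNIV u (\<lambda>y. g (y, t)) \<and> (AE y in lborel. f (y, t) = u y))"
proof (rule weak_deriv_space_slice[OF _ _ _ _ f _ g])
  show "locally_integrable (UNIV \<times> {0<..<T}) f" "locally_integrable (UNIV \<times> {0<..<T}) g"
    using w unfolding weak_deriv_def strip_def by auto
  show "(LINT z|lborel. f z * (deriv \<psi> (fst z) * \<phi> (snd z))) = - (LINT z|lborel. g z * (\<psi> (fst z) * \<phi> (snd z)))"
    if "test_function UNIV \<psi>" "test_function {0<..<T} \<phi>" for \<psi> \<phi>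
    by (rule weak_deriv_tensor(1)[OF that]) (use w in \<open>simp add: strip_def\<close>)
qed (use T in \<open>auto simp: is_interval_oo\<close>)

text \<open>A finite lower bound excludes \<open>th = 0\<close>, where the entropy is
  \<open>- \<infinity>\<close>; the formula is then solved for \<open>th\<close> after estimating
  \<open>ln j\<close> by \<open>ln Jh\<close>.\<close>

lemma entropy_lower_imp_temperature:
  assumes "cv > 0" "R > 0" "A > 0" "0 < r" "0 < j" "j \<le> Jh" "0 \<le> th" and ent: "ereal m \<le> entropy cv R A r j th"
  shows "exp (m / cv - ln (R / A) - (R / cv) * ln Jh) * r powr (R / cv) \<le> th"
proof -
  have th: "th > 0" using ent assms(7) by (auto simp: entropy_def split: if_splits)
  have "m \<le> cv * (ln (R / A) + (R / cv) * ln j + ln th - (R / cv) * ln r)"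
    using ent th by (simp add: entropy_def adiabatic_def)
  then have "m / cv \<le> ln (R / A) + (R / cv) * ln j + ln th - (R / cv) * ln r"
    using assms(1) by (simp add: pos_divide_le_eq mult.commute)
  moreover have "(R / cv) * ln j \<le> (R / cv) * ln Jh"
    using assms(1,2,5,6) by (intro mult_left_mono) auto
  ultimately have "m / cv - ln (R / A) - (R / cv) * ln Jh + (R / cv) * ln r \<le> ln th" by linarith
  then have "exp (m / cv - ln (R / A) - (R / cv) * ln Jh + (R / cv) * ln r) \<le> exp (ln th)" by (simp only: exp_le_cancel_iff)
  then show ?thesis using th assms(4) by (simp add: exp_add powr_def)
qed

text \<open>The exponent \<open>R / cv\<close> is \<open>\<gamma> - 1\<close>, so
  \<open>ln r\<close> cancels and the bound is uniform in the density.\<close>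

lemma temperature_lower_imp_entropy:
  assumes "cv > 0" "R > 0" "A > 0" "0 < r" "0 < jl" "jl \<le> j" "c > 0" and th: "c * r powr (R / cv) \<le> th"
  shows "ereal (cv * (ln (R / A) + (R / cv) * ln jl + ln c)) \<le> entropy cv R A r j th"
proof -
  have cr: "0 < c * r powr (R / cv)" using assms by simp
  then have th0: "th > 0" using th by linarith
  have "ln c + (R / cv) * ln r = ln (c * r powr (R / cv))"
    using assms by (simp add: ln_mult ln_powr)
  also have "\<dots> \<le> ln th" using th cr th0 by simp
  finally have "ln c \<le> ln th - (R / cv) * ln r" by linarith
  moreover have "(R / cv) * ln jl \<le> (R / cv) * ln j" using assms by (intro mult_left_mono) auto
  ultimately have "cv * (ln (R / A) + (R / cv) * ln jl + ln c) \<le> cv * (ln (R / A) + (R / cv) * ln j + ln th - (R / cv) * ln r)"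
    using assms(1) by (intro mult_left_mono) linarith+
  then show ?thesis using th0 by (simp add: entropy_def adiabatic_def)
qed

theorem theorem1p2:
  fixes \<mu> \<kappa> cv R A Jlow :: real
    and \<rho>0 J0 v0 \<theta>0 :: "real \<Rightarrow> real"
    and d\<rho>0 dJ0 dv0 d\<theta>0 d_inv_sqrt_\<rho>0 d_inv_\<rho>0 dd_inv_\<rho>0 :: "real \<Rightarrow> real"
    and J v \<theta> :: "real \<times> real \<Rightarrow> real"
  assumes "\<mu> > 0" "\<kappa> > 0" "cv > 0" "R > 0" "A > 0"
    and "\<And>y. 0 < \<rho>0 y" "L_infty UNIV \<rho>0" "weak_deriv1 \<rho>0 d\<rho>0" "L_infty UNIV d\<rho>0"
    and "Jlow > 0" "AE y in lborel. Jlow \<le> J0 y" "L_infty UNIV J0"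
    and "AE y in lborel. 0 \<le> \<theta>0 y"
    and "weak_deriv1 J0 dJ0" "weak_deriv1 v0 dv0" "weak_deriv1 \<theta>0 d\<theta>0"
    and "L2 (\<lambda>y. sqrt (\<rho>0 y) * v0 y)" "L2 (\<lambda>y. sqrt (\<rho>0 y) * (v0 y)\<^sup>2)"
    and "L2 (\<lambda>y. sqrt (\<rho>0 y) * \<theta>0 y)" "L2 (\<lambda>y. sqrt (\<rho>0 y) * dJ0 y)"
    and "L2 dv0" "L2 (\<lambda>y. \<rho>0 y powr (3/2) * d\<theta>0 y)"
    and "weak_deriv1 (\<lambda>y. 1 / sqrt (\<rho>0 y)) d_inv_sqrt_\<rho>0" "L_infty UNIV d_inv_sqrt_\<rho>0"
    and "integrable lborel \<rho>0"
    and "L2 (\<lambda>y. sqrt (\<rho>0 y) * d\<theta>0 y)" "L2 (\<lambda>y. dJ0 y / sqrt (\<rho>0 y))"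
    and "weak_deriv1 (\<lambda>y. 1 / \<rho>0 y) d_inv_\<rho>0" "weak_deriv1 d_inv_\<rho>0 dd_inv_\<rho>0"
        "L_infty UNIV dd_inv_\<rho>0"
    and "NS_global_solution \<mu> \<kappa> cv R \<rho>0 J0 v0 \<theta>0 J v \<theta>"
    and "ess_inf lborel (\<lambda>y. entropy cv R A (\<rho>0 y) (J0 y) (\<theta>0 y)) > - \<infinity>"
  shows "\<forall>T>0. ess_inf (restrict_space lborel (strip T))
                 (\<lambda>(y, t). entropy cv R A (\<rho>0 y) (J (y, t)) (\<theta> (y, t))) > - \<infinity>"
proof (intro allI impI)
  fix T :: real assume T: "T > 0"
  note pos = assms(1-5) and \<rho>pos = assms(6)
  have sol: "NS_solution \<mu> \<kappa> cv R \<rho>0 J0 v0 \<theta>0 T J v \<theta>"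
    using assms(31) T unfolding NS_global_solution_def by blast
  define S where "S = strip T"
  have "open S" unfolding S_def strip_def by (intro open_Times) auto
  then have Sb [measurable]: "S \<in> sets borel" by (rule borel_open)
  obtain Jt Jy Jyt vt vy vyy \<theta>t \<theta>y Fy Py Qy where
    wJt: "weak_deriv (strip T) (0, 1) J Jt" and w\<theta>t: "weak_deriv (strip T) (0, 1) \<theta> \<theta>t"
    and w\<theta>y: "weak_deriv (strip T) (1, 0) \<theta> \<theta>y"
    and wQ: "weak_deriv (strip T) (1, 0) (\<lambda>z. \<theta>y z / J z) Qy"
    and Jt2: "L_infty_L2 T Jt" and \<theta>2: "L_infty_L2 T (\<lambda>(y, t). sqrt (\<rho>0 y) * \<theta> (y, t))"
    and \<theta>y2: "L2_L2 T \<theta>y" and Q2: "L2_L2 T (\<lambda>(y, t). \<rho>0 y * Qy (y, t))"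
    and \<theta>t2: "L2_L2 T (\<lambda>(y, t). (\<rho>0 y)\<^sup>2 * \<theta>t (y, t))"
    and eqn: "AE (y, t) in lborel. (y, t) \<in> strip T \<longrightarrow>
         Jt (y, t) = vy (y, t) \<and>
         \<rho>0 y * vt (y, t) - \<mu> * Fy (y, t) + R * Py (y, t) = 0 \<and>
         cv * \<rho>0 y * \<theta>t (y, t) - \<kappa> * Qy (y, t)
           + R * (\<rho>0 y / J (y, t)) * \<theta> (y, t) * vy (y, t)
           = \<mu> * (\<bar>vy (y, t)\<bar>\<^sup>2 / J (y, t))"
    using sol unfolding NS_solution_def by (elim conjE exE) (rule that; assumption)
  have Jpos: "AE z in lborel. z \<in> strip T \<longrightarrow> 0 < J z" and JL: "L_infty (strip T) J"
    and JiL: "L_infty (strip T) (\<lambda>z. inverse (J z))" and \<theta>nn: "AE z in lborel. z \<in> strip T \<longrightarrow> 0 \<le> \<theta> z"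
    and Jinit: "attains_initial J J0" and \<theta>init: "attains_initial \<theta> \<theta>0"
    using sol unfolding NS_solution_def by blast+
  obtain \<rho>m where \<rho>m: "\<rho>m > 0" "\<rho>0 \<in> borel_measurable borel" "AE y in lborel. \<bar>\<rho>0 y\<bar> \<le> \<rho>m"
    using L_infty_UNIV[OF assms(7)] by metis
  obtain Jh where Jh: "Jh > 0" "J0 \<in> borel_measurable borel" "AE y in lborel. \<bar>J0 y\<bar> \<le> Jh"
    using L_infty_UNIV[OF assms(12)] by metis
  note [measurable] = \<rho>m(2) Jh(2)
  have \<theta>0m [measurable]: "\<theta>0 \<in> borel_measurable borel"
    using assms(16) unfolding weak_deriv_def by (auto intro: borel_measurable_locally_integrable)
  \<comment> \<open>Extension by 0 gives Borel functions on the whole plane and lets integrals of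
    the time derivatives range over all times. Weak derivatives, initial values and equations see
    only the strip.\<close>
  define J' Jt' \<theta>' \<theta>t' \<theta>y' Qy' where
    "J' z = indicat_real S z * J z" and "Jt' z = indicat_real S z * Jt z"
    and "\<theta>' z = indicat_real S z * \<theta> z" and "\<theta>t' z = indicat_real S z * \<theta>t z"
    and "\<theta>y' z = indicat_real S z * \<theta>y z" and "Qy' z = indicat_real S z * Qy z" for z
  note cuts = J'_def Jt'_def \<theta>'_def \<theta>t'_def \<theta>y'_def Qy'_def
  have on: "J' z = J z" "Jt' z = Jt z" "\<theta>' z = \<theta> z" "\<theta>t' z = \<theta>t z" "\<theta>y' z = \<theta>y z" "Qy' z = Qy z" if "z \<in> strip T" for z
    using that by (auto simp: cuts S_def)
  have off: "Jt' z = 0" "\<theta>t' z = 0" if "z \<notin> strip T" for z using that by (auto simp: cuts S_def)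
  have m: "J' \<in> borel_measurable borel" "Jt' \<in> borel_measurable borel" "\<theta>' \<in> borel_measurable borel"
    "\<theta>t' \<in> borel_measurable borel" "\<theta>y' \<in> borel_measurable borel" "Qy' \<in> borel_measurable borel"
  proof -
    show "J' \<in> borel_measurable borel" unfolding cuts
      by (rule borel_measurable_cut[OF _ Sb]) (use JL in \<open>simp add: L_infty_def S_def\<close>)
    show "Jt' \<in> borel_measurable borel" unfolding cuts
      by (rule borel_measurable_cut[OF _ Sb]) (use Jt2 in \<open>simp add: L_infty_L2_def S_def\<close>)
    show "\<theta>y' \<in> borel_measurable borel" unfolding cuts
      by (rule borel_measurable_cut[OF _ Sb]) (use \<theta>y2 in \<open>simp add: L2_L2_def S_def\<close>)
    show "\<theta>' \<in> borel_measurable borel" unfolding cuts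
      by (rule borel_measurable_cut_weight[of _ "\<lambda>y. sqrt (\<rho>0 y)"])
         (use \<theta>2 \<rho>pos in \<open>auto simp: L_infty_L2_def S_def less_imp_neq[OF \<rho>pos, symmetric]\<close>)
    show "\<theta>t' \<in> borel_measurable borel" unfolding cuts
      by (rule borel_measurable_cut_weight[of _ "\<lambda>y. (\<rho>0 y)\<^sup>2"])
         (use \<theta>t2 in \<open>auto simp: L2_L2_def S_def less_imp_neq[OF \<rho>pos, symmetric]\<close>)
    show "Qy' \<in> borel_measurable borel" unfolding cuts
      by (rule borel_measurable_cut_weight[of _ "\<lambda>y. \<rho>0 y"])
         (use Q2 in \<open>auto simp: L2_L2_def S_def less_imp_neq[OF \<rho>pos, symmetric]\<close>)
  qed
  note [measurable] = m
  obtain Ju where Ju: "AE z in lborel. z \<in> strip T \<longrightarrow> \<bar>J z\<bar> \<le> Ju" using JL unfolding L_infty_def by blast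
  obtain Ji where Ji: "AE z in lborel. z \<in> strip T \<longrightarrow> \<bar>inverse (J z)\<bar> \<le> Ji" using JiL unfolding L_infty_def by blast
  \<comment> \<open>The maximum with 1 makes the denominator positive without an argument about the
    sign of \<open>Ji\<close>.\<close>
  define Jl where "Jl = 1 / max Ji 1"
  have Jl: "Jl > 0" by (simp add: Jl_def)
  have Jb: "AE z in lborel. z \<in> strip T \<longrightarrow> Jl \<le> J z \<and> J z \<le> Ju"
    using Jpos Ju Ji
  proof eventually_elim
    case (elim z)
    show ?case
    proof
      assume z: "z \<in> strip T"
      have J0: "0 < J z" using elim z by auto
      have "inverse (J z) \<le> max Ji 1" using elim z J0 by auto
      then have "inverse (max Ji 1) \<le> inverse (inverse (J z))" using J0 by (intro le_imp_inverse_le) auto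
      then show "Jl \<le> J z \<and> J z \<le> Ju" using elim z J0 by (auto simp: Jl_def inverse_eq_divide)
    qed
  qed
  obtain CJ0 where CJ0: "AE t in lborel. t \<in> {0<..<T} \<longrightarrow> (\<integral>\<^sup>+ y. ennreal ((Jt (y, t))\<^sup>2) \<partial>lborel) \<le> ennreal CJ0"
    using Jt2 unfolding L_infty_L2_def by blast
  define CJ where "CJ = max CJ0 0"
  have JtL2: "AE t in lborel. (\<integral>\<^sup>+ y. ennreal ((Jt' (y, t))\<^sup>2) \<partial>lborel) \<le> ennreal CJ"
    using CJ0
  proof eventually_elim
    case (elim t)
    show ?case
    proof (cases "t \<in> {0<..<T}")
      case True
      then have "Jt' (y, t) = Jt (y, t)" for y using on(2)[of "(y, t)"] by (simp add: strip_def)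
      then show ?thesis using elim True by (auto simp: CJ_def intro: order_trans ennreal_leI)
    next
      case False
      then have "Jt' (y, t) = 0" for y using off(1)[of "(y, t)"] by (auto simp: strip_def)
      then show ?thesis by simp
    qed
  qed
  have slab: "(\<integral>\<^sup>+ t\<in>{0<..<T}. (\<integral>\<^sup>+ y. ennreal ((f (y, t))\<^sup>2) \<partial>lborel) \<partial>lborel)
      = (\<integral>\<^sup>+ t\<in>{0<..<T}. (\<integral>\<^sup>+ y. ennreal ((g (y, t))\<^sup>2) \<partial>lborel) \<partial>lborel)"
    if "\<And>z. z \<in> strip T \<Longrightarrow> f z = g z" for f g :: "real \<times> real \<Rightarrow> real"
    by (rule nn_integral_cong) (auto simp: indicator_def strip_def that)
  have Jti: "set_integrable lborel ({-r..r} \<times> UNIV) Jt'" for r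
  proof (rule set_integrable_rect_of_L2[OF m(2) off(1)])
    show "(\<integral>\<^sup>+ t\<in>{0<..<T}. (\<integral>\<^sup>+ y. ennreal ((Jt' (y, t))\<^sup>2) \<partial>lborel) \<partial>lborel) < \<infinity>"
      using slab[of Jt' Jt, OF on(2)] L_infty_L2_imp_L2_L2[OF Jt2] by simp
  qed
  have \<theta>ti: "set_integrable lborel ({-r..r} \<times> UNIV) \<theta>t'" for r
  proof -
    \<comment> \<open>\<open>\<theta>t\<close> is square integrable with the weight
      \<open>\<rho>0^2\<close>; on a bounded interval the weight is bounded below and can be
      removed.\<close>
    define f where "f z = (\<rho>0 (fst z))\<^sup>2 * \<theta>t' z" for z
    have fm [measurable]: "f \<in> borel_measurable borel" unfolding f_def by measurable
    have fi: "set_integrable lborel ({-r..r} \<times> UNIV) f"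
    proof (rule set_integrable_rect_of_L2[OF fm, of T])
      show "f z = 0" if "z \<notin> strip T" for z using off(2)[OF that] by (simp add: f_def)
      show "(\<integral>\<^sup>+ t\<in>{0<..<T}. (\<integral>\<^sup>+ y. ennreal ((f (y, t))\<^sup>2) \<partial>lborel) \<partial>lborel) < \<infinity>"
        using slab[of f "\<lambda>(y, t). (\<rho>0 y)\<^sup>2 * \<theta>t (y, t)"] \<theta>t2
        by (auto simp: L2_L2_def f_def on split_beta)
    qed
    obtain c where c: "c > 0" "AE y in lborel. \<bar>y\<bar> \<le> r \<longrightarrow> c \<le> \<rho>0 y"
      using density_locally_bounded_below[OF \<rho>pos assms(7) assms(28-30)] by blast
    show ?thesis
      unfolding set_integrable_def
    proof (rule Bochner_Integration.integrable_bound[OF integrable_mult_right[OF fi[unfolded set_integrable_def], of "1 / c\<^sup>2"]])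
      show "(\<lambda>z. indicat_real ({-r..r} \<times> UNIV) z *\<^sub>R \<theta>t' z) \<in> borel_measurable lborel"
        by (rule borel_measurable_rect[OF m(4)]) auto
      show "AE z in lborel. norm (indicat_real ({-r..r} \<times> UNIV) z *\<^sub>R \<theta>t' z)
          \<le> norm (1 / c\<^sup>2 * (indicat_real ({-r..r} \<times> UNIV) z *\<^sub>R f z))"
        using AE_lborel_fst[OF c(2)]
      proof eventually_elim
        case (elim z)
        show ?case
        proof (cases "z \<in> {-r..r} \<times> UNIV")
          case True
          then have "\<bar>fst z\<bar> \<le> r" by auto
          then have "c\<^sup>2 \<le> (\<rho>0 (fst z))\<^sup>2" using elim c(1) by (intro power_mono) auto
          then have "c\<^sup>2 * \<bar>\<theta>t' z\<bar> \<le> (\<rho>0 (fst z))\<^sup>2 * \<bar>\<theta>t' z\<bar>" by (rule mult_right_mono) simp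
          then show ?thesis using True c(1) by (simp add: f_def abs_mult field_simps)
        qed simp
      qed
    qed
  qed
  have Jeq: "AE z in lborel. z \<in> strip T \<longrightarrow> J' z = J0 (fst z) + (LINT s:{0..snd z}|lborel. Jt' (fst z, s))"
    by (rule weak_deriv_time_slice[OF T weak_deriv_cong[OF wJt] m(1,2) Jti Jh(2) attains_initial_cong[OF Jinit T]])
       (simp_all add: on)
  have \<theta>eq: "AE z in lborel. z \<in> strip T \<longrightarrow> \<theta>' z = \<theta>0 (fst z) + (LINT s:{0..snd z}|lborel. \<theta>t' (fst z, s))"
    by (rule weak_deriv_time_slice[OF T weak_deriv_cong[OF w\<theta>t] m(3,4) \<theta>ti \<theta>0m attains_initial_cong[OF \<theta>init T]])
       (simp_all add: on)
  have \<theta>sl: "AE t in lborel. t \<in> {0<..<T} \<longrightarrow>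
      (\<exists>u. primitive_on UNIV u (\<lambda>y. \<theta>y' (y, t)) \<and> (AE y in lborel. \<theta>' (y, t) = u y))"
    by (rule strip_space_slice[OF T weak_deriv_cong[OF w\<theta>y] m(3,5)]) (simp_all add: on)
  have Qsl: "AE t in lborel. t \<in> {0<..<T} \<longrightarrow>
      (\<exists>u. primitive_on UNIV u (\<lambda>y. Qy' (y, t)) \<and> (AE y in lborel. \<theta>y' (y, t) / J' (y, t) = u y))"
    by (rule strip_space_slice[OF T weak_deriv_cong[OF wQ], of "\<lambda>z. \<theta>y' z / J' z" Qy'])
       (simp_all add: on m borel_measurable_divide)
  \<comment> \<open>Viscous heating and pressure work combine to
    \<open>(\<mu> x^2 - R q x) / J\<close> with \<open>x = vy\<close> and
    \<open>q = \<rho>0 \<theta>\<close>. The minimum over \<open>x\<close> is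
    \<open>- R^2 q^2 / (4 \<mu> J)\<close>, so the velocity disappears from the inequality.\<close>
  have super: "AE z in lborel. z \<in> strip T \<longrightarrow>
      \<kappa> * Qy' z - (R\<^sup>2 / (4 * \<mu>)) * (\<rho>0 (fst z))\<^sup>2 * (\<theta>' z)\<^sup>2 / J' z \<le> cv * \<rho>0 (fst z) * \<theta>t' z"
    using eqn Jb
  proof eventually_elim
    case (elim z)
    show ?case
    proof
      assume z: "z \<in> strip T"
      obtain y t where yt: "z = (y, t)" by (cases z)
      define x q j where "x = vy z" and "q = \<rho>0 y * \<theta> z" and "j = J z"
      have j: "j > 0" using elim(2) z Jl by (auto simp: j_def)
      have h1: "cv * \<rho>0 y * \<theta>t z - \<kappa> * Qy z + R * (\<rho>0 y / j) * \<theta> z * x = \<mu> * (\<bar>x\<bar>\<^sup>2 / j)"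
        using elim(1) z unfolding yt x_def j_def by auto
      have h2: "R * (\<rho>0 y / j) * \<theta> z * x = (R * q * x) / j" by (simp add: q_def mult_ac)
      have e1: "cv * \<rho>0 y * \<theta>t z = \<kappa> * Qy z + (\<mu> * x\<^sup>2 - R * q * x) / j"
        using h1[unfolded h2] by (simp add: diff_divide_distrib)
      have "0 \<le> (2 * \<mu> * x - R * q)\<^sup>2 / (4 * \<mu>)" using pos(1) by simp
      also have "(2 * \<mu> * x - R * q)\<^sup>2 / (4 * \<mu>) = \<mu> * x\<^sup>2 - R * q * x + (R\<^sup>2 / (4 * \<mu>)) * q\<^sup>2"
        using pos(1) by (simp add: power2_eq_square field_simps)
      finally have "- ((R\<^sup>2 / (4 * \<mu>)) * q\<^sup>2) \<le> \<mu> * x\<^sup>2 - R * q * x" by linarith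
      then have "- ((R\<^sup>2 / (4 * \<mu>)) * q\<^sup>2) / j \<le> (\<mu> * x\<^sup>2 - R * q * x) / j" using j by (intro divide_right_mono) auto
      then have "\<kappa> * Qy z - (R\<^sup>2 / (4 * \<mu>)) * q\<^sup>2 / j \<le> cv * \<rho>0 y * \<theta>t z" unfolding e1 by simp
      then show "\<kappa> * Qy' z - (R\<^sup>2 / (4 * \<mu>)) * (\<rho>0 (fst z))\<^sup>2 * (\<theta>' z)\<^sup>2 / J' z \<le> cv * \<rho>0 (fst z) * \<theta>t' z"
        unfolding on[OF z] by (simp add: yt q_def j_def power_mult_distrib mult_ac)
    qed
  qed
  have \<alpha>: "R / cv > 0" using pos by simp
  obtain e e' C where C: "C > 0" and ec: "continuous_on UNIV e" and eP: "primitive_on UNIV e e'"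
    and em: "e' \<in> borel_measurable borel"
    and eb: "AE y in lborel. \<bar>e y\<bar> \<le> C * sqrt (\<rho>0 y) \<and> \<bar>e' y\<bar> \<le> C * \<rho>0 y \<and>
       \<bar>signed_integral 0 (\<lambda>x. J0 x * e x) y + (R / cv) * ln (\<rho>0 y)\<bar> \<le> C"
    using entropy_weight[OF \<alpha> \<rho>pos assms(7,25,28,29,30,10,11,12,14,27)] by blast
  \<comment> \<open>A real threshold below an essential infimum that is only known to exceed
    \<open>- \<infinity>\<close>.\<close>
  obtain m0 :: real where m0: "ereal m0 < ess_inf lborel (\<lambda>y. entropy cv R A (\<rho>0 y) (J0 y) (\<theta>0 y))"
    using ereal_dense2[OF assms(32)] by auto
  define c0 where "c0 = exp (m0 / cv - ln (R / A) - (R / cv) * ln Jh)"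
  have "AE y in lborel. - entropy cv R A (\<rho>0 y) (J0 y) (\<theta>0 y) \<le> esssup lborel (\<lambda>y. - entropy cv R A (\<rho>0 y) (J0 y) (\<theta>0 y))"
    by (rule esssup_AE)
  then have init: "AE y in lborel. c0 * \<rho>0 y powr (R / cv) \<le> \<theta>0 y"
    using assms(11,13) Jh(3)
  proof eventually_elim
    case (elim y)
    have "ess_inf lborel (\<lambda>y. entropy cv R A (\<rho>0 y) (J0 y) (\<theta>0 y)) \<le> entropy cv R A (\<rho>0 y) (J0 y) (\<theta>0 y)"
      using elim(1) unfolding ess_inf_def by (simp add: ereal_uminus_le_reorder)
    then have "ereal m0 \<le> entropy cv R A (\<rho>0 y) (J0 y) (\<theta>0 y)" using m0 by order
    then show ?case
      unfolding c0_def using elim(2-4) assms(10) \<rho>pos[of y] pos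
      by (intro entropy_lower_imp_temperature) auto
  qed
  interpret heat_supersolution T \<kappa> cv "R\<^sup>2 / (4 * \<mu>)" "R / cv" Jl Ju Jh \<rho>m c0 C CJ \<rho>0 J0 \<theta>0 e e' J' Jt' \<theta>' \<theta>t' \<theta>y' Qy'
  proof
    show "AE y in lborel. \<rho>0 y \<le> \<rho>m" using \<rho>m(3) by eventually_elim auto
    show "AE z in lborel. z \<in> strip T \<longrightarrow> Jl \<le> J' z \<and> J' z \<le> Ju" using Jb by eventually_elim (simp add: on)
    show "AE z in lborel. z \<in> strip T \<longrightarrow> 0 \<le> \<theta>' z" using \<theta>nn by eventually_elim (simp add: on)
  qed (fact T pos(2,3) \<alpha> Jl C \<rho>m(1,2) Jh(2,3) \<theta>0m em m \<rho>pos assms(25) Jti JtL2 Jeq \<theta>ti \<theta>eq \<theta>sl Qsl super ec eP eb init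
      | (use pos in \<open>simp add: c0_def CJ_def\<close>))+
  obtain c where c: "c > 0" "AE z in lborel. z \<in> strip T \<longrightarrow> c * \<rho>0 (fst z) powr (R / cv) \<le> \<theta>' z"
    using temperature_lower_bound by blast
  define m1 where "m1 = cv * (ln (R / A) + (R / cv) * ln Jl + ln c)"
  let ?M = "restrict_space lborel (strip T)"
  let ?s = "\<lambda>z. entropy cv R A (\<rho>0 (fst z)) (J z) (\<theta> z)"
  \<comment> \<open>\<open>esssup_I\<close> demands measurability, which holds for the entropy of
    the extensions \<open>J'\<close> and \<open>\<theta>'\<close>; on the strip they coincide with
    \<open>J\<close> and \<open>\<theta>\<close>.\<close>
  have sm: "(\<lambda>z. - ?s z) \<in> borel_measurable ?M"
  proof -
    have "(\<lambda>z. - entropy cv R A (\<rho>0 (fst z)) (J' z) (\<theta>' z)) \<in> borel_measurable borel"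
      unfolding entropy_def by measurable
    then have "(\<lambda>z. - entropy cv R A (\<rho>0 (fst z)) (J' z) (\<theta>' z)) \<in> borel_measurable ?M"
      by (intro measurable_restrict_space1) simp
    moreover have "space ?M = strip T" by (simp add: space_restrict_space)
    ultimately show ?thesis
      by (subst measurable_cong[of _ _ "\<lambda>z. - entropy cv R A (\<rho>0 (fst z)) (J' z) (\<theta>' z)"]) (simp_all add: on)
  qed
  have "AE z in lborel. z \<in> strip T \<longrightarrow> - ?s z \<le> - ereal m1"
    using c(2) Jb
  proof eventually_elim
    case (elim z)
    show ?case
    proof
      assume z: "z \<in> strip T"
      have "ereal m1 \<le> ?s z"
        unfolding m1_def using elim z pos c(1) Jl \<rho>pos
        by (intro temperature_lower_imp_entropy) (auto simp: on)
      then show "- ?s z \<le> - ereal m1" by (simp only: ereal_minus_le_minus)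
    qed
  qed
  then have "AE z in ?M. - ?s z \<le> - ereal m1"
    using Sb by (simp add: AE_restrict_space_iff S_def)
  then have "esssup ?M (\<lambda>z. - ?s z) \<le> - ereal m1" by (rule esssup_I[OF sm])
  then have "ereal m1 \<le> ess_inf ?M ?s"
    unfolding ess_inf_def by (metis ereal_minus_le_minus ereal_uminus_uminus)
  moreover have "?s = (\<lambda>(y, t). entropy cv R A (\<rho>0 y) (J (y, t)) (\<theta> (y, t)))" by auto
  ultimately show "- \<infinity> < ess_inf ?M (\<lambda>(y, t). entropy cv R A (\<rho>0 y) (J (y, t)) (\<theta> (y, t)))"
    using less_le_trans[of "- \<infinity>" "ereal m1"] by simp
qed

end
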